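(* Let $d\ge 1$, let $R_d=\mathbb{Z}[x_1^{\pm1},\dots,x_d^{\pm1}]$, and let $f\in R_d$ be irreducible and atoral. For every finite nonempty subset $\mathcal{F}\subset R_d$ there exists a number $M=M(f,\mathcal{F})\ge 1$ with the following property. For every finite subset $\mathcal{S}\subset\mathbb{Z}^d$ with $\|\mathbf{m}-\mathbf{n}\|\ge M$ for all $\mathbf{m}\ne\mathbf{n}$ in $\mathcal{S}$, and for every choice of $p^{(\mathbf{n})}\in\mathcal{F}$ for $\mathbf{n}\in\mathcal{S}$, if $f$ divides the sum $\sum_{\mathbf{n}\in\mathcal{S}}\mathbf{x}^{\mathbf{n}}p^{(\mathbf{n})}$ in $R_d$, then $f$ divides $p^{(\mathbf{n})}$ in $R_d$ for every $\mathbf{n}\in\mathcal{S}$.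
   Context: $R_d$ is the ring of Laurent polynomials with integer coefficients in $d$ commuting variables, and $\mathbf{x}^{\mathbf{n}}=x_1^{n_1}\cdots x_d^{n_d}$ for $\mathbf{n}=(n_1,\dots,n_d)\in\mathbb{Z}^d$. The units of $R_d$ are the elements $\pm\mathbf{x}^{\mathbf{n}}$; an element is irreducible if it is neither a unit nor a product of two non-units of $R_d$. For $\mathbf{n}\in\mathbb{Z}^d$ put $\|\mathbf{n}\|=\max_{1\le j\le d}|n_j|$. With $\mathbb{T}=\mathbb{R}/\mathbb{Z}$, the unitary variety of $f\in R_d$ is $$\mathsf{U}(f)=\{(t_1,\dots,t_d)\in\mathbb{T}^d: f(e^{2\pi i t_1},\dots,e^{2\pi i t_d})=0\}.$$ Under the identification of $\mathbb{T}^d$ with $\{z\in\mathbb{C}:|z|=1\}^d$, this is a real semialgebraic set, hence a finite disjoint union of cells, and its dimension $\dim\mathsf{U}(f)$ is the maximal dimension of these cells (independent of the cell decomposition). The polynomial $f$ is atoral if $\dim\mathsf{U}(f)\le d-2$; this includes the possibility $\mathsf{U}(f)=\varnothing$ (for every $d\ge 1$). *)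

theory Defs
  imports
    "HOL-Analysis.Analysis"
    "HOL-Library.Poly_Mapping"
    "HOL-Computational_Algebra.Factorial_Ring"
begin

text \<open>
  The Laurent polynomial ring in \<open>CARD('d)\<close> commuting variables is the group ring of \<open>\<int>\<^sup>d\<close>:
  finitely supported coefficient functions with convolution as multiplication.
\<close>

type_synonym 'd laurent = "(int ^ 'd) \<Rightarrow>\<^sub>0 int"

definition laurent_monom :: "int ^ 'd \<Rightarrow> 'd::finite laurent" where
  "laurent_monom n = Poly_Mapping.single n 1"

definition laurent_eval :: "'d::finite laurent \<Rightarrow> complex ^ 'd \<Rightarrow> complex" where
  "laurent_eval f z =
     (\<Sum>n\<in>Poly_Mapping.keys f. of_int (Poly_Mapping.lookup f n) * (\<Prod>j\<in>UNIV. (z $ j) powi (n $ j)))"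

definition max_norm :: "int ^ 'd \<Rightarrow> int" where
  "max_norm n = Max (range (\<lambda>j::'d::finite. \<bar>n $ j\<bar>))"

text \<open>
  \<open>(\<real>/\<int>)\<^sup>d\<close> is identified with the product of unit circles in \<open>\<complex>\<^sup>d\<close>; the unitary variety is taken
  as a subset of the latter, with points of \<open>(\<real>/\<int>)\<^sup>d\<close> given by arbitrary real representatives.
\<close>

definition torus_point :: "real ^ 'd \<Rightarrow> complex ^ 'd" where
  "torus_point t = (\<chi> j. exp (2 * of_real pi * \<i> * of_real (t $ j)))"

definition unitary_variety :: "'d::finite laurent \<Rightarrow> (complex ^ 'd) set" where
  "unitary_variety f = torus_point ` {t. laurent_eval f (torus_point t) = 0}"

text \<open>
  Semialgebraic sets: the smallest Boolean algebra of sets containing all \<open>{x. 0 < p x}\<close> with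
  \<open>p\<close> a real polynomial in the real coordinates.
\<close>

inductive semialgebraic :: "'a::euclidean_space set \<Rightarrow> bool" where
  pos: "real_polynomial_function p \<Longrightarrow> semialgebraic {x. 0 < p x}"
| compl: "semialgebraic A \<Longrightarrow> semialgebraic (- A)"
| union: "semialgebraic A \<Longrightarrow> semialgebraic B \<Longrightarrow> semialgebraic (A \<union> B)"

definition semialgebraic_map_on :: "'a::euclidean_space set \<Rightarrow> ('a \<Rightarrow> 'b::euclidean_space) \<Rightarrow> bool" where
  "semialgebraic_map_on A g \<longleftrightarrow> semialgebraic ((\<lambda>x. (x, g x)) ` A)"

text \<open>
  A copy of \<open>(0,1)\<^sup>k\<close>, \<open>k = card B\<close>, spanned by the coordinate directions in \<open>B \<subseteq> Basis\<close>.
  For \<open>B = {}\<close> it is a point.  Since a \<open>k\<close>-dimensional cell in a Euclidean space has \<open>k\<close> at most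
  the dimension of that space, the model cubes can be taken inside the ambient space.
\<close>

definition open_cube :: "'a::euclidean_space set \<Rightarrow> 'a set" where
  "open_cube B = {x. (\<forall>b\<in>B. 0 < x \<bullet> b \<and> x \<bullet> b < 1) \<and> (\<forall>b\<in>Basis - B. x \<bullet> b = 0)}"

definition cell :: "nat \<Rightarrow> 'a::euclidean_space set \<Rightarrow> bool" where
  "cell k C \<longleftrightarrow> semialgebraic C \<and>
     (\<exists>(B :: 'a set) g h. B \<subseteq> Basis \<and> card B = k \<and> homeomorphism (open_cube B) C g h \<and>
        semialgebraic_map_on (open_cube B) g)"

definition cell_decomposition :: "'a::euclidean_space set \<Rightarrow> 'a set set \<Rightarrow> bool" where
  "cell_decomposition S D \<longleftrightarrow>
     finite D \<and> disjoint D \<and> \<Union>D = S \<and> (\<forall>C\<in>D. \<exists>k. cell k C)"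

text \<open>The maximal dimension of the cells in \<open>D\<close>; it is \<open>-\<infinity>\<close> if there are none.\<close>

definition max_cell_dim :: "'a::euclidean_space set set \<Rightarrow> ereal" where
  "max_cell_dim D = Sup {ereal (real k) | k C. C \<in> D \<and> cell k C}"

text \<open>
  For semialgebraic \<open>S\<close> a decomposition exists and \<open>max_cell_dim\<close> takes the same value on all of
  them, so the infimum is this common value.  In particular the empty set has dimension \<open>-\<infinity>\<close>.
\<close>

definition semialg_dim :: "'a::euclidean_space set \<Rightarrow> ereal" where
  "semialg_dim S = Inf {max_cell_dim D | D. cell_decomposition S D}"

text \<open>The bound is a real number, not a truncated one: for \<open>d = 1\<close> it is \<open>-1\<close>.\<close>

definition atoral :: "'d::finite laurent \<Rightarrow> bool" where
  "atoral f \<longleftrightarrow> semialg_dim (unitary_variety f) \<le> ereal (real CARD('d) - 2)"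

end

theory Submission
  imports Defs "HOL-Complex_Analysis.Great_Picard"
begin

text \<open>
  Suppose that \<open>f\<close> does not divide \<open>g\<close> and \<open>\<bar>g\<bar>\<^sup>2 \<le> C \<bar>f\<bar>\<close> on the torus. For large \<open>a\<close> the quotient
  \<open>g\<^sup>a / f\<close> is then smooth enough for its Fourier coefficients \<open>w\<close> to be summable, and the convolution
  of \<open>f\<close> and \<open>w\<close> is \<open>g\<^sup>a\<close>. If \<open>f\<close> divides a sum of widely separated translates of the \<open>p\<^sup>(\<^sup>n\<^sup>)\<close>, the
  convolution of this sum with \<open>w\<close> is integer valued, and near the \<open>n\<close>-th translate it differs from that
  of \<open>p\<^sup>(\<^sup>n\<^sup>)\<close> alone only by a small tail of \<open>w\<close>. Cutting it off around the translate yields an integer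
  polynomial \<open>u\<close> such that \<open>f u - p\<^sup>(\<^sup>n\<^sup>) g\<^sup>a\<close> is integer valued and smaller than \<open>1\<close>, hence zero; as \<open>f\<close> is
  prime, it divides \<open>p\<^sup>(\<^sup>n\<^sup>)\<close>.

  To find \<open>g\<close>, let \<open>f\<^sup>*(x) = f(x\<^sup>-\<^sup>1)\<close>, which is the complex conjugate of \<open>f\<close> on the torus. If \<open>f\<close> does not
  divide \<open>f\<^sup>*\<close>, take \<open>g = f\<^sup>*\<close>. Otherwise \<open>f\<^sup>* = \<plusminus>x\<^sup>m f\<close>, and \<open>f\<close> becomes a real function \<open>\<phi>\<close> on \<open>\<real>\<^sup>d\<close> after
  multiplication by \<open>x\<^sup>m\<^sup>/\<^sup>2\<close> and possibly \<open>\<i>\<close>. This function has constant sign: at a sign change along a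
  coordinate axis, elimination gives a zero at which the corresponding partial derivative does not vanish;
  near it \<open>U(f)\<close> contains a hypersurface, which by Baire's theorem and invariance of dimension cannot be
  covered by finitely many cells of dimension at most \<open>d - 2\<close>. A function of constant sign satisfies
  \<open>\<bar>\<nabla>\<phi>\<bar>\<^sup>2 \<le> C \<bar>\<phi>\<bar>\<close>, so \<open>g\<close> can be taken to be a partial derivative.
\<close>

section \<open>Truncation of Laurent polynomials and monomial units\<close>

abbreviation coef :: "'d laurent \<Rightarrow> int ^ 'd \<Rightarrow> int" where
  "coef \<equiv> Poly_Mapping.lookup"

abbreviation supp :: "'d laurent \<Rightarrow> (int ^ 'd) set" where
  "supp \<equiv> Poly_Mapping.keys"

text \<open>This single truncation serves to pass to subrings, to extract homogeneous components,
  and to cut an infinite quotient off around one translate.\<close>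

lift_definition restr :: "('a \<Rightarrow> bool) \<Rightarrow> ('a \<Rightarrow>\<^sub>0 int) \<Rightarrow> ('a \<Rightarrow>\<^sub>0 int)"
  is "\<lambda>P f n. if P n then f n else 0"
  by (rule finite_subset) auto

lemma keys_restr: "Poly_Mapping.keys (restr P f) = {n \<in> Poly_Mapping.keys f. P n}"
  by (auto simp: in_keys_iff restr.rep_eq split: if_splits)

lemma restr_add: "restr P (f + g) = restr P f + restr P g"
  by (rule poly_mapping_eqI) (simp add: restr.rep_eq lookup_add)

lemma restr_zero [simp]: "restr P 0 = 0"
  by (rule poly_mapping_eqI) (simp add: restr.rep_eq)

lemma restr_sum: "restr P (sum f A) = (\<Sum>i\<in>A. restr P (f i))"
  by (induction A rule: infinite_finite_induct) (auto simp: restr_add)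

lemma restr_id: "(\<And>n. n \<in> Poly_Mapping.keys f \<Longrightarrow> P n) \<Longrightarrow> restr P f = f"
  by (rule poly_mapping_eqI) (auto simp: restr.rep_eq in_keys_iff)

lemma restr_eq_0: "(\<And>n. n \<in> Poly_Mapping.keys f \<Longrightarrow> \<not> P n) \<Longrightarrow> restr P f = 0"
  by (rule poly_mapping_eqI) (auto simp: restr.rep_eq in_keys_iff)

lemma restr_split: "f = restr P f + restr (\<lambda>n. \<not> P n) f"
  by (rule poly_mapping_eqI) (simp add: restr.rep_eq lookup_add)

text \<open>Every exponent of \<open>a\<close> carries exponents satisfying \<open>Q\<close> to
  exponents satisfying \<open>P\<close>, and the others to exponents violating \<open>P\<close>; so
  the two parts of \<open>f\<close> do not mix in the product.\<close>

lemma restr_mult: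
  assumes "\<And>m n. m \<in> supp a \<Longrightarrow> P (m + n) \<longleftrightarrow> Q n"
  shows "restr P (a * f) = a * restr Q f"
proof -
  have "restr P (a * restr Q f) = a * restr Q f"
  proof (rule restr_id)
    fix n assume "n \<in> supp (a * restr Q f)"
    then obtain x y where "n = x + y" "x \<in> supp a" "y \<in> supp (restr Q f)"
      using keys_mult[of a "restr Q f"] by auto
    then show "P n" using assms by (auto simp: keys_restr)
  qed
  moreover have "restr P (a * restr (\<lambda>n. \<not> Q n) f) = 0"
  proof (rule restr_eq_0)
    fix n assume "n \<in> supp (a * restr (\<lambda>n. \<not> Q n) f)"
    then obtain x y where "n = x + y" "x \<in> supp a" "y \<in> supp (restr (\<lambda>n. \<not> Q n) f)"
      using keys_mult[of a "restr (\<lambda>n. \<not> Q n) f"] by auto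
    then show "\<not> P n" using assms by (auto simp: keys_restr)
  qed
  moreover have "a * f = a * restr Q f + a * restr (\<lambda>n. \<not> Q n) f"
    by (metis restr_split distrib_left)
  ultimately show ?thesis by (simp add: restr_add)
qed

lemma laurent_monom_mult: "laurent_monom m * laurent_monom n = laurent_monom (m + n)"
  by (simp add: laurent_monom_def mult_single)

lemma laurent_monom_0 [simp]: "laurent_monom 0 = 1"
  by (simp add: laurent_monom_def)

lemma laurent_monom_cancel [simp]:
  "laurent_monom n * (laurent_monom (- n) * f) = f" "laurent_monom (- n) * (laurent_monom n * f) = f"
  by (simp_all flip: mult.assoc add: laurent_monom_mult)

lemma laurent_monom_unit [simp]: "laurent_monom n dvd 1"
  by (rule dvdI[of _ _ "laurent_monom (-n)"]) (simp add: laurent_monom_mult)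

lemma dvd_laurent_monom_mult [simp]: "f dvd laurent_monom n * g \<longleftrightarrow> f dvd g"
proof
  assume "f dvd laurent_monom n * g"
  then have "f dvd laurent_monom (- n) * (laurent_monom n * g)" by (rule dvd_mult)
  then show "f dvd g" by simp
qed (rule dvd_mult)

lemma laurent_monom_mult_dvd [simp]: "laurent_monom n * f dvd g \<longleftrightarrow> f dvd g"
proof
  assume "f dvd g"
  then obtain k where "g = f * k" by (rule dvdE)
  then have "g = (laurent_monom n * f) * (laurent_monom (- n) * k)"
    by (simp add: mult.assoc mult.left_commute[of _ f])
  then show "laurent_monom n * f dvd g" by (rule dvdI)
qed (rule dvd_mult_right)

lemma keys_monom_mult: "supp (laurent_monom n * f) \<subseteq> (+) n ` supp f"
  using keys_mult[of "laurent_monom n" f] by (auto simp: laurent_monom_def split: if_splits)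

lemma axis_plus: "axis j a + axis j b = axis j (a + b :: 'a::comm_monoid_add)"
  by (simp add: axis_def vec_eq_iff)

section \<open>Subrings of Laurent polynomials in some of the variables\<close>

text \<open>A subset of the full ring rather than a type of its own, so that unique factorisation
  can be proved by induction on the set of variables.\<close>

definition lring :: "'d set \<Rightarrow> 'd::finite laurent set" where
  "lring J = {f. \<forall>n\<in>supp f. \<forall>i. i \<notin> J \<longrightarrow> n $ i = 0}"

lemma lring_UNIV [simp]: "lring UNIV = UNIV"
  by (simp add: lring_def)

lemma lring_mono: "J \<subseteq> K \<Longrightarrow> f \<in> lring J \<Longrightarrow> f \<in> lring K"
  by (auto simp: lring_def)

lemma lring_0 [simp]: "0 \<in> lring J"
  by (simp add: lring_def)

lemma lring_1 [simp]: "1 \<in> lring J"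
  by (simp add: lring_def)

lemma lring_add [simp]: "f \<in> lring J \<Longrightarrow> g \<in> lring J \<Longrightarrow> f + g \<in> lring J"
  using keys_add[of f g] by (fastforce simp: lring_def)

lemma lring_uminus [simp]: "f \<in> lring J \<Longrightarrow> - f \<in> lring J"
  by (auto simp: lring_def)

lemma lring_diff [simp]: "f \<in> lring J \<Longrightarrow> g \<in> lring J \<Longrightarrow> f - g \<in> lring J"
  using lring_add[of f J "- g"] by simp

lemma lring_mult [simp]:
  assumes "f \<in> lring J" "g \<in> lring J" shows "f * g \<in> lring J"
  unfolding lring_def
proof (clarify)
  fix n i assume "n \<in> supp (f * g)" "i \<notin> J"
  then obtain x y where "n = x + y" "x \<in> supp f" "y \<in> supp g"
    using keys_mult[of f g] by auto
  then show "n $ i = 0" using assms \<open>i \<notin> J\<close> by (auto simp: lring_def)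
qed

lemma lring_prod_list [simp]: "set ps \<subseteq> lring J \<Longrightarrow> prod_list ps \<in> lring J"
  by (induction ps) auto

lemma lring_monom: "(\<And>i. i \<notin> J \<Longrightarrow> n $ i = 0) \<Longrightarrow> laurent_monom n \<in> lring J"
  by (auto simp: lring_def laurent_monom_def)

lemma lring_monom_axis [simp]: "laurent_monom (axis j k) \<in> lring (insert j J)"
  by (rule lring_monom) (auto simp: axis_def)

text \<open>Cutting a quotient from the full ring down to exponents supported in \<open>J\<close>
  does not change the product. Hence divisibility in \<open>lring J\<close> agrees with
  \<open>dvd\<close>, which can be used for all subrings at once.\<close>

lemma lring_dvdE:
  assumes "a \<in> lring J" "b \<in> lring J" "a dvd b"
  obtains q where "q \<in> lring J" "b = a * q"
proof -
  obtain q where q: "b = a * q" using assms by (auto elim: dvdE)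
  define P where "P = (\<lambda>n::int^'a. \<forall>i. i \<notin> J \<longrightarrow> n $ i = 0)"
  have "restr P b = b"
    by (rule restr_id) (use assms in \<open>auto simp: lring_def P_def\<close>)
  moreover have "restr P (a * q) = a * restr P q"
    by (rule restr_mult) (use assms in \<open>auto simp: lring_def P_def\<close>)
  moreover have "restr P q \<in> lring J"
    by (auto simp: lring_def keys_restr P_def)
  ultimately show ?thesis using that q by metis
qed

text \<open>The component keeps its power of the variable \<open>j\<close>; multiplication by
  \<open>laurent_monom (axis j (- i))\<close> turns it into a coefficient free of that
  variable.\<close>

definition hcomp :: "'d \<Rightarrow> int \<Rightarrow> 'd::finite laurent \<Rightarrow> 'd laurent" where
  "hcomp j i f = restr (\<lambda>n. n $ j = i) f"

lemma keys_hcomp: "supp (hcomp j i f) = {n \<in> supp f. n $ j = i}"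
  by (simp add: hcomp_def keys_restr)

lemma hcomp_zero [simp]: "hcomp j i 0 = 0"
  by (simp add: hcomp_def)

lemma hcomp_eq_0_iff: "hcomp j i f = 0 \<longleftrightarrow> (\<forall>n\<in>supp f. n $ j \<noteq> i)"
  by (auto simp flip: keys_eq_empty simp: keys_hcomp)

lemma hcomp_mult_homogeneous:
  assumes "\<And>n. n \<in> supp a \<Longrightarrow> n $ j = i"
  shows "hcomp j k (a * f) = a * hcomp j (k - i) f"
  unfolding hcomp_def by (rule restr_mult) (use assms in auto)

lemma hcomp_mult_lring:
  assumes "a \<in> lring J" "j \<notin> J" shows "hcomp j k (a * f) = a * hcomp j k f"
  using hcomp_mult_homogeneous[of a j 0] assms by (auto simp: lring_def)

lemma sum_hcomp:
  assumes "finite I" "\<And>n. n \<in> supp f \<Longrightarrow> n $ j \<in> I"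
  shows "(\<Sum>i\<in>I. hcomp j i f) = f"
proof (rule poly_mapping_eqI)
  fix n
  have "coef (\<Sum>i\<in>I. hcomp j i f) n = (\<Sum>i\<in>I. if n $ j = i then coef f n else 0)"
    by (simp add: lookup_sum hcomp_def restr.rep_eq)
  also have "\<dots> = (if n $ j \<in> I then coef f n else 0)" using assms by simp
  also have "\<dots> = coef f n" using assms by (auto simp: in_keys_iff)
  finally show "coef (\<Sum>i\<in>I. hcomp j i f) n = coef f n" .
qed

lemma hcomp_mult:
  assumes "finite I" "\<And>n. n \<in> supp f \<Longrightarrow> n $ j \<in> I"
  shows "hcomp j k (f * g) = (\<Sum>i\<in>I. hcomp j i f * hcomp j (k - i) g)"
proof -
  have "f * g = (\<Sum>i\<in>I. hcomp j i f * g)"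
    using sum_hcomp[OF assms] by (simp flip: sum_distrib_right)
  then have "hcomp j k (f * g) = (\<Sum>i\<in>I. hcomp j k (hcomp j i f * g))"
    by (simp add: hcomp_def restr_sum)
  also have "\<dots> = (\<Sum>i\<in>I. hcomp j i f * hcomp j (k - i) g)"
    by (intro sum.cong refl hcomp_mult_homogeneous) (auto simp: keys_hcomp)
  finally show ?thesis .
qed

lemma dvd_iff_dvd_hcomp:
  assumes "a \<in> lring J" "j \<notin> J"
  shows "a dvd f \<longleftrightarrow> (\<forall>i. a dvd hcomp j i f)"
proof
  assume "a dvd f"
  then show "\<forall>i. a dvd hcomp j i f"
    using hcomp_mult_lring[OF assms] by (auto elim!: dvdE)
next
  assume "\<forall>i. a dvd hcomp j i f"
  then have "a dvd (\<Sum>i\<in>(\<lambda>n. n $ j) ` supp f. hcomp j i f)"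
    by (intro dvd_sum) auto
  then show "a dvd f" by (subst (asm) sum_hcomp) auto
qed

lemma hcomp_in_lring:
  assumes "f \<in> lring (insert j J)"
  shows "laurent_monom (axis j (- i)) * hcomp j i f \<in> lring J"
  unfolding lring_def
proof clarify
  fix n k assume n: "n \<in> supp (laurent_monom (axis j (- i)) * hcomp j i f)" and k: "k \<notin> J"
  then obtain m where "m \<in> supp f" "m $ j = i" "n = axis j (-i) + m"
    using keys_monom_mult by (fastforce simp: keys_hcomp)
  then show "n $ k = 0" using assms k by (cases "k = j") (auto simp: lring_def axis_def)
qed

text \<open>Zero and units are not excluded: \<open>lprime J 0\<close> expresses that
  \<open>lring J\<close> has no zero divisors.\<close>

definition lprime :: "'d set \<Rightarrow> 'd::finite laurent \<Rightarrow> bool" where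
  "lprime J p \<longleftrightarrow> p \<in> lring J \<and> (\<forall>a\<in>lring J. \<forall>b\<in>lring J. p dvd a * b \<longrightarrow> p dvd a \<or> p dvd b)"

text \<open>Gauss's lemma. If \<open>p\<close> divides neither factor, take in each the component of
  highest degree in \<open>j\<close> that \<open>p\<close> does not divide. Modulo \<open>p\<close>,
  only their product contributes to the component of the product in degree
  \<open>a + b\<close>.\<close>

lemma lprime_insert:
  assumes "lprime J p" "j \<notin> J"
  shows "lprime (insert j J) p"
  unfolding lprime_def
proof (intro conjI ballI impI)
  have p: "p \<in> lring J" using assms by (simp add: lprime_def)
  then show "p \<in> lring (insert j J)" by (rule lring_mono[rotated]) auto
  fix f g assume f: "f \<in> lring (insert j J)" and g: "g \<in> lring (insert j J)" and dvd: "p dvd f * g"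
  show "p dvd f \<or> p dvd g"
  proof (rule ccontr)
    assume neg: "\<not> (p dvd f \<or> p dvd g)"
    define A where "A h = {i. \<not> p dvd hcomp j i h}" for h
    have fin: "finite (A h)" for h
    proof (rule finite_subset)
      show "A h \<subseteq> (\<lambda>n. n $ j) ` supp h"
      proof
        fix i assume "i \<in> A h"
        then have "hcomp j i h \<noteq> 0" by (auto simp: A_def)
        then show "i \<in> (\<lambda>n. n $ j) ` supp h" by (auto simp: hcomp_eq_0_iff)
      qed
    qed auto
    have "A h \<noteq> {}" if "\<not> p dvd h" for h
      using that dvd_iff_dvd_hcomp[OF p assms(2), of h] unfolding A_def by blast
    then have ne: "A f \<noteq> {}" "A g \<noteq> {}" using neg by auto
    define a b where "a = Max (A f)" "b = Max (A g)"
    have a: "\<not> p dvd hcomp j a f" and b: "\<not> p dvd hcomp j b g"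
      using Max_in[OF fin ne(1)] Max_in[OF fin ne(2)] by (auto simp: a_b_def A_def)
    have a': "p dvd hcomp j i f" if "i > a" for i
      using Max_ge[OF fin, of i f] that by (force simp: a_b_def A_def)
    have b': "p dvd hcomp j i g" if "i > b" for i
      using Max_ge[OF fin, of i g] that by (force simp: a_b_def A_def)
    define I where "I = insert a ((\<lambda>n. n $ j) ` supp f)"
    have "hcomp j (a + b) (f * g) = (\<Sum>i\<in>I. hcomp j i f * hcomp j (a + b - i) g)"
      by (rule hcomp_mult) (auto simp: I_def)
    also have "\<dots> = hcomp j a f * hcomp j b g + (\<Sum>i\<in>I - {a}. hcomp j i f * hcomp j (a + b - i) g)"
      by (subst sum.remove[of _ a]) (auto simp: I_def)
    finally have eq: "hcomp j (a + b) (f * g) = \<dots>" .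
    have "p dvd (\<Sum>i\<in>I - {a}. hcomp j i f * hcomp j (a + b - i) g)"
    proof (rule dvd_sum)
      fix i assume "i \<in> I - {a}"
      \<comment> \<open>If \<open>i\<close> is below \<open>a\<close>, then the complementary degree
        exceeds \<open>b\<close>.\<close>
      then consider "i > a" | "a + b - i > b" by fastforce
      then show "p dvd hcomp j i f * hcomp j (a + b - i) g"
        using a' b' by cases (auto intro: dvd_mult dvd_mult2)
    qed
    moreover have "p dvd hcomp j (a + b) (f * g)"
      using dvd dvd_iff_dvd_hcomp[OF p assms(2), of "f * g"] by blast
    ultimately have "p dvd hcomp j a f * hcomp j b g"
      unfolding eq using dvd_add_left_iff by blast
    \<comment> \<open>Primality of \<open>p\<close> is known only in \<open>lring J\<close>, so both
      components are first shifted to degree 0.\<close>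
    then have "p dvd laurent_monom (axis j (-a)) * laurent_monom (axis j (-b)) * (hcomp j a f * hcomp j b g)"
      by (rule dvd_mult)
    also have "\<dots> = (laurent_monom (axis j (-a)) * hcomp j a f) * (laurent_monom (axis j (-b)) * hcomp j b g)"
      by (simp only: mult_ac)
    finally have "p dvd (laurent_monom (axis j (-a)) * hcomp j a f) * (laurent_monom (axis j (-b)) * hcomp j b g)" .
    then have "p dvd (laurent_monom (axis j (-a)) * hcomp j a f) \<or> p dvd (laurent_monom (axis j (-b)) * hcomp j b g)"
      using assms(1) hcomp_in_lring[OF f] hcomp_in_lring[OF g] unfolding lprime_def by blast
    then show False using a b by simp
  qed
qed

lemma lring_empty_eq: "f \<in> lring {} \<Longrightarrow> f = of_int (coef f 0)"
proof (rule poly_mapping_eqI)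
  fix n assume "f \<in> lring {}"
  then have "coef f n = 0" if "n \<noteq> 0"
    using that by (auto simp: lring_def vec_eq_iff in_keys_iff)
  then show "coef f n = coef (of_int (coef f 0)) n"
    by (cases "n = 0") (auto simp: lookup_of_int)
qed

lemma lring_of_int [simp]: "of_int c \<in> lring J"
  by (auto simp: lring_def in_keys_iff lookup_of_int when_def split: if_splits)

lemma coef_of_int_mult:
  fixes q :: "'d::finite laurent" shows "coef (of_int a * q) n = a * coef q n"
proof -
  have "of_int a * q = Poly_Mapping.single 0 a * q"
    by (simp flip: single_of_int[where 'b = int])
  also have "\<dots> = Poly_Mapping.map ((*) a) q"
    by (rule mult_map_scale_conv_mult[symmetric])
  finally show ?thesis by (simp add: map.rep_eq when_def)
qed

lemma of_int_laurent_dvd_iff: "(of_int a :: 'd::finite laurent) dvd of_int b \<longleftrightarrow> a dvd b"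
proof
  assume "(of_int a :: 'd laurent) dvd of_int b"
  then obtain q :: "'d laurent" where "of_int b = of_int a * q" by (auto elim: dvdE)
  then have "coef (of_int b :: 'd laurent) 0 = a * coef q 0" by (simp add: coef_of_int_mult)
  then show "a dvd b" by (simp add: lookup_of_int)
next
  assume "a dvd b"
  then obtain k where "b = a * k" by (rule dvdE)
  then show "(of_int a :: 'd laurent) dvd of_int b" by simp
qed

section \<open>Unique factorisation\<close>

text \<open>Gauss's lemma applied to the prime 0 adds one variable at a time, starting from the
  integers.\<close>

lemma lprime_0: "lprime J (0 :: 'd::finite laurent)"
proof -
  have "finite J" by simp
  then show ?thesis
  proof (induction J rule: finite_induct)
    case empty
    have "a = 0 \<or> b = 0" if "a \<in> lring {}" "b \<in> lring {}" "a * b = 0" for a b :: "'d laurent"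
    proof -
      have "of_int (coef a 0 * coef b 0) = (0 :: 'd laurent)"
        using lring_empty_eq[OF that(1)] lring_empty_eq[OF that(2)] that(3) by (metis of_int_mult)
      then have "coef a 0 = 0 \<or> coef b 0 = 0" by (simp only: of_int_eq_0_iff mult_eq_0_iff)
      then show ?thesis
        using lring_empty_eq[OF that(1)] lring_empty_eq[OF that(2)] by (metis of_int_0)
    qed
    then show ?case by (auto simp: lprime_def)
  next
    case (insert j J)
    then show ?case by (intro lprime_insert)
  qed
qed

lemma laurent_mult_eq_0_iff [simp]:
  fixes a b :: "'d::finite laurent" shows "a * b = 0 \<longleftrightarrow> a = 0 \<or> b = 0"
  using lprime_0[of UNIV] by (auto simp: lprime_def)

lemma laurent_mult_left_cancel:
  fixes a b c :: "'d::finite laurent" assumes "a * b = a * c" "a \<noteq> 0" shows "b = c"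
proof -
  have "a * (b - c) = 0" using assms by (simp add: right_diff_distrib)
  then show ?thesis using assms(2) by simp
qed

lemma laurent_dvd_mult_cancel_left:
  fixes a b c :: "'d::finite laurent" assumes "a * b dvd a * c" "a \<noteq> 0" shows "b dvd c"
proof -
  obtain k where "a * c = a * b * k" using assms(1) by (rule dvdE)
  then have "c = b * k" using assms(2) by (rule_tac laurent_mult_left_cancel[of a]) (simp_all add: mult.assoc)
  then show ?thesis by simp
qed

lemma unit_mult_dvd: "u dvd (1::'a::comm_ring_1) \<Longrightarrow> p dvd u * x \<Longrightarrow> p dvd x"
  by (metis dvd_def dvd_mult2 mult.commute mult.left_commute mult_1)

lemma laurent_monom_neq_0 [simp]: "laurent_monom n \<noteq> 0"
  by (metis laurent_monom_def lookup_single_eq lookup_zero zero_neq_one)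

lemma axis_0 [simp]: "axis j (0 :: 'a::zero) = 0"
  by (simp add: axis_def vec_eq_iff)

section \<open>Degrees and widths in one variable\<close>

definition topdeg :: "int \<Rightarrow> 'd \<Rightarrow> 'd::finite laurent \<Rightarrow> int" where
  "topdeg s j f = Max ((\<lambda>n. s * n $ j) ` supp f)"

text \<open>Since \<open>topdeg (-1) j f\<close> is minus the lowest exponent, this is highest minus
  lowest exponent. It replaces the degree, because multiplication by a monomial does not change
  it.\<close>

definition width :: "'d \<Rightarrow> 'd::finite laurent \<Rightarrow> int" where
  "width j f = topdeg 1 j f + topdeg (-1) j f"

lemma hcomp_diff: "hcomp j i (f - g) = hcomp j i f - hcomp j i g"
  by (rule poly_mapping_eqI) (simp add: hcomp_def restr.rep_eq lookup_minus)

lemma hcomp_gt_top: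
  assumes "s * s = 1" "s * k > topdeg s j f" shows "hcomp j k f = 0"
proof -
  have False if "n \<in> supp f" "n $ j = k" for n
  proof -
    have "s * k \<le> topdeg s j f" unfolding topdeg_def
      by (rule Max_ge) (use that in auto)
    then show False using assms by simp
  qed
  then show ?thesis by (auto simp: hcomp_eq_0_iff)
qed

lemma hcomp_top_neq_0:
  assumes "s * s = 1" "f \<noteq> 0" shows "hcomp j (s * topdeg s j f) f \<noteq> 0"
proof -
  have "topdeg s j f \<in> (\<lambda>n. s * n $ j) ` supp f"
    unfolding topdeg_def by (rule Max_in) (use assms in auto)
  then obtain n where n: "n \<in> supp f" "topdeg s j f = s * n $ j" by auto
  then have eq: "s * topdeg s j f = n $ j" using assms by (simp flip: mult.assoc)
  show ?thesis unfolding eq using n(1) by (auto simp: hcomp_eq_0_iff)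
qed

lemma top_eqI:
  assumes "s * s = 1" "hcomp j (s * a) f \<noteq> 0" "\<And>k. s * k > a \<Longrightarrow> hcomp j k f = 0"
  shows "topdeg s j f = a"
proof (rule antisym)
  have "f \<noteq> 0" using assms by auto
  then show "topdeg s j f \<le> a"
    using assms(3)[of "s * topdeg s j f"] hcomp_top_neq_0[OF assms(1), of f j] assms(1)
    by (metis mult.assoc mult_1 not_le)
  show "a \<le> topdeg s j f"
    using hcomp_gt_top[OF assms(1), of j f "s * a"] assms(1,2) by (metis mult.assoc mult_1 not_le)
qed

text \<open>The numbers \<open>a\<close> and \<open>b\<close> are only upper bounds for the degrees;
  this flexibility gives the vanishing of all higher components as well.\<close>

lemma hcomp_top_mult:
  assumes s: "s * s = 1" and f: "\<And>k. s * k > a \<Longrightarrow> hcomp j k f = 0"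
    and g: "\<And>k. s * k > b \<Longrightarrow> hcomp j k g = 0"
  shows "hcomp j (s * (a + b)) (f * g) = hcomp j (s * a) f * hcomp j (s * b) g"
proof -
  define I where "I = insert (s * a) ((\<lambda>n. n $ j) ` supp f)"
  have ss: "s * (s * x) = x" for x using s by (simp flip: mult.assoc)
  have "hcomp j (s * (a + b)) (f * g) = (\<Sum>i\<in>I. hcomp j i f * hcomp j (s * (a + b) - i) g)"
    by (rule hcomp_mult) (auto simp: I_def)
  also have "\<dots> = (\<Sum>i\<in>{s * a}. hcomp j i f * hcomp j (s * (a + b) - i) g)"
  proof (rule sum.mono_neutral_right)
    show "\<forall>i\<in>I - {s * a}. hcomp j i f * hcomp j (s * (a + b) - i) g = 0"
    proof
      fix i assume "i \<in> I - {s * a}"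
      then have "s * i \<noteq> a" using ss by auto
      then consider "s * i > a" | "s * (s * (a + b) - i) > b"
        by (force simp: right_diff_distrib ss)
      then show "hcomp j i f * hcomp j (s * (a + b) - i) g = 0"
        using f g by cases auto
    qed
  qed (auto simp: I_def)
  finally show ?thesis by (simp add: algebra_simps)
qed

lemma hcomp_gt_top_mult:
  assumes s: "s * s = 1" and f: "\<And>k. s * k > a \<Longrightarrow> hcomp j k f = 0"
    and g: "\<And>k. s * k > b \<Longrightarrow> hcomp j k g = 0" and k: "s * k > a + b"
  shows "hcomp j k (f * g) = 0"
proof -
  \<comment> \<open>Raising \<open>a\<close> to \<open>a'\<close> keeps an upper bound, and the
    component of \<open>f\<close> at the raised degree is zero.\<close>
  define a' where "a' = s * k - b"
  have "hcomp j (s * (a' + b)) (f * g) = hcomp j (s * a') f * hcomp j (s * b) g"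
    by (rule hcomp_top_mult) (use assms in \<open>auto simp: a'_def\<close>)
  moreover have "hcomp j (s * a') f = 0"
    by (rule f) (use k s in \<open>simp add: a'_def flip: mult.assoc\<close>)
  moreover have "s * (a' + b) = k" using s by (simp add: a'_def flip: mult.assoc)
  ultimately show ?thesis by simp
qed

lemma top_mult:
  assumes "s * s = 1" "f \<noteq> 0" "g \<noteq> 0"
  shows "topdeg s j (f * g) = topdeg s j f + topdeg s j g"
proof (rule top_eqI[OF assms(1)])
  have f: "hcomp j k f = 0" if "s * k > topdeg s j f" for k using hcomp_gt_top[OF assms(1) that] .
  have g: "hcomp j k g = 0" if "s * k > topdeg s j g" for k using hcomp_gt_top[OF assms(1) that] .
  show "hcomp j (s * (topdeg s j f + topdeg s j g)) (f * g) \<noteq> 0"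
    using hcomp_top_mult[OF assms(1) f g] assms by (simp add: hcomp_top_neq_0)
  show "hcomp j k (f * g) = 0" if "topdeg s j f + topdeg s j g < s * k" for k
    using hcomp_gt_top_mult[OF assms(1) f g that] .
qed

lemma width_mult: "f \<noteq> 0 \<Longrightarrow> g \<noteq> 0 \<Longrightarrow> width j (f * g) = width j f + width j g"
  by (simp add: width_def top_mult)

lemma hcomp_outside:
  assumes "k > topdeg 1 j f \<or> k < - topdeg (-1) j f" shows "hcomp j k f = 0"
  using assms hcomp_gt_top[of 1 j f k] hcomp_gt_top[of "-1" j f k] by auto

lemma bot_le_top: "f \<noteq> 0 \<Longrightarrow> - topdeg (-1) j f \<le> topdeg 1 j f"
  using hcomp_outside[of j f "- topdeg (-1) j f"] hcomp_top_neq_0[of "-1" f j] by force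

lemma width_nonneg: "f \<noteq> 0 \<Longrightarrow> 0 \<le> width j f"
  using bot_le_top[of f j] by (simp add: width_def)

lemma width_eq_0D:
  assumes "f \<noteq> 0" "width j f = 0" shows "hcomp j (topdeg 1 j f) f = f"
proof -
  have "(\<Sum>i\<in>{topdeg 1 j f}. hcomp j i f) = f"
  proof (rule sum_hcomp)
    fix n assume n: "n \<in> supp f"
    then have "hcomp j (n $ j) f \<noteq> 0" by (auto simp: hcomp_eq_0_iff)
    then show "n $ j \<in> {topdeg 1 j f}"
      using hcomp_outside[of j f "n $ j"] assms(2) by (force simp: width_def)
  qed simp
  then show ?thesis by simp
qed

text \<open>The leading coefficient in the variable \<open>j\<close>, shifted to degree 0 so that it
  lies in the smaller ring.\<close>

definition lcoef :: "'d \<Rightarrow> 'd::finite laurent \<Rightarrow> 'd laurent" where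
  "lcoef j f = laurent_monom (axis j (- topdeg 1 j f)) * hcomp j (topdeg 1 j f) f"

lemma lcoef_in_lring: "f \<in> lring (insert j J) \<Longrightarrow> lcoef j f \<in> lring J"
  unfolding lcoef_def by (rule hcomp_in_lring)

lemma lcoef_neq_0: "f \<noteq> 0 \<Longrightarrow> lcoef j f \<noteq> 0"
  using hcomp_top_neq_0[of 1 f j] by (simp add: lcoef_def)

lemma hcomp_monom_axis_mult: "hcomp j k (laurent_monom (axis j i) * f) = laurent_monom (axis j i) * hcomp j (k - i) f"
  by (rule hcomp_mult_homogeneous) (auto simp: laurent_monom_def axis_def)

text \<open>Cross-multiplying with the leading coefficients cancels the top terms. As
  \<open>c\<close> is no wider than \<open>f\<close>, aligning the tops puts the lowest exponent of
  the shifted \<open>c\<close> no lower than that of \<open>f\<close>, so nothing new appears at the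
  bottom.\<close>

lemma pseudo_division_step:
  assumes f: "f \<in> lring (insert j J)" "f \<noteq> 0" and c: "c \<in> lring (insert j J)" "c \<noteq> 0"
    and j: "j \<notin> J" and width: "width j c \<le> width j f"
  defines "h \<equiv> lcoef j c * f - lcoef j f * (laurent_monom (axis j (topdeg 1 j f - topdeg 1 j c)) * c)"
  assumes "h \<noteq> 0"
  shows "width j h < width j f"
proof -
  define a b where "a = topdeg 1 j c" "b = topdeg 1 j f"
  have comp_h: "hcomp j k h = lcoef j c * hcomp j k f - lcoef j f * (laurent_monom (axis j (b - a)) * hcomp j (k - (b - a)) c)" for k
    using lcoef_in_lring[OF f(1)] lcoef_in_lring[OF c(1)] j
    by (simp add: h_def a_b_def hcomp_diff hcomp_mult_lring[of _ J] hcomp_monom_axis_mult)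
  have "hcomp j b h = 0"
  proof -
    have "lcoef j f * (laurent_monom (axis j (b - a)) * hcomp j a c) =
        laurent_monom (axis j (- b)) * laurent_monom (axis j (b - a)) * (hcomp j a c * hcomp j b f)"
      by (simp only: lcoef_def mult_ac flip: a_b_def)
    also have "laurent_monom (axis j (- b)) * laurent_monom (axis j (b - a)) = laurent_monom (axis j (- a))"
      by (simp add: laurent_monom_mult axis_plus)
    also have "\<dots> * (hcomp j a c * hcomp j b f) = lcoef j c * hcomp j b f"
      by (simp only: lcoef_def mult_ac flip: a_b_def)
    finally show ?thesis by (simp add: comp_h)
  qed
  moreover have "hcomp j k h = 0" if "k > b" for k
    using that by (simp add: comp_h hcomp_outside a_b_def)
  ultimately have top: "topdeg 1 j h < b"
    using hcomp_top_neq_0[of 1 h j] \<open>h \<noteq> 0\<close> by (metis linorder_neqE_linordered_idom mult_1)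
  have "hcomp j k h = 0" if "k < - topdeg (-1) j f" for k
  proof -
    have "k - (b - a) < - topdeg (-1) j c"
      using that width by (simp add: width_def a_b_def)
    then show ?thesis using that by (simp add: comp_h hcomp_outside)
  qed
  then have "- topdeg (-1) j h \<ge> - topdeg (-1) j f"
    using hcomp_top_neq_0[of "-1" h j] \<open>h \<noteq> 0\<close> by force
  then show ?thesis using top by (simp add: width_def a_b_def)
qed

section \<open>Contents, primitive elements and Gauss's theorem\<close>

definition lprime_factor :: "'d set \<Rightarrow> 'd::finite laurent \<Rightarrow> bool" where
  "lprime_factor J p \<longleftrightarrow> lprime J p \<and> p \<noteq> 0 \<and> \<not> p dvd 1"

text \<open>Unique factorisation in the form of existence of factorisations into primes; uniqueness
  up to units follows from primality.\<close>

definition lfactorial :: "'d::finite set \<Rightarrow> bool" where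
  "lfactorial J \<longleftrightarrow> (\<forall>f\<in>lring J. f \<noteq> 0 \<longrightarrow> (\<exists>u ps. u dvd 1 \<and> f = u * prod_list ps \<and>
     (\<forall>p::'d laurent\<in>set ps. lprime_factor J p)))"

text \<open>For \<open>c\<close> in \<open>lring (insert j J)\<close> this means that the content of
  \<open>c\<close>, as a polynomial in the variable \<open>j\<close>, is a unit.\<close>

definition primitive :: "'d set \<Rightarrow> 'd::finite laurent \<Rightarrow> bool" where
  "primitive J c \<longleftrightarrow> (\<forall>p. lprime_factor J p \<longrightarrow> \<not> p dvd c)"

lemma lprime_dvd_prod_list:
  "lprime J p \<Longrightarrow> set ps \<subseteq> lring J \<Longrightarrow> p dvd prod_list ps \<Longrightarrow> p dvd 1 \<or> (\<exists>q\<in>set ps. p dvd q)"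
proof (induction ps)
  case (Cons q ps)
  then have "prod_list ps \<in> lring J" "q \<in> lring J" "p dvd q * prod_list ps" by auto
  then have "p dvd q \<or> p dvd prod_list ps" using Cons.prems(1) unfolding lprime_def by blast
  then show ?case using Cons by auto
qed auto

lemma lprime_factor_in_lring: "lprime_factor J p \<Longrightarrow> p \<in> lring J"
  by (simp add: lprime_factor_def lprime_def)

lemma lprime_factor_insert: "lprime_factor J p \<Longrightarrow> j \<notin> J \<Longrightarrow> lprime_factor (insert j J) p"
  by (simp add: lprime_factor_def lprime_insert)

text \<open>Write \<open>q = p * e\<close>. As \<open>q\<close> is prime it divides \<open>p\<close>
  or \<open>e\<close>; the first makes \<open>e\<close> a unit, and the second would make
  \<open>p\<close> one.\<close>

lemma lprime_factor_dvd:
  assumes p: "lprime_factor J p" and q: "lprime_factor J q" and "p dvd q"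
  obtains e where "e dvd 1" "q = p * e"
proof -
  obtain e where e: "e \<in> lring J" "q = p * e"
    using lring_dvdE assms lprime_factor_in_lring by metis
  have "q dvd p \<or> q dvd e"
    using q e lprime_factor_in_lring[OF p] unfolding lprime_factor_def lprime_def by (metis dvd_refl)
  then have "e dvd 1"
  proof
    assume "q dvd p"
    then have "p * e dvd p * 1" using e by simp
    then show ?thesis using laurent_dvd_mult_cancel_left p by (metis lprime_factor_def)
  next
    assume "q dvd e"
    then have "e * p dvd e * 1" using e by (simp add: mult.commute)
    moreover have "e \<noteq> 0" using e q by (auto simp: lprime_factor_def)
    ultimately have "p dvd 1" by (rule laurent_dvd_mult_cancel_left)
    then show ?thesis using p by (simp add: lprime_factor_def)
  qed
  then show ?thesis using that e by blast
qed

text \<open>Primes of \<open>lring J\<close> are split off from \<open>c\<close> one by one. Each of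
  them also divides the fixed nonzero component, and so removes one of its prime factors
  \<open>qs\<close>; hence the process stops.\<close>

lemma content_primitive_aux:
  assumes j: "j \<notin> J"
  shows "c \<in> lring (insert j J) \<Longrightarrow> hcomp j a c = u * prod_list qs \<Longrightarrow> hcomp j a c \<noteq> 0 \<Longrightarrow> u dvd 1 \<Longrightarrow>
    (\<forall>q\<in>set qs. lprime_factor J q) \<Longrightarrow>
    \<exists>ps c'. (\<forall>p\<in>set ps. lprime_factor J p) \<and> c' \<in> lring (insert j J) \<and> c = prod_list ps * c' \<and> primitive J c'"
proof (induction "length qs" arbitrary: qs c u rule: less_induct)
  case less
  show ?case
  proof (cases "primitive J c")
    case True
    then show ?thesis using less.prems by (intro exI[of _ "[]"]) auto
  next
    case False
    then obtain p where p: "lprime_factor J p" "p dvd c" by (auto simp: primitive_def)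
    have pJ: "p \<in> lring J" using lprime_factor_in_lring p by blast
    obtain d where d: "d \<in> lring (insert j J)" "c = p * d"
      using lring_dvdE[OF lring_mono[OF _ pJ] less.prems(1) p(2)] by blast
    have cd: "hcomp j a c = p * hcomp j a d" using d hcomp_mult_lring[OF pJ j] by simp
    then have "p dvd u * prod_list qs" using less.prems by (metis dvd_triv_left)
    then have "p dvd prod_list qs" using unit_mult_dvd less.prems by blast
    moreover have "set qs \<subseteq> lring J" using less.prems(5) lprime_factor_in_lring by blast
    ultimately obtain q where q: "q \<in> set qs" "p dvd q"
      using lprime_dvd_prod_list p(1) unfolding lprime_factor_def by blast
    obtain e where e: "e dvd 1" "q = p * e"
      using lprime_factor_dvd[OF p(1) _ q(2)] q(1) less.prems by blast
    obtain xs ys where qs: "qs = xs @ q # ys" using split_list[OF q(1)] by blast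
    have "p * hcomp j a d = p * (u * e * prod_list (xs @ ys))"
      using cd less.prems(2) e qs by (simp add: mult_ac)
    then have "hcomp j a d = u * e * prod_list (xs @ ys)"
      using p(1) by (rule_tac laurent_mult_left_cancel[of p]) (auto simp: lprime_factor_def)
    moreover have "hcomp j a d \<noteq> 0" using cd less.prems by auto
    moreover have "length (xs @ ys) < length qs" by (simp add: qs)
    moreover have "u * e dvd 1" using less.prems(4) e(1) by (metis mult_dvd_mono mult_1)
    moreover have "\<forall>q\<in>set (xs @ ys). lprime_factor J q"
      using less.prems(5) qs by auto
    ultimately obtain ps c' where *: "\<forall>p\<in>set ps. lprime_factor J p" "c' \<in> lring (insert j J)"
        "d = prod_list ps * c'" "primitive J c'"
      using less.hyps[of "xs @ ys" d "u * e"] d(1) by blast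
    show ?thesis
      by (intro exI[of _ "p # ps"] exI[of _ c']) (use * d p in \<open>auto simp: mult.assoc\<close>)
  qed
qed

lemma content_primitive:
  assumes "lfactorial J" "j \<notin> J" "c \<in> lring (insert j J)" "c \<noteq> 0"
  obtains ps c' where "\<forall>p\<in>set ps. lprime_factor J p" "c' \<in> lring (insert j J)"
    "c = prod_list ps * c'" "primitive J c'"
proof -
  obtain u qs where uqs: "u dvd 1" "lcoef j c = u * prod_list qs" "\<forall>q\<in>set qs. lprime_factor J q"
    using assms(1) lcoef_in_lring[OF assms(3)] lcoef_neq_0[OF assms(4)] unfolding lfactorial_def by blast
  define a where "a = topdeg 1 j c"
  have "hcomp j a c = laurent_monom (axis j a) * lcoef j c"
    by (simp add: lcoef_def a_def laurent_monom_mult axis_plus flip: mult.assoc)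
  then have "hcomp j a c = laurent_monom (axis j a) * u * prod_list qs"
    using uqs by (simp add: mult.assoc)
  moreover have "laurent_monom (axis j a) * u dvd 1" using uqs(1) by simp
  moreover have "hcomp j a c \<noteq> 0" using hcomp_top_neq_0[of 1 c j] assms(4) by (simp add: a_def)
  ultimately show ?thesis
    using content_primitive_aux[OF assms(2,3)] uqs(3) that by blast
qed

text \<open>By Gauss's lemma a prime \<open>p\<close> of \<open>lring J\<close> stays prime in the
  larger ring. From \<open>p dvd c * s\<close> and primitivity of \<open>c\<close> it divides the
  cofactor \<open>s\<close>, and can be cancelled.\<close>

lemma primitive_dvd_cancel:
  assumes "j \<notin> J" "c \<in> lring (insert j J)" "primitive J c" "\<forall>p\<in>set ps. lprime_factor J p"
    "h \<in> lring (insert j J)" "c dvd prod_list ps * h"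
  shows "c dvd h"
  using assms(4-6)
proof (induction ps)
  case (Cons p ps)
  let ?B = "insert j J"
  have p: "lprime_factor J p" "p \<in> lring ?B" "lprime ?B p"
    using Cons.prems(1) assms(1) lprime_factor_insert[of J p j] lprime_factor_in_lring[of ?B p]
    by (auto simp: lprime_factor_def)
  have "prod_list ps \<in> lring ?B"
    using Cons.prems(1) lprime_factor_in_lring lring_mono[of J ?B] by (intro lring_prod_list) auto
  then have "prod_list (p # ps) * h \<in> lring ?B" using p Cons.prems by simp
  then obtain s where s: "s \<in> lring ?B" "prod_list (p # ps) * h = c * s"
    using lring_dvdE[OF assms(2)] Cons.prems(3) by blast
  have "p dvd c * s" unfolding s(2)[symmetric] by (simp add: mult.assoc)
  then have "p dvd s"
    using p s(1) assms(2,3) unfolding lprime_def primitive_def by blast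
  then obtain s' where s': "s = p * s'" by (rule dvdE)
  have "p * (prod_list ps * h) = p * (c * s')"
    using s(2) s' by (simp add: mult_ac)
  then have "prod_list ps * h = c * s'"
    using p(1) by (rule_tac laurent_mult_left_cancel[of p]) (auto simp: lprime_factor_def)
  then show ?case using Cons by auto
qed auto

text \<open>
  Pseudo-division by an element \<open>k c\<close> of minimal width in the ideal generated by \<open>f\<close> and \<open>g\<close>, with
  \<open>c\<close> primitive, shows that \<open>c\<close> divides a multiple of each by an element of \<open>lring J\<close>, hence each of them.
\<close>

lemma bezout_common_divisor:
  assumes fac: "lfactorial J" and j: "j \<notin> J"
    and f: "f \<in> lring (insert j J)" "f \<noteq> 0" and g: "g \<in> lring (insert j J)"
  obtains c k u v where "c dvd f" "c dvd g" "c \<in> lring (insert j J)" "k \<in> lring J" "k \<noteq> 0"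
    "k * c = u * f + v * g"
proof -
  let ?B = "insert j J"
  define I where "I = {u * f + v * g | u v. u \<in> lring ?B \<and> v \<in> lring ?B}"
  have memI: "u * f + v * g \<in> I" if "u \<in> lring ?B" "v \<in> lring ?B" for u v
    using that by (auto simp: I_def)
  have fI: "f \<in> I" and gI: "g \<in> I" using memI[of 1 0] memI[of 0 1] by auto
  have IB: "I \<subseteq> lring ?B" using f g by (auto simp: I_def)
  have I_comb: "a * x - b * y \<in> I" if "x \<in> I" "y \<in> I" "a \<in> lring ?B" "b \<in> lring ?B" for a b x y
  proof -
    obtain u v u' v' where *: "x = u * f + v * g" "y = u' * f + v' * g"
      "u \<in> lring ?B" "v \<in> lring ?B" "u' \<in> lring ?B" "v' \<in> lring ?B"
      using \<open>x \<in> I\<close> \<open>y \<in> I\<close> by (auto simp: I_def)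
    have "a * x - b * y = (a * u - b * u') * f + (a * v - b * v') * g"
      by (simp add: * algebra_simps)
    then show ?thesis using memI[of "a * u - b * u'" "a * v - b * v'"] that * by simp
  qed
  obtain c where c: "c \<in> I" "c \<noteq> 0" "\<And>h. h \<in> I \<Longrightarrow> h \<noteq> 0 \<Longrightarrow> nat (width j c) \<le> nat (width j h)"
    using ex_has_least_nat[of "\<lambda>h. h \<in> I \<and> h \<noteq> 0" f "\<lambda>h. nat (width j h)"] fI f(2) by blast
  have cB: "c \<in> lring ?B" using c IB by blast
  \<comment> \<open>Minimality of the width of \<open>c\<close> makes pseudo-division applicable to
    every nonzero element of \<open>I\<close>. The remainder is in \<open>I\<close> again and
    narrower, so the induction ends with remainder 0.\<close>
  have div: "\<exists>k\<in>lring J. k \<noteq> 0 \<and> c dvd k * h" if "h \<in> I" for h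
    using that
  proof (induction "nat (width j h)" arbitrary: h rule: less_induct)
    case less
    show ?case
    proof (cases "h = 0")
      case False
      define h' where "h' = lcoef j c * h - lcoef j h * (laurent_monom (axis j (topdeg 1 j h - topdeg 1 j c)) * c)"
      have hB: "h \<in> lring ?B" using less.prems IB by blast
      have lc: "lcoef j c \<in> lring J" "lcoef j c \<noteq> 0" "lcoef j h \<in> lring J"
        using lcoef_in_lring[OF cB] lcoef_in_lring[OF hB] lcoef_neq_0[OF c(2)] by auto
      have "h' \<in> I"
        unfolding h'_def mult.assoc[symmetric]
        using less.prems c(1) lring_mono[OF subset_insertI lc(1)] lring_mono[OF subset_insertI lc(3)]
        by (intro I_comb) auto
      have h_eq: "lcoef j c * h = h' + lcoef j h * laurent_monom (axis j (topdeg 1 j h - topdeg 1 j c)) * c"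
        by (simp add: h'_def mult.assoc)
      show ?thesis
      proof (cases "h' = 0")
        case True
        then show ?thesis using h_eq lc by (intro bexI[of _ "lcoef j c"]) auto
      next
        case h': False
        have "width j c \<le> width j h"
          using c(3)[OF less.prems False] width_nonneg[OF False, of j] width_nonneg[OF c(2), of j] by simp
        then have "width j h' < width j h"
          using h' unfolding h'_def by (intro pseudo_division_step[OF hB False cB c(2) j])
        then obtain k where k: "k \<in> lring J" "k \<noteq> 0" "c dvd k * h'"
          using less.hyps[of h'] \<open>h' \<in> I\<close> width_nonneg[OF h', of j] by (metis nat_mono_iff order_le_less_trans)
        have "k * lcoef j c * h = k * h' + k * lcoef j h * laurent_monom (axis j (topdeg 1 j h - topdeg 1 j c)) * c"
          using h_eq by (simp add: mult.assoc distrib_left)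
        then have "c dvd k * lcoef j c * h" using k(3) by simp
        then show ?thesis using k lc by (intro bexI[of _ "k * lcoef j c"]) auto
      qed
    qed (auto intro!: bexI[of _ 1])
  qed
  \<comment> \<open>Dividing \<open>c\<close> by its content allows the multipliers from
    \<open>lring J\<close> to be cancelled afterwards.\<close>
  obtain qs c' where c': "\<forall>p\<in>set qs. lprime_factor J p" "c' \<in> lring ?B" "c = prod_list qs * c'" "primitive J c'"
    using content_primitive[OF fac j cB c(2)] by blast
  have dvd: "c' dvd h" if h: "h \<in> I" for h
  proof -
    obtain k where k: "k \<in> lring J" "k \<noteq> 0" "c dvd k * h" using div[OF h] by blast
    obtain u ps where ps: "u dvd 1" "k = u * prod_list ps" "\<forall>p\<in>set ps. lprime_factor J p"
      using fac k unfolding lfactorial_def by blast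
    have "c dvd u * (prod_list ps * h)" using k(3) ps(2) by (simp add: mult.assoc)
    then have "c dvd prod_list ps * h" by (rule unit_mult_dvd[OF ps(1)])
    then have "c' dvd prod_list ps * h" using c'(3) by (metis dvd_mult_right)
    then show ?thesis
      using primitive_dvd_cancel[OF j c'(2,4) ps(3)] h IB by blast
  qed
  obtain u v where uv: "c = u * f + v * g" using c(1) by (auto simp: I_def)
  have "prod_list qs \<in> lring J" using c'(1) lprime_factor_in_lring by (intro lring_prod_list) auto
  moreover have "prod_list qs \<noteq> 0" using c(2) c'(3) by auto
  ultimately show ?thesis using that dvd[OF fI] dvd[OF gI] c' uv by metis
qed

definition lirreducible :: "'d set \<Rightarrow> 'd::finite laurent \<Rightarrow> bool" where
  "lirreducible J f \<longleftrightarrow> f \<in> lring J \<and> f \<noteq> 0 \<and> \<not> f dvd 1 \<and>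
     (\<forall>a\<in>lring J. \<forall>b\<in>lring J. f = a * b \<longrightarrow> a dvd 1 \<or> b dvd 1)"

text \<open>In the Bezout relation, the common divisor \<open>c\<close> of \<open>f\<close> and
  \<open>g\<close> is a unit: otherwise \<open>f\<close> would be \<open>c\<close> times a unit and
  divide \<open>g\<close>. Multiplying by its inverse leaves \<open>k\<close>, which does not
  involve the variable \<open>j\<close>.\<close>

lemma lirreducible_elimination:
  assumes fac: "lfactorial J" and j: "j \<notin> J" and f: "lirreducible (insert j J) f"
    and g: "g \<in> lring (insert j J)" "\<not> f dvd g"
  obtains k u v where "k \<in> lring J" "k \<noteq> 0" "k = u * f + v * g"
proof -
  have fB: "f \<in> lring (insert j J)" "f \<noteq> 0" using f by (auto simp: lirreducible_def)
  obtain c k u v where c: "c dvd f" "c dvd g" "c \<in> lring (insert j J)" "k \<in> lring J" "k \<noteq> 0"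
    "k * c = u * f + v * g"
    using bezout_common_divisor[OF fac j fB g(1)] by blast
  obtain s where s: "s \<in> lring (insert j J)" "f = c * s" using lring_dvdE[OF c(3) fB(1) c(1)] by blast
  have "\<not> s dvd 1"
  proof
    assume "s dvd 1"
    then have "f dvd c * 1" unfolding s(2) by (intro mult_dvd_mono) auto
    then show False using g(2) c(2) dvd_trans by auto
  qed
  then have "c dvd 1" using f s c(3) unfolding lirreducible_def by blast
  then obtain w where w: "1 = c * w" by (rule dvdE)
  have "k = w * (k * c)" using w by (metis mult.assoc mult.commute mult_1)
  also have "\<dots> = (w * u) * f + (w * v) * g" unfolding c(6) by (simp add: algebra_simps)
  finally show ?thesis using that c by blast
qed

text \<open>Multiplying the elimination relation for \<open>g\<close> by \<open>h\<close> shows that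
  \<open>f\<close> divides \<open>k * h\<close>. The primes of \<open>k\<close> lie in the smaller
  ring and cancel because \<open>f\<close> is primitive.\<close>

lemma lirreducible_imp_lprime:
  assumes fac: "lfactorial J" and j: "j \<notin> J" and f: "lirreducible (insert j J) f" and prim: "primitive J f"
  shows "lprime (insert j J) f"
  unfolding lprime_def
proof (intro conjI ballI impI)
  show fB: "f \<in> lring (insert j J)" using f by (auto simp: lirreducible_def)
  fix g h assume g: "g \<in> lring (insert j J)" and h: "h \<in> lring (insert j J)" and dvd: "f dvd g * h"
  show "f dvd g \<or> f dvd h"
  proof (cases "f dvd g")
    case False
    then obtain k u v where k: "k \<in> lring J" "k \<noteq> 0" "k = u * f + v * g"
      using lirreducible_elimination[OF fac j f g] by blast
    obtain w ps where ps: "w dvd 1" "k = w * prod_list ps" "\<forall>p\<in>set ps. lprime_factor J p"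
      using fac k unfolding lfactorial_def by blast
    have "k * h = f * (u * h) + v * (g * h)" by (simp add: k(3) algebra_simps)
    then have "f dvd k * h" using dvd by (metis dvd_add dvd_mult dvd_triv_left)
    then have "f dvd w * (prod_list ps * h)" using ps(2) by (simp add: mult.assoc)
    then have "f dvd prod_list ps * h" by (rule unit_mult_dvd[OF ps(1)])
    then have "f dvd h" by (rule primitive_dvd_cancel[OF j fB prim ps(3) h])
    then show ?thesis ..
  qed simp
qed

text \<open>Gauss's theorem: after removal of the content, a primitive element is a unit, or
  irreducible and hence prime, or splits into two factors of smaller width.\<close>

lemma lfactorial_insert:
  assumes fac: "lfactorial J" and j: "j \<notin> J"
  shows "lfactorial (insert j J)"
proof -
  let ?B = "insert j J"
  let ?fac = "\<lambda>f. \<exists>u ps. u dvd 1 \<and> f = u * prod_list ps \<and> (\<forall>p::'a laurent\<in>set ps. lprime_factor ?B p)"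
  have "?fac f" if "f \<in> lring ?B" "f \<noteq> 0" for f
    using that
  proof (induction "nat (width j f)" arbitrary: f rule: less_induct)
    case less
    obtain ps f' where f': "\<forall>p\<in>set ps. lprime_factor J p" "f' \<in> lring ?B" "f = prod_list ps * f'" "primitive J f'"
      using content_primitive[OF fac j less.prems] by blast
    have ps: "\<forall>p\<in>set ps. lprime_factor ?B p" using f'(1) j lprime_factor_insert by blast
    have nz: "prod_list ps \<noteq> 0" "f' \<noteq> 0" using less.prems(2) f'(3) by auto
    have wf': "width j f' \<le> width j f"
      using width_mult[OF nz] width_nonneg[OF nz(1), of j] f'(3) by simp
    have "?fac f'"
    proof (cases "f' dvd 1 \<or> lirreducible ?B f'")
      case True
      then show ?thesis
      proof
        assume "f' dvd 1" then show ?thesis by (intro exI[of _ f'] exI[of _ "[]"]) auto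
      next
        assume "lirreducible ?B f'"
        moreover from this have "lprime ?B f'" by (rule lirreducible_imp_lprime[OF fac j _ f'(4)])
        ultimately show ?thesis
          by (intro exI[of _ 1] exI[of _ "[f']"]) (auto simp: lprime_factor_def lirreducible_def)
      qed
    next
      case False
      then obtain a b where ab: "a \<in> lring ?B" "b \<in> lring ?B" "f' = a * b" "\<not> a dvd 1" "\<not> b dvd 1"
        using f'(2) nz by (auto simp: lirreducible_def)
      \<comment> \<open>A factor of width 0 is, up to a monomial, an element of
        \<open>lring J\<close>. A prime factor there would divide the primitive \<open>f'\<close>,
        so such a factor is a unit.\<close>
      have pos: "width j x > 0" if x: "x \<in> lring ?B" "x dvd f'" "\<not> x dvd 1" for x
      proof (rule ccontr)
        assume "\<not> width j x > 0"
        moreover have x0: "x \<noteq> 0" using nz x by auto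
        ultimately have "width j x = 0" using width_nonneg[OF x0, of j] by simp
        then have "lcoef j x = laurent_monom (axis j (- topdeg 1 j x)) * x"
          using width_eq_0D[OF x0] by (simp add: lcoef_def)
        moreover obtain u qs where qs: "u dvd 1" "lcoef j x = u * prod_list qs" "\<forall>p\<in>set qs. lprime_factor J p"
          using fac lcoef_in_lring[OF x(1)] lcoef_neq_0[OF x0] unfolding lfactorial_def by blast
        ultimately have eq: "laurent_monom (axis j (- topdeg 1 j x)) * x = u * prod_list qs" by simp
        show False
        proof (cases qs)
          case Nil
          then have "laurent_monom (axis j (- topdeg 1 j x)) * x dvd 1" using eq qs(1) by simp
          then show False using x(3) by simp
        next
          case (Cons q qs')
          then have "q dvd u * prod_list qs" by simp
          then have "q dvd x" by (simp flip: eq)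
          then have "q dvd f'" using x(2) by (rule dvd_trans)
          then show False using f'(4) qs(3) Cons by (auto simp: primitive_def)
        qed
      qed
      have "a \<noteq> 0" "b \<noteq> 0" using nz ab by auto
      then have "width j f' = width j a + width j b" using ab(3) by (simp add: width_mult)
      then have "width j a < width j f" "width j b < width j f"
        using pos[of a] pos[of b] ab wf' by auto
      then have "?fac a" "?fac b"
        using less.hyps[of a] less.hyps[of b] ab \<open>a \<noteq> 0\<close> \<open>b \<noteq> 0\<close>
          width_nonneg[OF \<open>a \<noteq> 0\<close>, of j] width_nonneg[OF \<open>b \<noteq> 0\<close>, of j] by auto
      then obtain u ps v qs where *: "u dvd 1" "v dvd 1" "a = u * prod_list ps" "b = v * prod_list qs"
        "\<forall>p\<in>set ps. lprime_factor ?B p" "\<forall>p\<in>set qs. lprime_factor ?B p"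
        by blast
      have "u * v dvd 1" using *(1,2) by (metis mult_dvd_mono mult_1)
      moreover have "f' = u * v * prod_list (ps @ qs)" using ab * by (simp add: mult_ac)
      ultimately show ?thesis using * by (metis UnE set_append)
    qed
    then obtain u qs where *: "u dvd 1" "f' = u * prod_list qs" "\<forall>p\<in>set qs. lprime_factor ?B p" by blast
    have "f = u * prod_list (ps @ qs)" using f' * by (simp add: mult_ac)
    moreover have "\<forall>p\<in>set (ps @ qs). lprime_factor ?B p" using ps * by auto
    ultimately show ?case using *(1) by blast
  qed
  then show ?thesis by (auto simp: lfactorial_def)
qed

lemma lfactorial_empty: "lfactorial ({} :: 'd::finite set)"
  unfolding lfactorial_def
proof (intro ballI impI)
  fix f :: "'d laurent" assume f: "f \<in> lring {}" "f \<noteq> 0"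
  define a where "a = coef f 0"
  have fa: "f = of_int a" using lring_empty_eq[OF f(1)] by (simp add: a_def)
  have "a \<noteq> 0" using f fa by auto
  obtain ps where ps: "mset ps = prime_factorization a" using ex_mset by blast
  have "lprime_factor {} (of_int p :: 'd laurent)" if "p \<in> set ps" for p
  proof -
    have "p \<in># prime_factorization a" using that ps by (metis set_mset_mset)
    then have p: "prime p" by (rule in_prime_factors_imp_prime)
    have "of_int p dvd x \<or> of_int p dvd y"
      if "x \<in> lring {}" "y \<in> lring {}" "of_int p dvd x * y" for x y :: "'d laurent"
    proof -
      have x: "x = of_int (coef x 0)" and y: "y = of_int (coef y 0)"
        using lring_empty_eq that by blast+
      have "(of_int p :: 'd laurent) dvd of_int (coef x 0 * coef y 0)"
        unfolding of_int_mult x[symmetric] y[symmetric] by (rule that(3))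
      then have "p dvd coef x 0 \<or> p dvd coef y 0"
        by (simp only: of_int_laurent_dvd_iff prime_dvd_mult_iff[OF p])
      then show ?thesis
        using x y of_int_laurent_dvd_iff[of p] by metis
    qed
    moreover have "\<not> (of_int p :: 'd laurent) dvd 1"
      using of_int_laurent_dvd_iff[of p 1] p not_prime_unit by auto
    ultimately show ?thesis using p by (auto simp: lprime_factor_def lprime_def)
  qed
  moreover have "prod_list ps = normalize a"
    using prod_mset_prime_factorization[OF \<open>a \<noteq> 0\<close>] ps by (metis prod_mset_prod_list)
  then have "a = sgn a * prod_list ps" by (simp add: sgn_mult_abs)
  then have "f = of_int (sgn a) * prod_list (map of_int ps)"
  proof -
    have "of_int (prod_list qs) = (prod_list (map of_int qs) :: 'd laurent)" for qs
      by (induction qs) auto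
    then show ?thesis using fa \<open>a = sgn a * prod_list ps\<close> by (metis of_int_mult)
  qed
  moreover have "(of_int (sgn a) :: 'd laurent) dvd 1"
    using \<open>a \<noteq> 0\<close> by (auto simp: sgn_if)
  ultimately show "\<exists>u ps. u dvd 1 \<and> f = u * prod_list ps \<and> (\<forall>p\<in>set ps. lprime_factor {} p)"
    by (intro exI[of _ "of_int (sgn a)"] exI[of _ "map of_int ps"]) auto
qed

lemma lfactorial: "lfactorial (J :: 'd::finite set)"
proof -
  have "finite J" by simp
  then show ?thesis
    by (induction J rule: finite_induct) (auto intro: lfactorial_empty lfactorial_insert)
qed

text \<open>In a factorisation of \<open>f\<close> into primes, irreducibility makes all but one
  factor a unit, so \<open>f\<close> is associated to a prime.\<close>

lemma irreducible_laurent_dvd_mult: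
  fixes f :: "'d::finite laurent"
  assumes f: "irreducible f" and "f dvd a * b" shows "f dvd a \<or> f dvd b"
proof -
  obtain u ps where ps: "u dvd 1" "f = u * prod_list ps" "\<forall>p\<in>set ps. lprime_factor UNIV p"
    using lfactorial[of UNIV] f unfolding lfactorial_def by (metis UNIV_I irreducible_def lring_UNIV)
  have "ps \<noteq> []" using f ps by (auto simp: irreducible_def)
  then obtain p qs where "ps = p # qs" by (cases ps) auto
  then have p: "lprime_factor UNIV p" "f = p * (u * prod_list qs)" using ps by (auto simp: mult_ac)
  then have "u * prod_list qs dvd 1" using f by (auto simp: irreducible_def lprime_factor_def)
  then have fp: "f dvd p" using p(2) by (metis dvd_refl mult_dvd_mono mult_1_right)
  have "p dvd a * b" using p(2) assms(2) by (metis dvd_mult_left)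
  then have "p dvd a \<or> p dvd b" using p(1) by (simp add: lprime_factor_def lprime_def)
  then show ?thesis using fp dvd_trans by blast
qed

text \<open>On the torus, \<open>k\<close> is constant along lines in direction \<open>j\<close>.
  Where it is nonzero on such a line, \<open>g\<close> cannot vanish at the zeros of
  \<open>f\<close> on that line.\<close>

lemma irreducible_laurent_elimination:
  fixes f :: "'d::finite laurent"
  assumes f: "irreducible f" and g: "\<not> f dvd g"
  obtains k u v where "k \<in> lring (UNIV - {j})" "k \<noteq> 0" "k = u * f + v * g"
proof (rule lirreducible_elimination[OF lfactorial[of "UNIV - {j}"], of j f g])
  have "insert j (UNIV - {j}) = UNIV" by auto
  then show "lirreducible (insert j (UNIV - {j})) f" "g \<in> lring (insert j (UNIV - {j}))"
    using f by (auto simp: lirreducible_def irreducible_def)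
qed (use g that in auto)

section \<open>Convolution and evaluation on the torus\<close>

text \<open>The action of the ring on arbitrary functions on the lattice; as \<open>p\<close> has
  finite support, no decay of \<open>w\<close> is required.\<close>

definition conv :: "'d::finite laurent \<Rightarrow> (int ^ 'd \<Rightarrow> complex) \<Rightarrow> int ^ 'd \<Rightarrow> complex" where
  "conv p w k = (\<Sum>m\<in>supp p. of_int (coef p m) * w (k - m))"

lemma conv_add: "conv (p + q) w k = conv p w k + conv q w k"
  unfolding conv_def
  by (rule setsum_keys_plus_distrib[where f = "\<lambda>m c. of_int c * w (k - m)"]) (auto simp: algebra_simps)

lemma conv_zero [simp]: "conv 0 w k = 0"
  by (simp add: conv_def)

lemma conv_sum: "conv (\<Sum>i\<in>A. p i) w k = (\<Sum>i\<in>A. conv (p i) w k)"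
  by (induction A rule: infinite_finite_induct) (auto simp: conv_add)

lemma conv_single: "conv (Poly_Mapping.single n c) w k = of_int c * w (k - n)"
  by (simp add: conv_def)

lemma sum_single: "(\<Sum>m\<in>supp p. Poly_Mapping.single m (coef p m)) = p"
proof (rule poly_mapping_eqI)
  fix n
  have "coef (\<Sum>m\<in>supp p. Poly_Mapping.single m (coef p m)) n = (\<Sum>m\<in>supp p. if m = n then coef p m else 0)"
    by (simp add: lookup_sum lookup_single when_def)
  also have "\<dots> = coef p n" by (simp add: in_keys_iff)
  finally show "coef (\<Sum>m\<in>supp p. Poly_Mapping.single m (coef p m)) n = coef p n" .
qed

lemma conv_mult: "conv (p * q) w k = conv p (conv q w) k"
proof -
  have "p * q = (\<Sum>m\<in>supp p. \<Sum>n\<in>supp q. Poly_Mapping.single (m + n) (coef p m * coef q n))"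
    by (subst (1) sum_single[of p, symmetric], subst (1) sum_single[of q, symmetric])
       (simp add: sum_product mult_single)
  then have "conv (p * q) w k = (\<Sum>m\<in>supp p. \<Sum>n\<in>supp q. of_int (coef p m * coef q n) * w (k - (m + n)))"
    by (simp add: conv_sum conv_single)
  also have "\<dots> = conv p (conv q w) k"
    by (simp add: conv_def sum_distrib_left mult.assoc diff_diff_eq)
  finally show ?thesis .
qed

lemma conv_laurent_monom: "conv (laurent_monom n) w k = w (k - n)"
  by (simp add: laurent_monom_def conv_single)

lemma coef_eq_conv: "of_int (coef p k) = conv p (\<lambda>n. if n = 0 then 1 else 0) k"
proof -
  have "conv p (\<lambda>n. if n = 0 then 1 else 0) k = (\<Sum>m\<in>supp p. if m = k then of_int (coef p m) else 0)"
    unfolding conv_def by (intro sum.cong) auto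
  also have "\<dots> = of_int (coef p k)" by (simp add: in_keys_iff)
  finally show ?thesis by simp
qed

lemma coef_mult_eq_conv: "of_int (coef (p * q) k) = conv p (\<lambda>n. of_int (coef q n)) k"
  by (simp add: coef_eq_conv conv_mult[abs_def])

section \<open>Characters and evaluation on the torus\<close>

definition pairing :: "int ^ 'd \<Rightarrow> real ^ 'd \<Rightarrow> real" where
  "pairing n t = (\<Sum>j\<in>UNIV. of_int (n $ j) * t $ j)"

definition e2pi :: "real \<Rightarrow> complex" where
  "e2pi x = exp (2 * of_real pi * \<i> * of_real x)"

lemma e2pi_add: "e2pi (x + y) = e2pi x * e2pi y"
  by (simp add: e2pi_def distrib_left exp_add)

lemma e2pi_0 [simp]: "e2pi 0 = 1"
  by (simp add: e2pi_def)

lemma e2pi_eq_cis: "e2pi x = cis (2 * pi * x)"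
  by (simp add: e2pi_def cis_conv_exp mult_ac)

lemma e2pi_neq_0 [simp]: "e2pi x \<noteq> 0"
  by (simp add: e2pi_def)

lemma norm_e2pi [simp]: "norm (e2pi x) = 1"
  by (simp add: e2pi_eq_cis)

lemma cnj_e2pi: "cnj (e2pi x) = e2pi (- x)"
  by (simp add: e2pi_eq_cis cis_cnj)

lemma e2pi_of_int [simp]: "e2pi (of_int n) = 1"
  using cis_multiple_2pi[of "of_int n"] by (simp add: e2pi_eq_cis)

lemma e2pi_sum: "e2pi (\<Sum>i\<in>A. f i) = (\<Prod>i\<in>A. e2pi (f i))"
  by (induction A rule: infinite_finite_induct) (auto simp: e2pi_add)

lemma continuous_on_e2pi [continuous_intros]: "continuous_on A f \<Longrightarrow> continuous_on A (\<lambda>x. e2pi (f x))"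
  unfolding e2pi_def by (intro continuous_intros)

lemma pairing_add_left: "pairing (m + n) t = pairing m t + pairing n t"
  by (simp add: pairing_def distrib_right sum.distrib)

lemma pairing_add_right: "pairing n (s + t) = pairing n s + pairing n t"
  by (simp add: pairing_def distrib_left sum.distrib)

lemma pairing_uminus_left: "pairing (- n) t = - pairing n t"
  by (simp add: pairing_def sum_negf)

lemma pairing_diff_left: "pairing (m - n) t = pairing m t - pairing n t"
  using pairing_add_left[of m "- n" t] by (simp add: pairing_uminus_left)

lemma pairing_0_left [simp]: "pairing 0 t = 0"
  by (simp add: pairing_def)

lemma axis_conv_scaleR: "axis j s = s *\<^sub>R axis j (1::real)"
  by (simp add: axis_def vec_eq_iff)

lemma pairing_axis_right: "pairing n (axis j s) = of_int (n $ j) * s"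
  by (simp add: pairing_def axis_def if_distrib cong: if_cong)

definition ev :: "'d::finite laurent \<Rightarrow> real ^ 'd \<Rightarrow> complex" where
  "ev p t = (\<Sum>m\<in>supp p. of_int (coef p m) * e2pi (pairing m t))"

lemma laurent_eval_torus_point: "laurent_eval p (torus_point t) = ev p t"
  by (simp add: laurent_eval_def torus_point_def ev_def pairing_def e2pi_sum)
     (simp add: e2pi_def exp_power_int mult_ac)

lemma ev_eq_conv_0: "ev p t = conv p (\<lambda>n. e2pi (pairing (- n) t)) 0"
  by (simp add: ev_def conv_def)

text \<open>Characters are eigenfunctions of \<open>conv q\<close> with eigenvalue
  \<open>ev q t\<close>, so multiplicativity follows from \<open>conv_mult\<close>.\<close>

lemma ev_mult: "ev (p * q) t = ev p t * ev q t"
proof -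
  have "conv q (\<lambda>n. e2pi (pairing (- n) t)) k = ev q t * e2pi (pairing (- k) t)" for k
    by (simp add: conv_def ev_def sum_distrib_right mult.assoc pairing_diff_left pairing_uminus_left flip: e2pi_add)
  then have "conv q (\<lambda>n. e2pi (pairing (- n) t)) = (\<lambda>k. ev q t * e2pi (pairing (- k) t))" by blast
  then show ?thesis
    unfolding ev_eq_conv_0[of "p * q"] conv_mult
    by (simp add: conv_def ev_def[of p] sum_distrib_left sum_distrib_right mult_ac)
qed

lemma ev_add: "ev (p + q) t = ev p t + ev q t"
  by (simp add: ev_eq_conv_0 conv_add)

lemma ev_0 [simp]: "ev 0 t = 0"
  by (simp add: ev_def)

lemma ev_of_int [simp]: "ev (of_int c) t = of_int c"
  by (simp add: ev_eq_conv_0 conv_single flip: single_of_int[of c])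

lemma ev_of_nat [simp]: "ev (of_nat c) t = of_nat c"
  using ev_of_int[of "int c"] by simp

lemma ev_1 [simp]: "ev 1 t = 1"
  using ev_of_int[of 1] by simp

lemma ev_uminus [simp]: "ev (- p) t = - ev p t"
  by (simp add: ev_def sum_negf)

lemma ev_diff: "ev (p - q) t = ev p t - ev q t"
  using ev_add[of p "- q" t] by simp

lemma ev_power: "ev (p ^ n) t = ev p t ^ n"
  by (induction n) (auto simp: ev_mult)

lemma ev_single: "ev (Poly_Mapping.single n c) t = of_int c * e2pi (pairing n t)"
  by (simp add: ev_eq_conv_0 conv_single)

definition norm1 :: "'d::finite laurent \<Rightarrow> real" where
  "norm1 p = (\<Sum>m\<in>supp p. \<bar>of_int (coef p m)\<bar>)"

lemma norm1_nonneg: "norm1 p \<ge> 0"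
  by (auto simp: norm1_def intro: sum_nonneg)

lemma norm_ev_le: "norm (ev p t) \<le> norm1 p"
  unfolding ev_def norm1_def by (rule sum_norm_le) (simp add: norm_mult)

lemma norm_conv_le:
  assumes "\<And>n. norm (w n) \<le> C" shows "norm (conv p w k) \<le> norm1 p * C"
  unfolding conv_def norm1_def sum_distrib_right
  by (rule sum_norm_le) (use assms in \<open>simp add: norm_mult mult_left_mono\<close>)

lemma continuous_on_ev [continuous_intros]: "continuous_on A (ev p)"
  unfolding ev_def pairing_def by (intro continuous_intros)

lemma ev_periodic: "ev p (t + (\<chi> j. of_int (k $ j))) = ev p t"
proof -
  have "pairing m (\<chi> j. of_int (k $ j)) = of_int (\<Sum>j\<in>UNIV. m $ j * k $ j)" for m
    by (simp add: pairing_def)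
  then have "e2pi (pairing m (\<chi> j. of_int (k $ j))) = 1" for m by (simp only: e2pi_of_int)
  then show ?thesis by (simp add: ev_def pairing_add_right e2pi_add)
qed

text \<open>The operator \<open>x_j d/dx_j\<close>. On the torus it is the partial derivative
  divided by \<open>2 pi i\<close>, and it preserves integer coefficients.\<close>

lift_definition euler :: "'d \<Rightarrow> 'd::finite laurent \<Rightarrow> 'd laurent"
  is "\<lambda>j f n. n $ j * f n"
  by (rule finite_subset) auto

lemma coef_euler: "coef (euler j p) n = n $ j * coef p n"
  by (simp add: euler.rep_eq)

lemma ev_euler: "ev (euler j p) t = (\<Sum>m\<in>supp p. of_int (m $ j) * of_int (coef p m) * e2pi (pairing m t))"
  unfolding ev_def by (rule sum.mono_neutral_cong_left) (auto simp: coef_euler in_keys_iff)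

text \<open>Complex arguments make the rules for field derivatives of powers and quotients available.\<close>

definition cev :: "'d::finite laurent \<Rightarrow> real ^ 'd \<Rightarrow> 'd \<Rightarrow> complex \<Rightarrow> complex" where
  "cev p t j z = (\<Sum>m\<in>supp p. of_int (coef p m) * exp (2 * of_real pi * \<i> * (of_real (pairing m t) + of_int (m $ j) * z)))"

lemma cev_of_real: "cev p t j (of_real s) = ev p (t + axis j s)"
  by (simp add: cev_def ev_def pairing_add_right pairing_axis_right e2pi_def)

lemma cev_has_field_derivative:
  "(cev p t j has_field_derivative 2 * of_real pi * \<i> * ev (euler j p) (t + axis j s)) (at (of_real s))"
proof -
  have "(cev p t j has_field_derivative (\<Sum>m\<in>supp p. of_int (coef p m) * (exp (2 * of_real pi * \<i> * (of_real (pairing m t) + of_int (m $ j) * of_real s))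
      * (2 * of_real pi * \<i> * of_int (m $ j))))) (at (of_real s))"
    unfolding cev_def[abs_def] by (auto intro!: derivative_eq_intros simp: mult_ac)
  also have "(\<Sum>m\<in>supp p. of_int (coef p m) * (exp (2 * of_real pi * \<i> * (of_real (pairing m t) + of_int (m $ j) * of_real s))
      * (2 * of_real pi * \<i> * of_int (m $ j)))) = 2 * of_real pi * \<i> * ev (euler j p) (t + axis j s)"
    by (simp add: ev_euler sum_distrib_left pairing_add_right pairing_axis_right e2pi_def mult_ac)
  finally show ?thesis .
qed

lemma ev_has_vector_derivative:
  "((\<lambda>s. ev p (t + axis j s)) has_vector_derivative 2 * of_real pi * \<i> * ev (euler j p) (t + axis j s)) (at s)"
  using has_vector_derivative_real_field[OF cev_has_field_derivative] by (simp add: cev_of_real)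

text \<open>A local form of the linear independence of characters. If \<open>p\<close> vanishes on
  \<open>U\<close>, so does its derivative, and a suitable combination of both has fewer
  terms.\<close>

lemma ev_neq_0_on_open:
  assumes "p \<noteq> 0" "open U" "U \<noteq> {}"
  shows "\<exists>t\<in>U. ev p t \<noteq> 0"
  using assms(1)
proof (induction "card (supp p)" arbitrary: p rule: less_induct)
  case less
  show ?case
  proof (rule ccontr)
    assume "\<not> ?thesis"
    then have zero: "ev p t = 0" if "t \<in> U" for t using that by blast
    obtain n where n: "n \<in> supp p" using less.prems by fastforce
    then have n': "coef p n \<noteq> 0" by (simp add: in_keys_iff)
    show False
    proof (cases "supp p = {n}")
      case True
      obtain t where "t \<in> U" using assms by blast
      then show False using zero[of t] True n' by (simp add: ev_def)
    next
      case False
      then obtain m where m: "m \<in> supp p" "m \<noteq> n" using n by blast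
      then obtain j where j: "m $ j \<noteq> n $ j" by (auto simp: vec_eq_iff)
      \<comment> \<open>The combination removes the exponent \<open>n\<close> and keeps
        \<open>m\<close>, whose \<open>j\<close>-th coordinate differs.\<close>
      define q where "q = euler j p - of_int (n $ j) * p"
      have coef_q: "coef q k = (k $ j - n $ j) * coef p k" for k
        by (simp add: q_def lookup_minus coef_euler coef_of_int_mult left_diff_distrib)
      have "supp q \<subseteq> supp p - {n}" by (auto simp: in_keys_iff coef_q)
      then have "card (supp q) < card (supp p)"
        using n by (meson card_mono card_Diff1_less finite_keys finite_Diff order_le_less_trans)
      moreover have "m \<in> supp q" using m j by (simp add: in_keys_iff coef_q)
      then have "q \<noteq> 0" by auto
      ultimately obtain t where t: "t \<in> U" "ev q t \<noteq> 0" using less.hyps by blast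
      have "\<forall>\<^sub>F s in nhds 0. t + axis j s \<in> U"
      proof -
        have "((\<lambda>s. t + s *\<^sub>R axis j (1::real)) \<longlongrightarrow> t + 0 *\<^sub>R axis j 1) (nhds 0)"
          by (intro tendsto_intros filterlim_ident)
        then have "((\<lambda>s. t + axis j s) \<longlongrightarrow> t) (nhds 0)"
          by (simp flip: axis_conv_scaleR)
        then show ?thesis using assms(2) t(1) by (rule topological_tendstoD)
      qed
      then have "\<forall>\<^sub>F s in nhds 0. ev p (t + axis j s) = 0" by eventually_elim (rule zero)
      then have "((\<lambda>s. ev p (t + axis j s)) has_vector_derivative 0) (at 0)"
        using has_vector_derivative_const[of 0 "at 0"]
        by (subst has_vector_derivative_cong_ev[where g = "\<lambda>_. 0"]) (auto dest: eventually_nhds_x_imp_x)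
      then have "2 * of_real pi * \<i> * ev (euler j p) (t + axis j 0) = 0"
        using ev_has_vector_derivative vector_derivative_unique_at by blast
      then show False using t zero by (simp add: q_def ev_diff ev_mult)
    qed
  qed
qed

lemma ev_inject:
  assumes "\<And>t. ev p t = ev q t" shows "p = q"
  using ev_neq_0_on_open[of "p - q" UNIV] assms by (auto simp: ev_diff)

lift_definition adj :: "'d::finite laurent \<Rightarrow> 'd laurent"
  is "\<lambda>f n. f (- n)"
proof -
  fix f :: "int ^ 'd \<Rightarrow> int" assume "finite {n. f n \<noteq> 0}"
  then have "finite (uminus ` {n. f n \<noteq> 0})" by simp
  then show "finite {n. f (- n) \<noteq> 0}" by (rule rev_finite_subset) force
qed

lemma coef_adj: "coef (adj p) n = coef p (- n)"
  by (simp add: adj.rep_eq)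

lemma adj_adj [simp]: "adj (adj p) = p"
  by (rule poly_mapping_eqI) (simp add: coef_adj)

lemma ev_adj: "ev (adj p) t = cnj (ev p t)"
proof -
  have "supp (adj p) = uminus ` supp p"
    by (force simp: in_keys_iff coef_adj)
  then have "ev (adj p) t = (\<Sum>m\<in>supp p. of_int (coef p m) * e2pi (pairing (- m) t))"
    by (simp add: ev_def coef_adj sum.reindex)
  then show ?thesis by (simp add: ev_def cnj_e2pi pairing_uminus_left)
qed

lemma adj_mult: "adj (p * q) = adj p * adj q"
  by (rule ev_inject) (simp add: ev_adj ev_mult)

section \<open>Powers of a dominated polynomial have a smooth quotient\<close>

lemma vector_differentiable_bound:
  fixes f :: "real \<Rightarrow> complex"
  assumes "\<And>s. (f has_vector_derivative f' s) (at s)" "\<And>s. norm (f' s) \<le> B"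
  shows "norm (f y - f x) \<le> B * \<bar>y - x\<bar>"
proof -
  have "norm (f y - f x) \<le> B * norm (y - x)"
  proof (rule differentiable_bound[of UNIV f "\<lambda>s h. h *\<^sub>R f' s"])
    show "(f has_derivative (\<lambda>h. h *\<^sub>R f' s)) (at s within UNIV)" for s
      using assms(1)[of s] by (simp add: has_vector_derivative_def)
    show "onorm (\<lambda>h. h *\<^sub>R f' s) \<le> B" for s
      by (rule onorm_le) (simp add: mult.commute[of B] mult_left_mono assms(2))
  qed auto
  then show ?thesis by simp
qed

text \<open>Two factors \<open>y\<close> pay for each factor \<open>x\<close> in the denominator;
  the remaining \<open>a - 2 * b\<close> factors are bounded by \<open>B\<close>. For
  \<open>x = 0\<close> and \<open>b > 0\<close> the quotient is 0 by convention.\<close>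

lemma quotient_bound:
  fixes x y z :: complex
  assumes "norm y ^ 2 \<le> C * norm x" "norm y \<le> B" "norm z \<le> A" "2 * b \<le> a" "C \<ge> 0"
  shows "norm (z * y ^ a / x ^ b) \<le> A * (C ^ b * B ^ (a - 2 * b))"
proof -
  have nn: "0 \<le> A" "0 \<le> B" using assms(2,3) norm_ge_zero order_trans by blast+
  have "norm y ^ a / norm x ^ b \<le> C ^ b * B ^ (a - 2 * b)"
  proof (cases "x = 0 \<and> b > 0")
    case True
    then have "norm y ^ a / norm x ^ b = 0" by (simp add: zero_power)
    then show ?thesis using nn assms(5) by (simp only: zero_le_mult_iff zero_le_power simp_thms)
  next
    case False
    have "norm y ^ a = (norm y ^ 2) ^ b * norm y ^ (a - 2 * b)"
      using assms(4) by (simp flip: power_mult power_add)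
    also have "\<dots> \<le> (C * norm x) ^ b * B ^ (a - 2 * b)"
      using assms nn by (intro mult_mono power_mono) auto
    finally show ?thesis using False by (auto simp: divide_simps power_mult_distrib mult_ac)
  qed
  then have "norm z * (norm y ^ a / norm x ^ b) \<le> A * (C ^ b * B ^ (a - 2 * b))"
    using assms(3) nn by (intro mult_mono) auto
  then show ?thesis by (simp add: norm_mult norm_divide norm_power)
qed

definition quot :: "'d::finite laurent \<Rightarrow> 'd laurent \<Rightarrow> 'd laurent \<Rightarrow> nat \<Rightarrow> nat \<Rightarrow> real ^ 'd \<Rightarrow> complex" where
  "quot f g P a b t = ev P t * ev g t ^ a / ev f t ^ b"

text \<open>
  At the zeros of \<open>f\<close> both sides vanish because of the convention \<open>x / 0 = 0\<close>, so that the
  quotient rule holds everywhere.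
\<close>

lemma quot_has_vector_derivative:
  fixes f g P :: "'d::finite laurent" and j :: 'd
  assumes dom: "\<And>t. norm (ev g t) ^ 2 \<le> C * norm (ev f t)" and C: "C \<ge> 0" and a: "a \<ge> 2 * b + 1" and b: "b \<ge> 1"
  defines "P' \<equiv> euler j P * g * f + of_int (1 + int a) * (P * euler j g * f) - of_int (int b) * (P * g * euler j f)"
  shows "((\<lambda>s. quot f g P (Suc a) b (t + axis j s)) has_vector_derivative
    2 * of_real pi * \<i> * quot f g P' a (Suc b) (t + axis j s)) (at s)"
proof (cases "ev f (t + axis j s) = 0")
  case False
  let ?f = "ev f (t + axis j s)" and ?g = "ev g (t + axis j s)" and ?P = "ev P (t + axis j s)"
  obtain b' where b': "b = Suc b'" using b by (cases b) auto
  let ?d = "\<lambda>p. 2 * of_real pi * \<i> * ev (euler j p) (t + axis j s)"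
  have d: "(cev p t j has_field_derivative ?d p) (at (of_real s))" for p
    by (rule cev_has_field_derivative)
  have "((\<lambda>z. cev P t j z * cev g t j z ^ Suc a / cev f t j z ^ Suc b') has_field_derivative
     ((?d P * ?g ^ Suc a + (1 + of_nat a) * (?d g * ?g ^ a) * ?P) * ?f ^ Suc b' -
      (1 + of_nat b') * (?d f * ?f ^ b') * (?P * ?g ^ Suc a)) / (?f ^ Suc b') ^ Suc (Suc 0)) (at (of_real s))"
    by (rule DERIV_cong[OF DERIV_quotient[OF DERIV_mult[OF d[of P] DERIV_power_Suc[OF d[of g]]] DERIV_power_Suc[OF d[of f]]]])
       (use False in \<open>simp_all only: cev_of_real power_eq_0_iff simp_thms not_False_eq_True\<close>)
  also have "((?d P * ?g ^ Suc a + (1 + of_nat a) * (?d g * ?g ^ a) * ?P) * ?f ^ Suc b' -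
      (1 + of_nat b') * (?d f * ?f ^ b') * (?P * ?g ^ Suc a)) / (?f ^ Suc b') ^ Suc (Suc 0) =
     2 * of_real pi * \<i> * quot f g P' a (Suc b) (t + axis j s)"
    using False
    by (simp add: quot_def P'_def ev_add ev_diff ev_mult b' divide_simps) (simp add: algebra_simps)
  finally have "((\<lambda>z. cev P t j z * cev g t j z ^ Suc a / cev f t j z ^ b) has_field_derivative
     2 * of_real pi * \<i> * quot f g P' a (Suc b) (t + axis j s)) (at (of_real s))"
    by (simp only: b')
  from has_vector_derivative_real_field[OF this] show ?thesis
    by (simp add: cev_of_real quot_def)
next
  case True
  define G where "G s = ev g (t + axis j s)" for s
  have G0: "G s = 0" using dom[of "t + axis j s"] True by (simp add: G_def)
  have zero: "quot f g P (Suc a) b (t + axis j s) = 0" "quot f g P' a (Suc b) (t + axis j s) = 0"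
    using True b by (simp_all add: quot_def)
  define L where "L = 2 * pi * norm1 (euler j g)"
  have lip: "norm (G y) \<le> L * \<bar>y - s\<bar>" for y
  proof -
    have "norm (G y - G s) \<le> L * \<bar>y - s\<bar>"
      unfolding G_def
      by (rule vector_differentiable_bound[OF ev_has_vector_derivative])
         (auto simp: L_def norm_mult intro!: norm_ev_le)
    then show ?thesis using G0 by simp
  qed
  define K where "K = norm1 P * (C ^ b * norm1 g ^ (Suc a - 2 * b - 2))"
  have "norm1 g \<ge> 0" "norm1 P \<ge> 0" "L \<ge> 0" by (auto simp: norm1_nonneg L_def)
  then have K: "K \<ge> 0" using C by (simp add: K_def)
  \<comment> \<open>Two of the \<open>Suc a\<close> factors \<open>g\<close> vanish to first order
    at the zero of \<open>f\<close>; the other \<open>a - 1\<close>, at least \<open>2 * b\<close>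
    of them, control the denominator. This quadratic bound makes the derivative 0.\<close>
  have bound: "norm (quot f g P (Suc a) b (t + axis j y)) \<le> K * L\<^sup>2 * \<bar>y - s\<bar>\<^sup>2" for y
  proof -
    have "quot f g P (Suc a) b (t + axis j y) =
        (ev P (t + axis j y) * ev g (t + axis j y) ^ (Suc a - 2) / ev f (t + axis j y) ^ b) * G y ^ 2"
      using a b by (simp add: quot_def G_def flip: power_add)
    also have "norm \<dots> \<le> (norm1 P * (C ^ b * norm1 g ^ (Suc a - 2 - 2 * b))) * (L * \<bar>y - s\<bar>) ^ 2"
      unfolding norm_mult norm_power
      by (intro mult_mono quotient_bound power_mono dom norm_ev_le lip C) (use a K in \<open>auto simp: K_def\<close>)
    also have "Suc a - 2 - 2 * b = Suc a - 2 * b - 2" by simp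
    finally show ?thesis by (simp add: K_def power_mult_distrib mult_ac)
  qed
  have "((\<lambda>y. quot f g P (Suc a) b (t + axis j y)) has_derivative (\<lambda>h. 0)) (at s)"
    unfolding has_derivative_at
  proof (intro conjI)
    have "((\<lambda>h. K * L\<^sup>2 * \<bar>h\<bar>) \<longlongrightarrow> K * L\<^sup>2 * \<bar>0\<bar>) (at 0)"
      by (intro tendsto_intros)
    then have lim: "((\<lambda>h. K * L\<^sup>2 * \<bar>h\<bar>) \<longlongrightarrow> 0) (at 0)" by simp
    have "norm (norm (quot f g P (Suc a) b (t + axis j (s + h)) - quot f g P (Suc a) b (t + axis j s) - 0) / norm h)
        \<le> K * L\<^sup>2 * \<bar>h\<bar>" if "h \<noteq> 0" for h
      using bound[of "s + h"] that zero by (simp add: divide_simps power2_eq_square mult_ac)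
    then show "((\<lambda>h. norm (quot f g P (Suc a) b (t + axis j (s + h)) - quot f g P (Suc a) b (t + axis j s) - 0) / norm h) \<longlongrightarrow> 0) (at 0)"
      by (intro Lim_null_comparison[OF _ lim]) (auto simp: eventually_at intro!: exI[of _ 1])
  qed simp
  then show ?thesis by (simp add: has_vector_derivative_def zero)
qed

text \<open>\<open>K\<close> bounds the \<open>m\<close>-th derivative in direction
  \<open>j\<close>; the lower ones only have to exist. Derivatives along lines keep the calculus
  one-dimensional.\<close>

primrec smooth_bound :: "'d::finite \<Rightarrow> nat \<Rightarrow> real \<Rightarrow> (real ^ 'd \<Rightarrow> complex) \<Rightarrow> bool" where
  "smooth_bound j 0 K \<phi> \<longleftrightarrow> (\<forall>t. norm (\<phi> t) \<le> K)"
| "smooth_bound j (Suc m) K \<phi> \<longleftrightarrow> (\<exists>\<phi>'. (\<forall>t s. ((\<lambda>s. \<phi> (t + axis j s)) has_vector_derivative \<phi>' (t + axis j s)) (at s))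
     \<and> smooth_bound j m K \<phi>')"

lemma smooth_bound_scale: "smooth_bound j m K \<phi> \<Longrightarrow> smooth_bound j m (norm c * K) (\<lambda>t. c * \<phi> t)"
proof (induction m arbitrary: \<phi>)
  case 0
  then show ?case by (auto simp: norm_mult intro: mult_left_mono)
next
  case (Suc m)
  then obtain \<phi>' where "\<And>t s. ((\<lambda>s. \<phi> (t + axis j s)) has_vector_derivative \<phi>' (t + axis j s)) (at s)"
    "smooth_bound j m K \<phi>'" by auto
  then show ?case using Suc.IH[of \<phi>']
    by (auto intro!: exI[of _ "\<lambda>t. c * \<phi>' t"] has_vector_derivative_mult_right)
qed

text \<open>A differentiation lowers the exponent of \<open>g\<close> by 1 and raises that of
  \<open>f\<close> by 1, so it costs 3 of the reserve \<open>a - 2 * b\<close>.\<close>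

lemma smooth_bound_quot:
  assumes dom: "\<And>t. norm (ev g t) ^ 2 \<le> C * norm (ev f t)" and C: "C \<ge> 0"
  shows "b \<ge> 1 \<Longrightarrow> a \<ge> 2 * b + 3 * m \<Longrightarrow> \<exists>K. smooth_bound j m K (quot f g P a b)"
proof (induction m arbitrary: P a b)
  case 0
  have "norm (quot f g P a b t) \<le> norm1 P * (C ^ b * norm1 g ^ (a - 2 * b))" for t
    unfolding quot_def by (rule quotient_bound) (use dom C 0 in \<open>auto intro: norm_ev_le\<close>)
  then show ?case by auto
next
  case (Suc m)
  then obtain a' where a': "a = Suc a'" by (cases a) auto
  obtain P' where P': "\<And>t s. ((\<lambda>s. quot f g P (Suc a') b (t + axis j s)) has_vector_derivative
    2 * of_real pi * \<i> * quot f g P' a' (Suc b) (t + axis j s)) (at s)"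
    using quot_has_vector_derivative[OF dom C, where b = b and a = a' and j = j and P = P] Suc.prems a'
    by auto
  obtain K where "smooth_bound j m K (quot f g P' a' (Suc b))"
    using Suc.IH[of "Suc b" a' P'] Suc.prems a' by auto
  then have "smooth_bound j m (norm (2 * of_real pi * \<i>) * K) (\<lambda>t. 2 * of_real pi * \<i> * quot f g P' a' (Suc b) t)"
    by (rule smooth_bound_scale)
  then have "smooth_bound j (Suc m) (norm (2 * of_real pi * \<i>) * K) (quot f g P a b)"
    using P' a' by (auto intro!: exI[of _ "\<lambda>t. 2 * of_real pi * \<i> * quot f g P' a' (Suc b) t"])
  then show ?case ..
qed

definition fdiff :: "'d \<Rightarrow> real \<Rightarrow> (real ^ 'd \<Rightarrow> complex) \<Rightarrow> real ^ 'd::finite \<Rightarrow> complex" where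
  "fdiff j h \<phi> t = \<phi> (t + axis j h) - \<phi> t"

text \<open>Differences commute with derivatives, so the claim reduces to the mean value inequality
  for the last derivative.\<close>

lemma smooth_bound_fdiff: "smooth_bound j (Suc m) K \<phi> \<Longrightarrow> smooth_bound j m (\<bar>h\<bar> * K) (fdiff j h \<phi>)"
proof (induction m arbitrary: \<phi>)
  case 0
  then obtain \<phi>' where \<phi>': "\<And>t s. ((\<lambda>s. \<phi> (t + axis j s)) has_vector_derivative \<phi>' (t + axis j s)) (at s)"
    "\<And>t. norm (\<phi>' t) \<le> K" by auto
  have "norm (\<phi> (t + axis j h) - \<phi> (t + axis j 0)) \<le> K * \<bar>h - 0\<bar>" for t
    by (rule vector_differentiable_bound[OF \<phi>'])
  then show ?case by (simp add: fdiff_def mult.commute)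
next
  case (Suc m)
  then obtain \<phi>' where \<phi>': "\<And>t s. ((\<lambda>s. \<phi> (t + axis j s)) has_vector_derivative \<phi>' (t + axis j s)) (at s)"
    "smooth_bound j (Suc m) K \<phi>'" by auto
  have "((\<lambda>s. fdiff j h \<phi> (t + axis j s)) has_vector_derivative fdiff j h \<phi>' (t + axis j s)) (at s)" for t s
  proof -
    have "((\<lambda>s. \<phi> (t + axis j h + axis j s)) has_vector_derivative \<phi>' (t + axis j h + axis j s)) (at s)"
      by (rule \<phi>')
    moreover have "t + axis j h + axis j s = t + axis j s + axis j h" for s by (simp add: add_ac)
    ultimately show ?thesis
      unfolding fdiff_def by (intro has_vector_derivative_diff \<phi>') simp
  qed
  then show ?case using Suc.IH[OF \<phi>'(2)] by auto
qed

lemma fdiff_funpow_bound: "smooth_bound j m K \<phi> \<Longrightarrow> norm ((fdiff j h ^^ m) \<phi> t) \<le> \<bar>h\<bar> ^ m * K"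
proof (induction m arbitrary: \<phi> K)
  case (Suc m)
  have "norm ((fdiff j h ^^ m) (fdiff j h \<phi>) t) \<le> \<bar>h\<bar> ^ m * (\<bar>h\<bar> * K)"
    by (rule Suc.IH[OF smooth_bound_fdiff[OF Suc.prems]])
  then show ?case by (simp only: funpow_Suc_right o_apply power_Suc2 mult.assoc)
qed simp

section \<open>Discrete Fourier coefficients\<close>

definition grid :: "nat \<Rightarrow> (int ^ 'd::finite) set" where
  "grid N = {k. \<forall>i. 0 \<le> k $ i \<and> k $ i < int N}"

text \<open>Averages over a finite grid of torsion points stand in for integrals over the torus; the
  grid is refined at the end by a compactness argument.\<close>

definition mean :: "nat \<Rightarrow> (int ^ 'd::finite \<Rightarrow> complex) \<Rightarrow> complex" where
  "mean N \<psi> = (\<Sum>k\<in>grid N. \<psi> k) / of_nat (card (grid N :: (int ^ 'd) set))"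

lemma finite_int_vec_bounded: "finite {k :: int ^ 'd::finite. \<forall>i. a \<le> k $ i \<and> k $ i \<le> b}"
proof -
  have "{k :: int ^ 'd. \<forall>i. a \<le> k $ i \<and> k $ i \<le> b} = vec_lambda ` (PiE UNIV (\<lambda>_. {a..b}))"
    by (force simp: PiE_def Pi_def image_iff intro: vec_nth_inverse[symmetric])
  then show ?thesis by (simp add: finite_PiE)
qed

lemma finite_grid [simp]: "finite (grid N)"
  by (rule finite_subset[OF _ finite_int_vec_bounded[of 0 "int N"]]) (auto simp: grid_def intro: less_imp_le)

lemma grid_nonempty: "N > 0 \<Longrightarrow> grid N \<noteq> {}"
  by (auto simp: grid_def intro!: exI[of _ 0])

lemma norm_mean_le: "N > 0 \<Longrightarrow> (\<And>k. norm (\<psi> k) \<le> B) \<Longrightarrow> norm (mean N \<psi>) \<le> B"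
proof -
  assume *: "N > 0" "\<And>k. norm (\<psi> k) \<le> B"
  have "norm (\<Sum>k\<in>grid N. \<psi> k) \<le> of_nat (card (grid N :: (int ^ 'a) set)) * B"
    by (rule sum_norm_bound) (rule *)
  moreover have "real (card (grid N :: (int ^ 'a) set)) > 0"
    using grid_nonempty[OF *(1)] by (simp add: card_gt_0_iff)
  ultimately show ?thesis by (simp add: mean_def norm_divide pos_divide_le_eq mult.commute)
qed

lemma mean_cmult: "mean N (\<lambda>k. c * \<psi> k) = c * mean N \<psi>"
  by (simp add: mean_def sum_distrib_left)

lemma mean_diff: "mean N (\<lambda>k. \<psi> k - \<psi>' k) = mean N \<psi> - mean N \<psi>'"
  by (simp add: mean_def sum_subtractf diff_divide_distrib)

lemma mean_sum: "mean N (\<lambda>k. \<Sum>i\<in>A. \<psi> i k) = (\<Sum>i\<in>A. mean N (\<psi> i))"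
  unfolding mean_def by (subst sum.swap) (simp add: sum_divide_distrib)

lemma mean_1 [simp]: "N > 0 \<Longrightarrow> mean N (\<lambda>k :: int ^ 'd::finite. 1) = 1"
  using grid_nonempty[of N] by (simp add: mean_def)

lemma mean_shift:
  assumes "N > 0" "\<And>k. \<psi> (k + axis j (int N)) = \<psi> k"
  shows "mean N (\<lambda>k. \<psi> (k + axis j 1)) = mean N \<psi>"
proof -
  \<comment> \<open>The cyclic shift of the \<open>j\<close>-th coordinate modulo \<open>N\<close>,
    and its inverse.\<close>
  let ?up = "\<lambda>k. if k $ j = int N - 1 then k - axis j (int N - 1) else k + axis j 1"
  let ?down = "\<lambda>k. if k $ j = 0 then k + axis j (int N - 1) else k - axis j 1"
  have "(\<Sum>k\<in>grid N. \<psi> (k + axis j 1)) = (\<Sum>k\<in>grid N. \<psi> k)"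
  proof (rule sum.reindex_bij_witness[of _ ?down ?up])
    fix k :: "int ^ 'a" assume k: "k \<in> grid N"
    then have kj: "0 \<le> k $ j" "k $ j < int N" by (auto simp: grid_def)
    have "k $ j \<noteq> int N - 1 \<Longrightarrow> k $ j + 1 < int N" "k $ j \<noteq> 0 \<Longrightarrow> 1 \<le> k $ j" "k $ j - 1 < int N"
      using kj by linarith+
    then show "?up k \<in> grid N" "?down k \<in> grid N" using k assms(1) by (auto simp: grid_def axis_def)
    show "?down (?up k) = k" "?up (?down k) = k" using kj by (auto simp: axis_def vec_eq_iff)
    show "\<psi> (?up k) = \<psi> (k + axis j 1)"
    proof (cases "k $ j = int N - 1")
      case True
      have eq: "k + axis j 1 = k - axis j (int N - 1) + axis j (int N)"
        by (simp add: vec_eq_iff axis_def)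
      show ?thesis unfolding eq assms(2) using True by simp
    qed simp
  qed
  then show ?thesis by (simp add: mean_def)
qed

definition gridpt :: "nat \<Rightarrow> int ^ 'd \<Rightarrow> real ^ 'd::finite" where
  "gridpt N k = (\<chi> i. of_int (k $ i) / real N)"

lemma gridpt_add: "gridpt N (k + l) = gridpt N k + gridpt N l"
  by (simp add: gridpt_def vec_eq_iff add_divide_distrib)

lemma gridpt_axis: "gridpt N (axis j m) = axis j (of_int m / real N)"
  by (simp add: gridpt_def vec_eq_iff axis_def)

definition fcoef :: "nat \<Rightarrow> (real ^ 'd \<Rightarrow> complex) \<Rightarrow> int ^ 'd::finite \<Rightarrow> complex" where
  "fcoef N \<phi> n = mean N (\<lambda>k. \<phi> (gridpt N k) * e2pi (- pairing n (gridpt N k)))"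

definition periodic :: "(real ^ 'd::finite \<Rightarrow> complex) \<Rightarrow> bool" where
  "periodic \<phi> \<longleftrightarrow> (\<forall>t j. \<phi> (t + axis j 1) = \<phi> t)"

lemma periodic_fdiff: "periodic \<phi> \<Longrightarrow> periodic (fdiff j h \<phi>)"
  unfolding periodic_def fdiff_def by (metis add.assoc add.commute)

lemma e2pi_shift_int: "e2pi (x - of_int n) = e2pi x"
  by (metis diff_add_cancel e2pi_add e2pi_of_int mult.right_neutral)

text \<open>Summation by parts: shifting the grid by one step in direction \<open>j\<close>
  preserves the mean of a periodic function and multiplies the character by a root of unity.\<close>

lemma fcoef_fdiff:
  assumes "N > 0" "periodic \<phi>"
  shows "fcoef N (fdiff j (1 / real N) \<phi>) n = (e2pi (of_int (n $ j) / real N) - 1) * fcoef N \<phi> n"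
proof -
  define \<psi> where "\<psi> k = \<phi> (gridpt N k) * e2pi (- pairing n (gridpt N k))" for k
  have "\<psi> (k + axis j (int N)) = \<psi> k" for k
    using assms e2pi_shift_int[of "- pairing n (gridpt N k)" "n $ j"]
    by (simp add: \<psi>_def gridpt_add gridpt_axis pairing_add_right pairing_axis_right periodic_def)
  then have shift: "mean N (\<lambda>k. \<psi> (k + axis j 1)) = mean N \<psi>" by (rule mean_shift[OF assms(1)])
  have "fdiff j (1 / real N) \<phi> (gridpt N k) * e2pi (- pairing n (gridpt N k)) =
      e2pi (of_int (n $ j) / real N) * \<psi> (k + axis j 1) - \<psi> k" for k
    by (simp add: fdiff_def \<psi>_def gridpt_add gridpt_axis pairing_add_right pairing_axis_right left_diff_distrib
        mult.left_commute[of "e2pi (of_int (n $ j) / real N)"] flip: e2pi_add)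
  then have "fcoef N (fdiff j (1 / real N) \<phi>) n = e2pi (of_int (n $ j) / real N) * mean N (\<lambda>k. \<psi> (k + axis j 1)) - mean N \<psi>"
    by (simp add: fcoef_def mean_diff mean_cmult)
  moreover have "fcoef N \<phi> n = mean N \<psi>" by (simp add: fcoef_def \<psi>_def[abs_def])
  ultimately show ?thesis by (simp add: shift left_diff_distrib)
qed

lemma fcoef_fdiff_funpow:
  assumes "N > 0" "periodic \<phi>"
  shows "fcoef N ((fdiff j (1 / real N) ^^ m) \<phi>) n = (e2pi (of_int (n $ j) / real N) - 1) ^ m * fcoef N \<phi> n
    \<and> periodic ((fdiff j (1 / real N) ^^ m) \<phi>)"
  by (induction m) (use assms in \<open>auto simp: fcoef_fdiff periodic_fdiff\<close>)

text \<open>The left side of the identity below is a chord of length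
  \<open>2 * \<bar>sin (pi * x)\<bar>\<close>; the estimate \<open>y / 2 \<le> sin y\<close> up to
  \<open>pi / 2\<close> comes from \<open>sin y = tan (y / 2) * (1 + cos y)\<close>.\<close>

lemma norm_e2pi_minus_1:
  assumes "\<bar>x\<bar> \<le> 1 / 2" shows "norm (e2pi x - 1) \<ge> \<bar>x\<bar>"
proof -
  have *: "y / 2 \<le> sin y" if y: "0 \<le> y" "y \<le> pi / 2" for y :: real
  proof -
    have c: "cos (y / 2) > 0" by (intro cos_gt_zero_pi) (use y pi_gt_zero in linarith)+
    have "\<bar>y / 2\<bar> \<le> \<bar>tan (y / 2)\<bar>" by (rule abs_tan_ge) (use y pi_gt_zero in linarith)
    moreover have "tan (y / 2) \<ge> 0"
      using tan_gt_zero[of "y / 2"] y pi_gt_zero by (cases "y = 0") (auto intro: less_imp_le)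
    ultimately have t: "y / 2 \<le> tan (y / 2)" using y by simp
    have "sin y = 2 * sin (y / 2) * cos (y / 2)" using sin_double[of "y / 2"] by simp
    also have "\<dots> = 2 * tan (y / 2) * (cos (y / 2))\<^sup>2" using c by (simp add: tan_def power2_eq_square)
    also have "\<dots> = tan (y / 2) * (1 + cos y)" using cos_double_cos[of "y / 2"] by simp
    also have "\<dots> \<ge> (y / 2) * 1"
      using t y cos_ge_zero[of y] by (intro mult_mono) auto
    finally show ?thesis by simp
  qed
  have "norm (e2pi x - 1) = 2 * \<bar>sin (pi * x)\<bar>"
    using dist_exp_i_1[of "2 * pi * x"] by (simp add: e2pi_def mult_ac)
  also have "\<bar>sin (pi * x)\<bar> = \<bar>sin (pi * \<bar>x\<bar>)\<bar>" by (simp add: abs_if)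
  also have "2 * \<dots> \<ge> 2 * (pi * \<bar>x\<bar> / 2)"
    using *[of "pi * \<bar>x\<bar>"] assms by (simp add: abs_if)
  moreover have "pi * \<bar>x\<bar> \<ge> 1 * \<bar>x\<bar>" using pi_ge_two by (intro mult_right_mono) auto
  ultimately show ?thesis by simp
qed

text \<open>Taking \<open>m\<close> differences with step \<open>1 / N\<close> multiplies the
  coefficient by a number of modulus at least \<open>(\<bar>n $ j\<bar> / N) ^ m\<close>, while the
  differences are at most \<open>K / N ^ m\<close>. The powers of \<open>N\<close> cancel, so the
  bound is uniform in the grid.\<close>

lemma fcoef_decay:
  assumes "N > 0" "periodic \<phi>" "smooth_bound j m K \<phi>" and n: "2 * \<bar>n $ j\<bar> \<le> int N"
  shows "\<bar>of_int (n $ j)\<bar> ^ m * norm (fcoef N \<phi> n) \<le> K"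
proof -
  define x where "x = of_int (n $ j) / real N"
  have "\<bar>of_int (n $ j)\<bar> \<le> real N / 2" using n by linarith
  then have "\<bar>x\<bar> \<le> 1 / 2" using assms(1) by (simp add: x_def abs_divide divide_simps)
  then have "\<bar>x\<bar> ^ m * norm (fcoef N \<phi> n) \<le> norm (e2pi x - 1) ^ m * norm (fcoef N \<phi> n)"
    by (intro mult_right_mono power_mono norm_e2pi_minus_1) auto
  also have "\<dots> = norm (fcoef N ((fdiff j (1 / real N) ^^ m) \<phi>) n)"
    using fcoef_fdiff_funpow[OF assms(1,2)] by (simp add: x_def norm_mult norm_power)
  also have "\<dots> \<le> \<bar>1 / real N\<bar> ^ m * K"
    unfolding fcoef_def
    by (rule norm_mean_le[OF assms(1)]) (simp only: norm_mult norm_e2pi mult_1_right fdiff_funpow_bound[OF assms(3)])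
  finally show ?thesis
    using assms(1) by (simp add: x_def abs_divide power_divide divide_simps split: if_splits)
qed

text \<open>Orthogonality of characters on the grid. Frequencies within \<open>N / 2\<close> of
  \<open>n\<close> are not aliased with \<open>n\<close>: for \<open>l \<noteq> n\<close> some
  coordinate shift multiplies the character by a root of unity other than 1.\<close>

lemma fcoef_ev:
  assumes "N > 0" "\<And>l i. l \<in> supp p \<Longrightarrow> 2 * \<bar>l $ i - n $ i\<bar> \<le> int N"
  shows "fcoef N (ev p) n = of_int (coef p n)"
proof -
  define \<psi> where "\<psi> l k = e2pi (pairing (l - n) (gridpt N k))" for l k
  have ortho: "mean N (\<psi> l) = (if l = n then 1 else 0)" if l: "l \<in> supp p" for l
  proof (cases "l = n")
    case True
    then show ?thesis using mean_1[OF assms(1)] by (simp add: \<psi>_def[abs_def])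
  next
    case False
    then obtain j where j: "l $ j \<noteq> n $ j" by (auto simp: vec_eq_iff)
    define x where "x = of_int (l $ j - n $ j) / real N"
    have "real_of_int (2 * \<bar>l $ j - n $ j\<bar>) \<le> real_of_int (int N)"
      using assms(2)[OF l] by (rule of_int_le_iff[THEN iffD2])
    then have "\<bar>of_int (l $ j - n $ j)\<bar> \<le> real N / 2" by simp
    then have "\<bar>x\<bar> \<le> 1 / 2" using assms(1) by (simp add: x_def abs_divide divide_simps)
    then have "norm (e2pi x - 1) \<ge> \<bar>x\<bar>" by (rule norm_e2pi_minus_1)
    moreover have "x \<noteq> 0" using j assms(1) by (simp add: x_def)
    ultimately have "e2pi x \<noteq> 1" by auto
    have "\<psi> l (k + axis j (int N)) = \<psi> l k" for k
      using assms(1) e2pi_of_int[of "l $ j - n $ j"]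
      by (simp add: \<psi>_def gridpt_add gridpt_axis pairing_add_right pairing_axis_right e2pi_add del: e2pi_of_int)
    then have "mean N (\<lambda>k. \<psi> l (k + axis j 1)) = mean N (\<psi> l)" by (rule mean_shift[OF assms(1)])
    moreover have "\<psi> l (k + axis j 1) = e2pi x * \<psi> l k" for k
      by (simp add: \<psi>_def gridpt_add gridpt_axis pairing_add_right pairing_axis_right e2pi_add x_def)
    ultimately have "e2pi x * mean N (\<psi> l) = mean N (\<psi> l)" by (simp add: mean_cmult)
    then show ?thesis using \<open>e2pi x \<noteq> 1\<close> False by simp
  qed
  have "fcoef N (ev p) n = mean N (\<lambda>k. \<Sum>l\<in>supp p. of_int (coef p l) * \<psi> l k)"
    unfolding fcoef_def ev_def \<psi>_def
    by (simp add: sum_distrib_right mult.assoc pairing_diff_left flip: e2pi_add)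
  also have "\<dots> = (\<Sum>l\<in>supp p. of_int (coef p l) * mean N (\<psi> l))"
    by (simp add: mean_sum mean_cmult)
  also have "\<dots> = (\<Sum>l\<in>supp p. if l = n then of_int (coef p l) else 0)"
    by (intro sum.cong) (auto simp: ortho)
  also have "\<dots> = of_int (coef p n)" by (simp add: in_keys_iff)
  finally show ?thesis .
qed

lemma conv_fcoef: "conv p (fcoef N \<phi>) n = fcoef N (\<lambda>t. \<phi> t * ev p t) n"
proof -
  have "e2pi (- pairing (n - m) t) = e2pi (pairing m t) * e2pi (- pairing n t)" for m t
    by (simp add: pairing_diff_left flip: e2pi_add)
  then have "conv p (fcoef N \<phi>) n = (\<Sum>m\<in>supp p. mean N (\<lambda>k. of_int (coef p m) * (\<phi> (gridpt N k) *
      (e2pi (pairing m (gridpt N k)) * e2pi (- pairing n (gridpt N k))))))"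
    by (simp add: conv_def fcoef_def mean_cmult)
  also have "\<dots> = fcoef N (\<lambda>t. \<phi> t * ev p t) n"
    by (simp add: mean_sum[symmetric] fcoef_def ev_def sum_distrib_left sum_distrib_right mult_ac)
  finally show ?thesis .
qed

lemma ev_periodic_axis:
  fixes p :: "'d::finite laurent" shows "ev p (t + axis j 1) = ev p t"
proof -
  have "(axis j 1 :: real ^ 'd) = (\<chi> i. of_int (axis j (1::int) $ i))" by (simp add: axis_def vec_eq_iff)
  then show ?thesis by (simp only: ev_periodic)
qed

section \<open>Summable weights and the homoclinic point\<close>

lemma sum_inverse_squares_int:
  assumes "R \<ge> 1" shows "(\<Sum>i\<in>{- int R..int R}. 1 / max 1 \<bar>of_int i :: real\<bar> ^ 2) \<le> 5 - 2 / real R"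
  using assms
proof (induction R rule: dec_induct)
  case base
  have "{-1..1::int} = {-1, 0, 1}" by auto
  then show ?case by simp
next
  case (step R)
  have "{- int (Suc R)..int (Suc R)} = insert (- int (Suc R)) (insert (int (Suc R)) {- int R..int R})" by auto
  \<comment> \<open>The two new terms are dominated by a telescoping difference, which explains the
    correction \<open>2 / real R\<close> in the bound.\<close>
  moreover have "1 / (1 + real R)\<^sup>2 + 1 / (1 + real R)\<^sup>2 \<le> 2 / real R - 2 / (1 + real R)"
    using step.hyps by (simp add: divide_simps power2_eq_square)
  ultimately show ?case using step.IH by (simp add: max_def add.commute[of "real R" 1])
qed

text \<open>A product weight, so that its sum over a box factors into one-dimensional sums.\<close>

definition decay :: "int ^ 'd::finite \<Rightarrow> real" where
  "decay n = (\<Prod>i\<in>UNIV. 1 / max 1 \<bar>of_int (n $ i)\<bar> ^ 2)"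

lemma sum_decay_le:
  assumes "finite T" shows "(\<Sum>n\<in>T. decay (n :: int ^ 'd::finite)) \<le> 5 ^ CARD('d)"
proof -
  obtain R where R: "R \<ge> 1" "\<And>n i. n \<in> T \<Longrightarrow> \<bar>n $ i\<bar> \<le> int R"
  proof -
    define R where "R = nat (1 + (\<Sum>n\<in>T. \<Sum>i\<in>UNIV. \<bar>n $ i\<bar>))"
    have nn: "0 \<le> (\<Sum>n\<in>T. \<Sum>i\<in>UNIV. \<bar>n $ i\<bar>)" by (intro sum_nonneg) auto
    have "\<bar>n $ i\<bar> \<le> int R" if "n \<in> T" for n i
    proof -
      have "\<bar>n $ i\<bar> \<le> (\<Sum>i\<in>UNIV. \<bar>n $ i\<bar>)" by (rule member_le_sum) auto
      also have "\<dots> \<le> (\<Sum>n\<in>T. \<Sum>i\<in>UNIV. \<bar>n $ i\<bar>)"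
        by (rule member_le_sum[OF that, of "\<lambda>n. \<Sum>i\<in>UNIV. \<bar>n $ i\<bar>"]) (auto intro: sum_nonneg assms)
      finally show ?thesis using nn by (simp add: R_def)
    qed
    then show ?thesis using that[of R] nn by (simp add: R_def)
  qed
  let ?I = "{- int R..int R}" and ?w = "\<lambda>i::int. 1 / max 1 \<bar>of_int i :: real\<bar> ^ 2"
  have inj: "inj_on vec_lambda (PiE UNIV (\<lambda>_::'d. ?I))" by (auto simp: inj_on_def vec_lambda_inject)
  have "T \<subseteq> vec_lambda ` (PiE UNIV (\<lambda>_::'d. ?I))"
  proof
    fix n assume "n \<in> T"
    then have "vec_nth n \<in> PiE UNIV (\<lambda>_::'d. ?I)" using R(2) by (auto simp: abs_le_iff minus_le_iff)
    then show "n \<in> vec_lambda ` (PiE UNIV (\<lambda>_::'d. ?I))" by (metis image_eqI vec_nth_inverse)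
  qed
  then have "(\<Sum>n\<in>T. decay n) \<le> (\<Sum>n\<in>vec_lambda ` (PiE UNIV (\<lambda>_::'d. ?I)). decay n)"
    by (intro sum_mono2) (auto simp: finite_PiE decay_def intro: prod_nonneg)
  also have "\<dots> = (\<Sum>h\<in>PiE UNIV (\<lambda>_::'d. ?I). \<Prod>i\<in>UNIV. ?w (h i))"
    by (simp add: sum.reindex[OF inj] decay_def)
  also have "\<dots> = (\<Prod>i\<in>(UNIV::'d set). \<Sum>k\<in>?I. ?w k)"
    by (rule prod_sum_PiE[symmetric]) auto
  also have "\<dots> = (\<Sum>k\<in>?I. ?w k) ^ CARD('d)" by simp
  also have "\<dots> \<le> 5 ^ CARD('d)"
  proof (rule power_mono)
    have "2 / real R \<ge> 0" by simp
    then show "(\<Sum>k\<in>?I. ?w k) \<le> 5" using sum_inverse_squares_int[OF R(1)] by linarith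
  qed (auto intro: sum_nonneg)
  finally show ?thesis .
qed

text \<open>The product of the squared coordinates, each replaced by at least 1, is bounded by the
  power \<open>2 * CARD('d)\<close> of the largest. Decay in one coordinate direction at a time is
  therefore enough.\<close>

lemma le_decayI:
  fixes n :: "int ^ 'd::finite"
  assumes "x \<le> K" "\<And>j. \<bar>of_int (n $ j)\<bar> ^ (2 * CARD('d)) * x \<le> K" "x \<ge> 0"
  shows "x \<le> K * decay n"
proof -
  define M where "M j = max 1 \<bar>of_int (n $ j) :: real\<bar>" for j
  have "Max (range M) \<in> range M" by (rule Max_in) auto
  then obtain j where "Max (range M) = M j" by blast
  then have j: "M i \<le> M j" for i using Max_ge[of "range M" "M i"] by simp
  have M1: "M i \<ge> 1" for i by (simp add: M_def)
  have "(\<Prod>i\<in>UNIV. M i ^ 2) \<le> (\<Prod>i\<in>(UNIV::'d set). M j ^ 2)"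
    using M1 j by (intro prod_mono) (auto intro!: power_mono order_trans[OF zero_le_one M1])
  also have "\<dots> = M j ^ (2 * CARD('d))" by (simp add: power_mult)
  finally have "(\<Prod>i\<in>UNIV. M i ^ 2) * x \<le> M j ^ (2 * CARD('d)) * x"
    using assms(3) by (rule mult_right_mono)
  also have "\<dots> \<le> K" using assms(1,2) by (auto simp: M_def max_def)
  finally have "(\<Prod>i\<in>UNIV. M i ^ 2) * x \<le> K" .
  moreover have "(\<Prod>i\<in>UNIV. M i ^ 2) > 0"
    by (intro prod_pos ballI zero_less_power order_less_le_trans[OF zero_less_one M1])
  ultimately show ?thesis
    by (simp add: decay_def prod_dividef divide_simps mult.commute flip: M_def)
qed

text \<open>
  The function \<open>w\<close> consists of the Fourier coefficients of \<open>g\<^sup>a / f\<close>: a summable homoclinic point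
  in the dual group of \<open>R\<^sub>d / (f)\<close>.
\<close>

lemma summable_homoclinic_point:
  fixes f g :: "'d::finite laurent"
  assumes dom: "\<And>t. norm (ev g t) ^ 2 \<le> C * norm (ev f t)" and C: "C \<ge> 0"
  obtains w a B where "\<And>n. conv f w n = of_int (coef (g ^ a) n)"
    "\<And>T. finite T \<Longrightarrow> (\<Sum>n\<in>T. norm (w n)) \<le> B"
proof -
  define m where "m = 2 * CARD('d)"
  \<comment> \<open>The exponent needed for \<open>m\<close> derivatives of
    \<open>g ^ a / f\<close>: \<open>2 * b + 3 * m\<close> with \<open>b = 1\<close>.\<close>
  define a where "a = 2 + 3 * m"
  define \<phi> where "\<phi> = quot f g 1 a 1"
  have per: "periodic \<phi>" by (simp add: \<phi>_def periodic_def quot_def ev_periodic_axis)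
  have mult: "\<phi> t * ev f t = ev (g ^ a) t" for t
  proof (cases "ev f t = 0")
    \<comment> \<open>At a zero of \<open>f\<close> the convention gives
      \<open>\<phi> t = 0\<close>, in agreement with the right side because \<open>g\<close>
      vanishes there as well.\<close>
    case True
    then have "ev g t = 0" using dom[of t] by simp
    moreover have "a > 0" by (simp add: a_def)
    ultimately show ?thesis using True by (simp add: ev_power zero_power)
  qed (simp add: \<phi>_def quot_def ev_power)
  have "\<exists>K. smooth_bound j m K \<phi>" for j
    unfolding \<phi>_def by (rule smooth_bound_quot[OF dom C]) (auto simp: a_def)
  then obtain K where K: "\<And>j. smooth_bound j m (K j) \<phi>" by metis
  \<comment> \<open>For zero derivatives the direction does not matter.\<close>
  have "\<exists>K. smooth_bound undefined 0 K \<phi>"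
    unfolding \<phi>_def by (rule smooth_bound_quot[OF dom C]) (auto simp: a_def)
  then obtain K0 where K0: "smooth_bound undefined 0 K0 \<phi>" ..
  define L where "L = Max (insert K0 (range K))"
  have L: "K0 \<le> L" "\<And>j. K j \<le> L" unfolding L_def by (auto intro!: Max_ge simp del: Max_insert)
  define v where "v N = fcoef (Suc N) \<phi>" for N
  have v0: "norm (v N n) \<le> K0" for N n
    unfolding v_def fcoef_def by (rule norm_mean_le) (use K0 in \<open>auto simp: norm_mult\<close>)
  \<comment> \<open>The coefficients are bounded uniformly in the grid and the lattice is countable,
    so a diagonal subsequence converges pointwise; its limit is \<open>w\<close>.\<close>
  obtain r where r: "strict_mono (r :: nat \<Rightarrow> nat)" "\<And>n. \<exists>l. (\<lambda>i. v (r i) n) \<longlonglongrightarrow> l"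
    using function_convergent_subsequence[of UNIV v K0] v0 by auto
  from r(2) obtain w where w: "\<And>n. (\<lambda>i. v (r i) n) \<longlonglongrightarrow> w n" by metis
  \<comment> \<open>The grid eventually outgrows any given frequency, so that both
    \<open>fcoef_ev\<close> and \<open>fcoef_decay\<close> apply in the limit.\<close>
  have ev_le: "\<forall>\<^sub>F i in sequentially. x \<le> int (Suc (r i))" for x
  proof (rule eventually_sequentiallyI[of "nat x"])
    fix i assume "nat x \<le> i"
    then show "x \<le> int (Suc (r i))" using seq_suble[OF r(1), of i] by linarith
  qed
  have "conv f w n = of_int (coef (g ^ a) n)" for n
  proof -
    have "(\<lambda>i. conv f (v (r i)) n) \<longlonglongrightarrow> conv f w n"
      unfolding conv_def by (intro tendsto_intros w)
    moreover have "\<forall>\<^sub>F i in sequentially. conv f (v (r i)) n = of_int (coef (g ^ a) n)"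
    proof -
      have "\<forall>\<^sub>F i in sequentially. \<forall>l\<in>supp (g ^ a). \<forall>j\<in>UNIV. 2 * \<bar>l $ j - n $ j\<bar> \<le> int (Suc (r i))"
        by (intro eventually_ball_finite ballI ev_le) auto
      then show ?thesis
      proof eventually_elim
        case (elim i)
        have "conv f (v (r i)) n = fcoef (Suc (r i)) (ev (g ^ a)) n"
          by (simp add: v_def conv_fcoef mult)
        also have "\<dots> = of_int (coef (g ^ a) n)" by (rule fcoef_ev) (use elim in auto)
        finally show ?case .
      qed
    qed
    ultimately have "(\<lambda>i. of_int (coef (g ^ a) n) :: complex) \<longlonglongrightarrow> conv f w n"
      by (rule Lim_transform_eventually)
    then show ?thesis by (simp add: LIMSEQ_const_iff)
  qed
  moreover have w_le: "norm (w n) \<le> L * decay n" for n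
  proof (rule le_decayI)
    have lim: "(\<lambda>i. norm (v (r i) n)) \<longlonglongrightarrow> norm (w n)" by (intro tendsto_norm w)
    show "norm (w n) \<le> L"
      by (rule LIMSEQ_le_const2[OF lim]) (use v0 L(1) order_trans in blast)
    show "\<bar>of_int (n $ j)\<bar> ^ (2 * CARD('d)) * norm (w n) \<le> L" for j
    proof (rule tendsto_upperbound)
      show "(\<lambda>i. \<bar>of_int (n $ j)\<bar> ^ (2 * CARD('d)) * norm (v (r i) n)) \<longlonglongrightarrow> \<bar>of_int (n $ j)\<bar> ^ (2 * CARD('d)) * norm (w n)"
        by (intro tendsto_intros lim)
      show "\<forall>\<^sub>F i in sequentially. \<bar>of_int (n $ j)\<bar> ^ (2 * CARD('d)) * norm (v (r i) n) \<le> L"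
        using ev_le[of "2 * \<bar>n $ j\<bar>"]
      proof eventually_elim
        case (elim i)
        then show ?case
          using fcoef_decay[OF _ per K, of "Suc (r i)" n j] L(2)[of j] by (simp add: v_def m_def)
      qed
    qed simp
  qed simp
  have "(\<Sum>n\<in>T. norm (w n)) \<le> L * 5 ^ CARD('d)" if "finite T" for T
  proof -
    have "(\<Sum>n\<in>T. norm (w n)) \<le> L * (\<Sum>n\<in>T. decay n)"
      unfolding sum_distrib_left by (intro sum_mono w_le)
    also have "\<dots> \<le> L * 5 ^ CARD('d)"
    proof (rule mult_left_mono[OF sum_decay_le[OF that]])
      show "0 \<le> L" using order_trans[OF norm_ge_zero v0[of 0 0]] L(1) by linarith
    qed
    finally show ?thesis .
  qed
  ultimately show ?thesis using that by blast
qed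

section \<open>Separating the translates\<close>

lemma component_le_max_norm: "\<bar>n $ j\<bar> \<le> max_norm n"
  unfolding max_norm_def by (rule Max_ge) auto

lemma max_norm_leI: "(\<And>j. \<bar>n $ j\<bar> \<le> K) \<Longrightarrow> max_norm n \<le> K"
  unfolding max_norm_def by (subst Max_le_iff) auto

lemma max_norm_nonneg: "0 \<le> max_norm n"
  using component_le_max_norm[of n undefined] by linarith

lemma max_norm_triangle: "max_norm (m + n) \<le> max_norm m + max_norm n"
proof (rule max_norm_leI)
  fix j show "\<bar>(m + n) $ j\<bar> \<le> max_norm m + max_norm n"
    using component_le_max_norm[of m j] component_le_max_norm[of n j] by simp
qed

lemma max_norm_minus_commute: "max_norm (m - n) = max_norm (n - m)"
  by (simp add: max_norm_def abs_minus_commute)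

lemma conv_superset:
  assumes "finite E" "supp p \<subseteq> E"
  shows "conv p w k = (\<Sum>m\<in>E. of_int (coef p m) * w (k - m))"
  unfolding conv_def by (rule sum.mono_neutral_left) (use assms in \<open>auto simp: in_keys_iff\<close>)

lemma conv_diff_right: "conv p (\<lambda>n. v n - w n) k = conv p v k - conv p w k"
  by (simp add: conv_def right_diff_distrib sum_subtractf)

text \<open>A finite set \<open>T0\<close> nearly attains the supremum of the finite sums; any
  finite set disjoint from it adds at most \<epsilon>.\<close>

lemma summable_tail:
  fixes w :: "int ^ 'd::finite \<Rightarrow> complex"
  assumes "\<And>T. finite T \<Longrightarrow> (\<Sum>n\<in>T. norm (w n)) \<le> B" and "\<epsilon> > 0"
  obtains R where "R \<ge> 1" "\<And>T. finite T \<Longrightarrow> (\<And>n. n \<in> T \<Longrightarrow> max_norm n \<ge> R) \<Longrightarrow> (\<Sum>n\<in>T. norm (w n)) \<le> \<epsilon>"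
proof -
  define X where "X = (\<lambda>T. \<Sum>n\<in>T. norm (w n)) ` {T. finite T}"
  have bdd: "bdd_above X" and ne: "X \<noteq> {}"
    using assms(1) by (auto simp: X_def intro!: bdd_aboveI[of _ B])
  obtain T0 where T0: "finite T0" "(\<Sum>n\<in>T0. norm (w n)) > Sup X - \<epsilon>"
    using less_cSupE[OF _ ne, of "Sup X - \<epsilon>"] assms(2) by (auto simp: X_def)
  define R where "R = 1 + Max (insert 0 (max_norm ` T0))"
  have le: "max_norm n < R" if "n \<in> T0" for n
  proof -
    have "max_norm n \<le> Max (insert 0 (max_norm ` T0))" by (rule Max_ge) (use T0 that in auto)
    then show ?thesis by (simp add: R_def)
  qed
  have "0 \<le> Max (insert 0 (max_norm ` T0))" by (rule Max_ge) (use T0 in auto)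
  then have "R \<ge> 1" by (simp add: R_def)
  moreover have "(\<Sum>n\<in>T. norm (w n)) \<le> \<epsilon>" if T: "finite T" "\<And>n. n \<in> T \<Longrightarrow> max_norm n \<ge> R" for T
  proof -
    have "T \<inter> T0 = {}" using T(2) le by force
    then have "(\<Sum>n\<in>T. norm (w n)) + (\<Sum>n\<in>T0. norm (w n)) = (\<Sum>n\<in>T \<union> T0. norm (w n))"
      using T(1) T0(1) by (simp add: sum.union_disjoint)
    also have "\<dots> \<le> Sup X" by (rule cSup_upper[OF _ bdd]) (use T(1) T0(1) in \<open>auto simp: X_def\<close>)
    finally show ?thesis using T0(2) by linarith
  qed
  ultimately show ?thesis using that by blast
qed

text \<open>
  A finitely supported integer approximation \<open>u\<close> of the convolution \<open>p w\<close> with error below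
  \<open>1 / norm1 f\<close> gives \<open>f u = p f w\<close> exactly, because both sides are integer valued.
\<close>

lemma dvd_from_approximation:
  assumes w: "\<And>n. conv f w n = of_int (coef G n)" and e: "norm1 f * e < 1"
    and approx: "\<And>k. norm (of_int (coef u k) - conv z w k) \<le> e"
  shows "f dvd z * G"
proof -
  have "coef (f * u) k = coef (z * G) k" for k
  proof -
    have "conv f (conv z w) k = conv z (conv f w) k"
      by (metis conv_mult mult.commute)
    also have "conv f w = (\<lambda>n. of_int (coef G n))" using w by blast
    finally have "of_int (coef (f * u) k - coef (z * G) k) = conv f (\<lambda>k. of_int (coef u k) - conv z w k) k"
      by (simp add: conv_diff_right coef_mult_eq_conv)
    also have "norm \<dots> \<le> norm1 f * e" by (rule norm_conv_le[OF approx])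
    finally have "\<bar>real_of_int (coef (f * u) k - coef (z * G) k)\<bar> < 1"
      using e by (simp only: norm_of_int)
    then show ?thesis by linarith
  qed
  then have "z * G = f * u" by (intro poly_mapping_eqI) simp
  then show ?thesis by simp
qed

lemma separation:
  fixes f g :: "'d::finite laurent"
  assumes irr: "irreducible f" and g: "\<not> f dvd g" and C: "C \<ge> 0"
    and dom: "\<And>t. norm (ev g t) ^ 2 \<le> C * norm (ev f t)" and F: "finite F"
  shows "\<exists>M::real. M \<ge> 1 \<and>
    (\<forall>(S :: (int ^ 'd) set) (p :: int ^ 'd \<Rightarrow> 'd laurent).
       finite S \<longrightarrow>
       (\<forall>m\<in>S. \<forall>n\<in>S. m \<noteq> n \<longrightarrow> real_of_int (max_norm (m - n)) \<ge> M) \<longrightarrow>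
       (\<forall>n\<in>S. p n \<in> F) \<longrightarrow>
       f dvd (\<Sum>n\<in>S. laurent_monom n * p n) \<longrightarrow>
       (\<forall>n\<in>S. f dvd p n))"
proof -
  obtain w a B where w: "\<And>n. conv f w n = of_int (coef (g ^ a) n)"
    and B: "\<And>T. finite T \<Longrightarrow> (\<Sum>n\<in>T. norm (w n)) \<le> B"
    using summable_homoclinic_point[OF dom C] by blast
  have wf: "conv f w = (\<lambda>n. of_int (coef (g ^ a) n))" by (rule ext) (rule w)
  define E where "E = (\<Union>p\<in>F. supp p)"
  have E: "finite E" using F by (simp add: E_def)
  define A where "A = (\<Sum>p\<in>F. norm1 p)"
  have A: "\<bar>of_int (coef p m)\<bar> \<le> A" if "p \<in> F" for p m
  proof -
    have "\<bar>of_int (coef p m)\<bar> \<le> norm1 p"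
    proof (cases "m \<in> supp p")
      case True
      then show ?thesis unfolding norm1_def by (intro member_le_sum) auto
    qed (simp add: in_keys_iff norm1_nonneg)
    also have "\<dots> \<le> A" unfolding A_def by (rule member_le_sum[OF that]) (auto simp: norm1_nonneg F)
    finally show ?thesis .
  qed
  have A0: "A \<ge> 0" by (auto simp: A_def norm1_nonneg intro: sum_nonneg)
  define D where "D = (\<Sum>s\<in>E. max_norm s)"
  have D: "max_norm s \<le> D" if "s \<in> E" for s
    unfolding D_def by (rule member_le_sum[OF that]) (auto simp: max_norm_nonneg E)
  have D0: "D \<ge> 0" by (auto simp: D_def max_norm_nonneg intro: sum_nonneg)
  \<comment> \<open>A common bound for the sum of the absolute coefficients of any element of
    \<open>F\<close>.\<close>
  define N where "N = A * real (card E)"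
  have N0: "N \<ge> 0" using A0 by (simp add: N_def)
  \<comment> \<open>Chosen to make \<open>norm1 f * (N * \<epsilon>)\<close> smaller than 1; the
    added ones keep the denominator positive.\<close>
  define \<epsilon> where "\<epsilon> = 1 / ((1 + norm1 f) * (1 + N))"
  have pos: "(1 + norm1 f) * (1 + N) > 0" using norm1_nonneg[of f] N0 by (intro mult_pos_pos) auto
  then have \<epsilon>: "\<epsilon> > 0" by (simp add: \<epsilon>_def)
  have small: "norm1 f * (N * \<epsilon>) < 1"
  proof -
    have "norm1 f * N < (1 + norm1 f) * (1 + N)"
      using norm1_nonneg[of f] N0 by (simp add: algebra_simps add_pos_nonneg)
    then show ?thesis using pos by (simp add: \<epsilon>_def divide_simps)
  qed
  obtain R where R: "R \<ge> 1"
    "\<And>T. finite T \<Longrightarrow> (\<And>n. n \<in> T \<Longrightarrow> max_norm n \<ge> R) \<Longrightarrow> (\<Sum>n\<in>T. norm (w n)) \<le> \<epsilon>"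
    using summable_tail[OF B \<epsilon>] by blast
  \<comment> \<open>For each exponent \<open>s\<close> in \<open>E\<close> the points
    \<open>k - n - s\<close> are distinct and, since \<open>s\<close> has norm at most
    \<open>D\<close>, still at distance at least \<open>R\<close> from 0. Each \<open>s\<close> thus
    contributes at most \<open>A * \<epsilon>\<close>.\<close>
  have tail: "norm (\<Sum>n\<in>T. conv (p n) w (k - n)) \<le> N * \<epsilon>"
    if T: "finite T" "\<And>n. n \<in> T \<Longrightarrow> p n \<in> F" "\<And>n. n \<in> T \<Longrightarrow> max_norm (k - n) \<ge> R + D" for T p k
  proof -
    have "norm (\<Sum>n\<in>T. conv (p n) w (k - n)) \<le> (\<Sum>n\<in>T. \<Sum>s\<in>E. A * norm (w (k - n - s)))"
    proof (rule sum_norm_le)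
      fix n assume n: "n \<in> T"
      have "conv (p n) w (k - n) = (\<Sum>s\<in>E. of_int (coef (p n) s) * w (k - n - s))"
        by (rule conv_superset[OF E]) (use T(2)[OF n] in \<open>auto simp: E_def\<close>)
      also have "norm \<dots> \<le> (\<Sum>s\<in>E. A * norm (w (k - n - s)))"
        by (rule sum_norm_le) (use A[OF T(2)[OF n]] in \<open>simp add: norm_mult mult_right_mono\<close>)
      finally show "norm (conv (p n) w (k - n)) \<le> (\<Sum>s\<in>E. A * norm (w (k - n - s)))" .
    qed
    also have "\<dots> = (\<Sum>s\<in>E. A * (\<Sum>n\<in>T. norm (w (k - n - s))))"
      by (subst sum.swap) (simp add: sum_distrib_left)
    also have "\<dots> \<le> (\<Sum>s\<in>E. A * \<epsilon>)"
    proof (rule sum_mono, rule mult_left_mono[OF _ A0])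
      fix s assume s: "s \<in> E"
      have inj: "inj_on (\<lambda>n. k - n - s) T" by (auto simp: inj_on_def)
      have "(\<Sum>n\<in>T. norm (w (k - n - s))) = (\<Sum>l\<in>(\<lambda>n. k - n - s) ` T. norm (w l))"
        by (simp add: sum.reindex[OF inj])
      also have "\<dots> \<le> \<epsilon>"
      proof (rule R(2))
        fix l assume "l \<in> (\<lambda>n. k - n - s) ` T"
        then obtain n where n: "n \<in> T" "k - n = l + s" by (auto simp: algebra_simps)
        then show "max_norm l \<ge> R"
          using T(3)[OF n(1)] max_norm_triangle[of l s] D[OF s] by simp
      qed (use T in auto)
      finally show "(\<Sum>n\<in>T. norm (w (k - n - s))) \<le> \<epsilon>" .
    qed
    also have "\<dots> = N * \<epsilon>" by (simp add: N_def)
    finally show ?thesis .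
  qed
  \<comment> \<open>\<open>H\<close> is the cutoff radius around a translate. With separation
    \<open>2 * H\<close>, every point within \<open>H\<close> of one translate is farther than
    \<open>H\<close> from all others.\<close>
  define H where "H = R + D"
  define M where "M = real_of_int (2 * H)"
  have main: "f dvd p n0"
    if S: "finite S" and sep: "\<forall>m\<in>S. \<forall>n\<in>S. m \<noteq> n \<longrightarrow> real_of_int (max_norm (m - n)) \<ge> M"
      and p: "\<forall>n\<in>S. p n \<in> F" and dvd: "f dvd (\<Sum>n\<in>S. laurent_monom n * p n)" and n0: "n0 \<in> S"
    for S p n0
  proof -
    define z where "z = laurent_monom n0 * p n0"
    obtain q where q: "(\<Sum>n\<in>S. laurent_monom n * p n) = f * q" using dvd by (rule dvdE)
    \<comment> \<open>Convolving \<open>f * q\<close> with \<open>w\<close> gives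
      \<open>q * g ^ a\<close>, so the sum of all the contributions is integer valued.\<close>
    have total: "of_int (coef (q * g ^ a) k) = (\<Sum>n\<in>S. conv (p n) w (k - n))" for k
    proof -
      have "of_int (coef (q * g ^ a) k) = conv q (conv f w) k"
        by (simp add: coef_mult_eq_conv wf)
      also have "\<dots> = conv (f * q) w k" by (metis conv_mult mult.commute)
      also have "\<dots> = (\<Sum>n\<in>S. conv (p n) w (k - n))"
        by (simp add: conv_sum conv_mult conv_laurent_monom flip: q)
      finally show ?thesis .
    qed
    \<comment> \<open>Inside the cutoff the error comes from the other translates; outside it is the
      tail of the translate at \<open>n0\<close> alone.\<close>
    define u where "u = restr (\<lambda>k. max_norm (k - n0) < H) (q * g ^ a)"
    have z: "conv z w k = conv (p n0) w (k - n0)" for k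
      by (simp add: z_def conv_mult conv_laurent_monom)
    have approx: "norm (of_int (coef u k) - conv z w k) \<le> N * \<epsilon>" for k
    proof (cases "max_norm (k - n0) < H")
      case True
      then have "of_int (coef u k) - conv z w k = (\<Sum>n\<in>S - {n0}. conv (p n) w (k - n))"
        using S n0 by (simp add: u_def restr.rep_eq total z sum.remove[OF S n0])
      also have "norm \<dots> \<le> N * \<epsilon>"
      proof (rule tail)
        fix n assume n: "n \<in> S - {n0}"
        then have "real_of_int (max_norm (n - n0)) \<ge> real_of_int (2 * H)"
          using sep n0 by (auto simp: M_def)
        then have "max_norm (n - n0) \<ge> 2 * H" by (simp only: of_int_le_iff)
        then show "max_norm (k - n) \<ge> R + D"
          using True max_norm_triangle[of "n - k" "k - n0"] max_norm_minus_commute[of n k] by (simp add: H_def)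
        show "p n \<in> F" using p n by simp
      qed (use S in auto)
      finally show ?thesis .
    next
      case False
      then have "norm (of_int (coef u k) - conv z w k) = norm (\<Sum>n\<in>{n0}. conv (p n) w (k - n))"
        by (simp add: u_def restr.rep_eq z)
      also have "\<dots> \<le> N * \<epsilon>" by (rule tail) (use False p n0 in \<open>auto simp: H_def\<close>)
      finally show ?thesis .
    qed
    have "f dvd z * g ^ a" by (rule dvd_from_approximation[OF w small approx])
    then have "f dvd p n0 * g ^ a" by (simp add: z_def mult.assoc)
    then consider "f dvd p n0" | "f dvd g ^ a" using irreducible_laurent_dvd_mult[OF irr] by blast
    then show ?thesis
    proof cases
      case 2
      have "f dvd g ^ i \<Longrightarrow> f dvd g" for i
        by (induction i) (use irr irreducible_laurent_dvd_mult[OF irr] in \<open>auto simp: irreducible_def\<close>)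
      then show ?thesis using 2 g by blast
    qed
  qed
  show ?thesis
  proof (intro exI[of _ M] conjI allI impI ballI)
    show "M \<ge> 1" using R(1) D0 by (simp add: M_def H_def)
  qed (rule main)
qed

section \<open>Regular zeros are incompatible with codimension two\<close>

lemma box_in_open:
  fixes t :: "real ^ 'd::finite"
  assumes "open U" "t \<in> U"
  obtains \<delta> where "\<delta> > 0" "\<And>z. (\<And>i. \<bar>z $ i - t $ i\<bar> \<le> \<delta>) \<Longrightarrow> z \<in> U"
proof -
  obtain e where e: "e > 0" "ball t e \<subseteq> U" using assms open_contains_ball by blast
  define \<delta> where "\<delta> = e / (2 * real CARD('d))"
  have "z \<in> U" if "\<And>i. \<bar>z $ i - t $ i\<bar> \<le> \<delta>" for z
  proof -
    have "norm (z - t) \<le> (\<Sum>i\<in>UNIV. \<bar>(z - t) $ i\<bar>)" by (rule norm_le_l1_cart)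
    also have "\<dots> \<le> (\<Sum>i\<in>(UNIV :: 'd set). \<delta>)" by (rule sum_mono) (use that in simp)
    also have "\<dots> < e" using e(1) by (simp add: \<delta>_def)
    finally show ?thesis using e(2) by (auto simp: dist_norm norm_minus_commute)
  qed
  moreover have "\<delta> > 0" using e(1) by (simp add: \<delta>_def)
  ultimately show ?thesis using that by blast
qed

lemma e2pi_inject:
  assumes "e2pi x = e2pi y" "\<bar>x - y\<bar> < 1" shows "x = y"
proof -
  have "exp (2 * of_real pi * \<i> * of_real (x - y)) = 1"
    using assms(1) e2pi_add[of "x - y" y] by (simp add: e2pi_def)
  then obtain n :: int where "2 * pi * (x - y) = of_int (2 * n) * pi"
    by (auto simp: exp_eq_1)
  then have "x - y = of_int n" by simp
  moreover from this have "n = 0" using assms(2) by linarith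
  ultimately show ?thesis by simp
qed

lemma torus_point_nth: "torus_point t $ j = e2pi (t $ j)"
  by (simp add: torus_point_def e2pi_def)

lemma torus_point_inject:
  assumes "torus_point s = torus_point t" "\<And>j. \<bar>s $ j - t $ j\<bar> < 1" shows "s = t"
  using assms by (auto simp: vec_eq_iff torus_point_nth intro: e2pi_inject)

lemma continuous_on_torus_point: "continuous_on A torus_point"
  unfolding torus_point_def by (intro continuous_intros)

lemma torus_point_in_unitary_variety: "ev f t = 0 \<Longrightarrow> torus_point t \<in> unitary_variety f"
  by (auto simp: unitary_variety_def laurent_eval_torus_point)

lemma open_cube_subset_span: "open_cube B \<subseteq> span B"
proof
  fix x assume x: "x \<in> open_cube B"
  have "x = (\<Sum>b\<in>Basis. (x \<bullet> b) *\<^sub>R b)" by (simp add: euclidean_representation)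
  also have "\<dots> \<in> span B"
  proof (rule span_sum)
    fix b :: 'a assume "b \<in> Basis"
    then show "(x \<bullet> b) *\<^sub>R b \<in> span B"
      using x by (cases "b \<in> B") (auto simp: open_cube_def intro: span_scale span_base span_zero)
  qed
  finally show "x \<in> span B" .
qed

text \<open>An exhaustion by closed subcubes; it turns a finite decomposition into cells into a
  countable cover by compact sets, as Baire's theorem requires.\<close>

lemma open_cube_sigma_compact:
  fixes B :: "'a::euclidean_space set"
  assumes "B \<subseteq> Basis"
  obtains K :: "nat \<Rightarrow> 'a set" where "\<And>n. compact (K n)" "open_cube B = (\<Union>n. K n)"
proof -
  define K where "K n = cbox (\<Sum>b\<in>B. (1 / (real n + 1)) *\<^sub>R b) (\<Sum>b\<in>B. (1 - 1 / (real n + 1)) *\<^sub>R b)" for n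
  have inner: "(\<Sum>b\<in>B. c *\<^sub>R b) \<bullet> i = (if i \<in> B then c else 0)" if "i \<in> Basis" for c :: real and i
  proof -
    have "(\<Sum>b\<in>B. c *\<^sub>R b) \<bullet> i = (\<Sum>b\<in>B. if b = i then c else 0)"
      unfolding inner_sum_left using assms that by (intro sum.cong) (auto simp: inner_Basis)
    also have "\<dots> = (if i \<in> B then c else 0)"
      using finite_subset[OF assms finite_Basis] by simp
    finally show ?thesis .
  qed
  have K: "x \<in> K n \<longleftrightarrow> (\<forall>b\<in>B. 1 / (real n + 1) \<le> x \<bullet> b \<and> x \<bullet> b \<le> 1 - 1 / (real n + 1)) \<and> (\<forall>b\<in>Basis - B. x \<bullet> b = 0)" for x n
    unfolding K_def mem_box using assms by (auto simp: inner)
  have "open_cube B = (\<Union>n. K n)"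
  proof (intro equalityI subsetI)
    fix x assume x: "x \<in> open_cube B"
    define m where "m = Min (insert 1 ((\<lambda>b. min (x \<bullet> b) (1 - x \<bullet> b)) ` B))"
    have finB: "finite B" using finite_subset[OF assms finite_Basis] .
    have "m > 0" unfolding m_def using finB x by (subst Min_gr_iff) (auto simp: open_cube_def)
    then obtain n where n: "1 / (real n + 1) < m" using reals_Archimedean[of m] by (auto simp: inverse_eq_divide add.commute)
    have "m \<le> min (x \<bullet> b) (1 - x \<bullet> b)" if "b \<in> B" for b
      unfolding m_def by (rule Min_le) (use finB that in auto)
    then have "x \<in> K n" unfolding K using n x by (force simp: open_cube_def)
    then show "x \<in> (\<Union>n. K n)" by blast
  next
    fix x assume "x \<in> (\<Union>n. K n)"
    then obtain n where n: "x \<in> K n" by blast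
    have "1 / (real n + 1) > 0" by simp
    then have "0 < x \<bullet> b \<and> x \<bullet> b < 1" if "b \<in> B" for b
      using n that unfolding K by (smt (verit))
    then show "x \<in> open_cube B" using n unfolding K open_cube_def by simp
  qed
  moreover have "compact (K n)" for n by (simp add: K_def compact_cbox)
  ultimately show ?thesis using that by blast
qed

text \<open>The dimension is an infimum over decompositions and lies strictly below
  \<open>d - 1\<close>, so some decomposition stays below it. The form
  \<open>k + 1 < CARD('d)\<close> avoids truncated subtraction; for \<open>d = 1\<close> it leaves
  no cells.\<close>

lemma atoral_small_cells:
  fixes f :: "'d::finite laurent"
  assumes "atoral f"
  obtains D where "cell_decomposition (unitary_variety f) D" "\<And>C k. C \<in> D \<Longrightarrow> cell k C \<Longrightarrow> k + 1 < CARD('d)"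
proof -
  have "semialg_dim (unitary_variety f) < ereal (real CARD('d) - 1)"
    using assms unfolding atoral_def by (rule order_le_less_trans) simp
  then obtain D where D: "cell_decomposition (unitary_variety f) D" "max_cell_dim D < ereal (real CARD('d) - 1)"
    unfolding semialg_dim_def Inf_less_iff by auto
  have "k + 1 < CARD('d)" if "C \<in> D" "cell k C" for C k
  proof -
    have "ereal (real k) \<le> max_cell_dim D"
      unfolding max_cell_dim_def by (rule Sup_upper) (use that in auto)
    then have "ereal (real k) < ereal (real CARD('d) - 1)" using D(2) by (rule order_le_less_trans)
    then show ?thesis by simp
  qed
  then show ?thesis using that D(1) by blast
qed

text \<open>\<open>Y\<close> is a compact piece of a hyperplane, and \<open>Y0\<close> is relatively
  open there and dense in \<open>Y\<close>, since moving any point towards \<open>c\<close> enters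
  it. Baire's theorem finds an open piece of \<open>Y\<close> mapped into a single cell, whose chart
  then embeds an open piece of dimension \<open>d - 1\<close> into a space of smaller
  dimension.\<close>

lemma atoral_no_embedding:
  fixes f :: "'d::finite laurent" and \<theta> :: "real ^ 'd \<Rightarrow> complex ^ 'd"
  assumes f: "atoral f" and Y: "compact Y" "convex Y" "Y \<subseteq> {y. y $ j = 0}"
    and int: "c \<in> Y" "openin (top_of_set {y. y $ j = 0}) Y0" "Y0 \<subseteq> Y"
      "\<And>y \<epsilon>. y \<in> Y \<Longrightarrow> 0 < \<epsilon> \<Longrightarrow> \<epsilon> < 1 \<Longrightarrow> y + \<epsilon> *\<^sub>R (c - y) \<in> Y0"
    and \<theta>: "continuous_on Y \<theta>" "inj_on \<theta> Y" "\<theta> ` Y \<subseteq> unitary_variety f"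
  shows False
proof -
  let ?H = "{y :: real ^ 'd. y $ j = 0}"
  obtain D where D: "cell_decomposition (unitary_variety f) D"
    and small: "\<And>C k. C \<in> D \<Longrightarrow> cell k C \<Longrightarrow> k + 1 < CARD('d)"
    using atoral_small_cells[OF f] by blast
  \<comment> \<open>Unlike the cells, their compact subsets have closed preimages in
    \<open>Y\<close>.\<close>
  define \<K> where "\<K> = {L. compact L \<and> (\<exists>C\<in>D. L \<subseteq> C)}"
  have "\<exists>\<L>. countable \<L> \<and> \<L> \<subseteq> \<K> \<and> C = \<Union>\<L>" if C: "C \<in> D" for C
  proof -
    obtain k where "cell k C" using D C by (auto simp: cell_decomposition_def)
    then obtain B :: "(complex ^ 'd) set" and g h where B: "B \<subseteq> Basis" "homeomorphism (open_cube B) C g h"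
      unfolding cell_def by blast
    obtain K :: "nat \<Rightarrow> (complex ^ 'd) set" where K: "\<And>n. compact (K n)" "open_cube B = (\<Union>n. K n)"
      using open_cube_sigma_compact[OF B(1)] by blast
    have g: "continuous_on (open_cube B) g" "g ` open_cube B = C" using B(2) by (auto simp: homeomorphism_def)
    have "compact (g ` K n)" for n
      by (rule compact_continuous_image[OF continuous_on_subset[OF g(1)] K(1)]) (use K(2) in auto)
    moreover have "g ` K n \<subseteq> C" for n using g(2) K(2) by blast
    ultimately have "range (\<lambda>n. g ` K n) \<subseteq> \<K>" using C unfolding \<K>_def by blast
    moreover have "C = \<Union>(range (\<lambda>n. g ` K n))" using g(2) K(2) by auto
    ultimately show ?thesis by (intro exI[of _ "range (\<lambda>n. g ` K n)"]) auto
  qed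
  then obtain \<L> where \<L>: "\<And>C. C \<in> D \<Longrightarrow> countable (\<L> C) \<and> \<L> C \<subseteq> \<K> \<and> C = \<Union>(\<L> C)" by metis
  define \<L>' where "\<L>' = (\<Union>C\<in>D. \<L> C)"
  have "finite D" "\<Union>D = unitary_variety f" using D by (auto simp: cell_decomposition_def)
  moreover have "\<Union>\<L>' = (\<Union>C\<in>D. \<Union>(\<L> C))" by (auto simp: \<L>'_def)
  moreover have "\<dots> = (\<Union>C\<in>D. C)" by (rule SUP_cong) (use \<L> in auto)
  moreover have "\<L>' \<subseteq> \<K>" using \<L> unfolding \<L>'_def by blast
  moreover have "countable \<L>'"
    unfolding \<L>'_def by (rule countable_UN[OF countable_finite]) (use \<open>finite D\<close> \<L> in blast)+
  ultimately have \<L>': "countable \<L>'" "\<L>' \<subseteq> \<K>" "\<Union>\<L>' = unitary_variety f" by simp_all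
  define P where "P L = {y \<in> Y. \<theta> y \<in> L}" for L
  have closedP: "closed (P L)" if "L \<in> \<L>'" for L
  proof -
    have "closed L" using that \<L>'(2) by (auto simp: \<K>_def compact_imp_closed)
    then have "closed (Y \<inter> \<theta> -` L)"
      using continuous_on_closed_vimage[OF compact_imp_closed[OF Y(1)], of \<theta>] \<theta>(1) by (simp add: Int_commute)
    moreover have "P L = Y \<inter> \<theta> -` L" by (auto simp: P_def)
    ultimately show ?thesis by simp
  qed
  \<comment> \<open>Otherwise the complements of the \<open>P L\<close> are open and dense in
    \<open>Y\<close>, and their intersection is dense; but it is empty because the
    \<open>P L\<close> cover \<open>Y\<close>.\<close>
  have "\<exists>L\<in>\<L>'. \<not> Y \<subseteq> closure (Y - P L)"
  proof (rule ccontr)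
    assume *: "\<not> ?thesis"
    have "Y \<subseteq> closure (\<Inter>((\<lambda>L. Y - P L) ` \<L>'))"
    proof (rule Baire[OF compact_imp_closed[OF Y(1)]])
      fix T assume "T \<in> (\<lambda>L. Y - P L) ` \<L>'"
      then obtain L where L: "L \<in> \<L>'" "T = Y - P L" by auto
      have "openin (top_of_set Y) (Y \<inter> - P L)" by (rule openin_open_Int) (use closedP[OF L(1)] in auto)
      then show "openin (top_of_set Y) T \<and> Y \<subseteq> closure T" using L * by (auto simp: Diff_eq)
    qed (use \<L>'(1) in auto)
    moreover have "\<Inter>((\<lambda>L. Y - P L) ` \<L>') = {}"
    proof -
      have "\<theta> c \<in> \<Union>\<L>'" using \<theta>(3) int(1) \<L>'(3) by blast
      then have "\<L>' \<noteq> {}" by auto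
      moreover have "\<exists>L\<in>\<L>'. y \<in> P L" if "y \<in> Y" for y
      proof -
        have "\<theta> y \<in> \<Union>\<L>'" using \<theta>(3) that \<L>'(3) by blast
        then show ?thesis using that by (auto simp: P_def)
      qed
      ultimately show ?thesis by blast
    qed
    ultimately show False using int(1) by auto
  qed
  then obtain L y1 where L: "L \<in> \<L>'" and y1: "y1 \<in> Y" "y1 \<notin> closure (Y - P L)" by blast
  have "open (- closure (Y - P L))" by (simp add: open_Compl)
  then obtain e where e: "e > 0" "ball y1 e \<subseteq> - closure (Y - P L)"
    using y1(2) open_contains_ball by blast
  have ballP: "y \<in> P L" if "y \<in> Y" "y \<in> ball y1 e" for y
    using that e(2) closure_subset[of "Y - P L"] by blast
  \<comment> \<open>Small enough that \<open>y1\<close>, pushed towards \<open>c\<close> into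
    \<open>Y0\<close>, stays in the ball.\<close>
  define \<epsilon> where "\<epsilon> = min (1 / 2) (e / (2 * (1 + norm (c - y1))))"
  have pos: "1 + norm (c - y1) > 0" by (simp add: add_pos_nonneg)
  have \<epsilon>: "0 < \<epsilon>" "\<epsilon> < 1" using e(1) pos by (auto simp: \<epsilon>_def)
  define S where "S = Y0 \<inter> ball y1 e"
  have "y1 + \<epsilon> *\<^sub>R (c - y1) \<in> S"
  proof -
    have "\<epsilon> * norm (c - y1) \<le> e / (2 * (1 + norm (c - y1))) * norm (c - y1)"
      by (intro mult_right_mono) (auto simp: \<epsilon>_def)
    also have "\<dots> < e" using e(1) pos by (simp add: divide_simps)
    finally have "dist y1 (y1 + \<epsilon> *\<^sub>R (c - y1)) < e" using \<epsilon> by (simp add: dist_norm)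
    then show ?thesis using int(4)[OF y1(1) \<epsilon>] by (simp add: S_def)
  qed
  then have S_ne: "S \<noteq> {}" by blast
  have S_open: "openin (top_of_set ?H) S"
    unfolding S_def by (rule openin_Int_open[OF int(2)]) simp
  have S_Y: "S \<subseteq> Y" using int(3) by (auto simp: S_def)
  obtain C where C: "C \<in> D" "L \<subseteq> C" using L \<L>'(2) by (auto simp: \<K>_def)
  obtain k where k: "cell k C" using D C(1) by (auto simp: cell_decomposition_def)
  then obtain B :: "(complex ^ 'd) set" and g h where B: "B \<subseteq> Basis" "card B = k" "homeomorphism (open_cube B) C g h"
    by (auto simp: cell_def)
  have \<theta>S: "\<theta> ` S \<subseteq> C" using ballP S_Y C(2) unfolding S_def P_def by blast
  have h: "continuous_on C h" "h ` C = open_cube B" "inj_on h C"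
    using B(3) by (auto simp: homeomorphism_def intro: inj_on_inverseI)
  have "dim ?H \<le> dim (span B)"
  proof (rule invariance_of_dimension_subspaces[OF S_open])
    show "subspace ?H" by (auto simp: subspace_def)
    show "subspace (span B)" by (rule subspace_span)
    show "continuous_on S (h \<circ> \<theta>)"
      by (intro continuous_on_compose continuous_on_subset[OF \<theta>(1) S_Y] continuous_on_subset[OF h(1) \<theta>S])
    show "h \<circ> \<theta> \<in> S \<rightarrow> span B" using \<theta>S h(2) open_cube_subset_span[of B] unfolding Pi_def comp_def by blast
    show "inj_on (h \<circ> \<theta>) S"
      by (intro comp_inj_on inj_on_subset[OF \<theta>(2) S_Y] inj_on_subset[OF h(3) \<theta>S])
  qed (rule S_ne)
  also have "\<dots> \<le> k"
    using dim_le_card'[of B] finite_subset[OF B(1) finite_Basis] B(2) by simp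
  finally have "dim ?H \<le> k" .
  moreover have "?H = {y. axis j 1 \<bullet> y = 0}" by (simp add: inner_axis')
  moreover have "dim {y :: real ^ 'd. axis j 1 \<bullet> y = 0} = CARD('d) - 1"
    by (subst dim_special_hyperplane) (auto simp: axis_in_Basis_iff)
  ultimately show False using small[OF C(1) k] by simp
qed

lemma isCont_along_axis:
  fixes \<phi> :: "real ^ 'd::finite \<Rightarrow> real"
  assumes "continuous_on UNIV \<phi>" shows "continuous_on A (\<lambda>r. \<phi> (t + axis j r))"
proof -
  have "continuous_on A (\<lambda>r. t + r *\<^sub>R axis j (1::real))" by (intro continuous_intros)
  then have "continuous_on A (\<lambda>r. t + axis j r)" by (simp flip: axis_conv_scaleR)
  then show ?thesis using continuous_on_compose2[OF assms] by blast
qed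

text \<open>A topological implicit function theorem: near \<open>t0\<close> the function increases
  strictly in direction \<open>j\<close>, so its zeros in a box form a graph over a hyperplane piece
  \<open>Y\<close>. The graph map would embed \<open>Y\<close> into the unitary variety.\<close>

lemma atoral_no_regular_zero_aux:
  fixes f :: "'d::finite laurent" and \<phi> :: "real ^ 'd \<Rightarrow> real"
  assumes f: "atoral f"
    and deriv: "\<And>t s. ((\<lambda>s. \<phi> (t + axis j s)) has_real_derivative \<phi>' (t + axis j s)) (at s)"
    and cont: "continuous_on UNIV \<phi>" "continuous_on UNIV \<phi>'"
    and zero: "\<And>t. \<phi> t = 0 \<Longrightarrow> ev f t = 0"
    and t0: "\<phi> t0 = 0" "\<phi>' t0 > 0"
  shows False
proof -
  have "open {z. \<phi>' z > 0}" by (rule open_Collect_less) (use cont in auto)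
  then obtain \<delta>0 where \<delta>0: "\<delta>0 > 0" "\<And>z. (\<And>i. \<bar>z $ i - t0 $ i\<bar> \<le> \<delta>0) \<Longrightarrow> \<phi>' z > 0"
    using box_in_open[of "{z. \<phi>' z > 0}" t0] t0 by auto
  \<comment> \<open>The bound \<open>1 / 4\<close> keeps coordinates of points in the box less than
    1 apart, where \<open>torus_point\<close> is injective.\<close>
  define \<delta> where "\<delta> = min \<delta>0 (1 / 4)"
  have \<delta>: "\<delta> > 0" "\<delta> \<le> 1 / 4" and pos: "\<And>z. (\<And>i. \<bar>z $ i - t0 $ i\<bar> \<le> \<delta>) \<Longrightarrow> \<phi>' z > 0"
    using \<delta>0 by (auto simp: \<delta>_def)
  have increasing: "\<phi> (t + axis j a) < \<phi> (t + axis j b)"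
    if "a < b" "\<And>r i. a \<le> r \<Longrightarrow> r \<le> b \<Longrightarrow> \<bar>(t + axis j r) $ i - t0 $ i\<bar> \<le> \<delta>" for t a b
    using DERIV_pos_imp_increasing[OF that(1), of "\<lambda>r. \<phi> (t + axis j r)"] deriv pos that(2) by blast
  have near: "\<bar>axis j r $ i\<bar> \<le> \<delta>" if "\<bar>r\<bar> \<le> \<delta>" for r i
    using that \<delta>(1) by (simp add: axis_def)
  have "\<phi> (t0 + axis j 0) < \<phi> (t0 + axis j \<delta>)"
    by (rule increasing) (use \<delta>(1) in \<open>auto intro!: near\<close>)
  then have up: "\<phi> (t0 + axis j \<delta>) > 0" using t0(1) by simp
  have "\<phi> (t0 + axis j (- \<delta>)) < \<phi> (t0 + axis j 0)"
    by (rule increasing) (use \<delta>(1) in \<open>auto intro!: near\<close>)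
  then have down: "\<phi> (t0 + axis j (- \<delta>)) < 0" using t0(1) by simp
  obtain \<eta>1 where \<eta>1: "\<eta>1 > 0" "\<And>z. (\<And>i. \<bar>z $ i - (t0 + axis j \<delta>) $ i\<bar> \<le> \<eta>1) \<Longrightarrow> \<phi> z > 0"
    using box_in_open[of "{z. \<phi> z > 0}" "t0 + axis j \<delta>"] up open_Collect_less[of "\<lambda>_. 0" \<phi>] cont(1) by auto
  obtain \<eta>2 where \<eta>2: "\<eta>2 > 0" "\<And>z. (\<And>i. \<bar>z $ i - (t0 + axis j (- \<delta>)) $ i\<bar> \<le> \<eta>2) \<Longrightarrow> \<phi> z < 0"
    using box_in_open[of "{z. \<phi> z < 0}" "t0 + axis j (- \<delta>)"] down open_Collect_less[of \<phi> "\<lambda>_. 0"] cont(1) by auto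
  \<comment> \<open>The box is so thin across direction \<open>j\<close> that \<open>\<phi>\<close>
    is positive on its top face and negative on its bottom face.\<close>
  define \<eta> where "\<eta> = Min {\<delta>, \<eta>1, \<eta>2}"
  have \<eta>: "\<eta> > 0" "\<eta> \<le> \<delta>" "\<eta> \<le> \<eta>1" "\<eta> \<le> \<eta>2" using \<delta> \<eta>1 \<eta>2 by (auto simp: \<eta>_def)
  define Q where "Q = cbox (\<chi> i. if i = j then t0 $ i - \<delta> else t0 $ i - \<eta>) (\<chi> i. if i = j then t0 $ i + \<delta> else t0 $ i + \<eta>)"
  define Y where "Y = cbox (\<chi> i. if i = j then 0 else t0 $ i - \<eta>) (\<chi> i. if i = j then 0 else t0 $ i + \<eta>)"
  have Q: "z \<in> Q \<longleftrightarrow> \<bar>z $ j - t0 $ j\<bar> \<le> \<delta> \<and> (\<forall>i. i \<noteq> j \<longrightarrow> \<bar>z $ i - t0 $ i\<bar> \<le> \<eta>)" for z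
    unfolding Q_def mem_box_cart abs_diff_le_iff by simp metis
  have Y: "y \<in> Y \<longleftrightarrow> y $ j = 0 \<and> (\<forall>i. i \<noteq> j \<longrightarrow> \<bar>y $ i - t0 $ i\<bar> \<le> \<eta>)" for y
    unfolding Y_def mem_box_cart abs_diff_le_iff by simp (metis order_antisym order_refl)
  define Z where "Z = Q \<inter> {z. \<phi> z = 0}"
  define \<pi> where "\<pi> z = z - axis j (z $ j)" for z :: "real ^ 'd"
  have compactZ: "compact Z"
    unfolding Z_def Q_def by (intro compact_Int_closed compact_cbox closed_Collect_eq cont(1)) auto
  have cont_\<pi>: "continuous_on A \<pi>" for A
  proof -
    have "continuous_on A (\<lambda>z. z - (z $ j) *\<^sub>R axis j (1::real))" by (intro continuous_intros)
    then show ?thesis by (simp add: \<pi>_def[abs_def] flip: axis_conv_scaleR)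
  qed
  have box: "\<bar>(y + axis j r) $ i - t0 $ i\<bar> \<le> \<delta>" if "y \<in> Y" "\<bar>r - t0 $ j\<bar> \<le> \<delta>" for y r i
    using that \<eta>(2) by (cases "i = j") (force simp: Y axis_def)+
  have \<pi>Z: "\<pi> ` Z = Y"
  proof (intro equalityI subsetI)
    fix y assume "y \<in> \<pi> ` Z"
    then show "y \<in> Y" by (auto simp: Z_def Q Y \<pi>_def axis_def)
  next
    fix y assume y: "y \<in> Y"
    have "\<phi> (y + axis j (t0 $ j + \<delta>)) > 0"
      by (rule \<eta>1(2)) (use y \<eta> in \<open>force simp: Y axis_def\<close>)
    moreover have "\<phi> (y + axis j (t0 $ j - \<delta>)) < 0"
      by (rule \<eta>2(2)) (use y \<eta> in \<open>force simp: Y axis_def\<close>)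
    ultimately obtain r where r: "t0 $ j - \<delta> \<le> r" "r \<le> t0 $ j + \<delta>" "\<phi> (y + axis j r) = 0"
      using IVT'[of "\<lambda>r. \<phi> (y + axis j r)" "t0 $ j - \<delta>" 0 "t0 $ j + \<delta>"] isCont_along_axis[OF cont(1)] \<delta>(1) by auto
    then have "y + axis j r \<in> Z" using y by (auto simp: Z_def Q Y axis_def)
    moreover have "\<pi> (y + axis j r) = y" using y by (simp add: \<pi>_def Y vec_eq_iff axis_def)
    ultimately show "y \<in> \<pi> ` Z" by force
  qed
  have no_two: False if "y \<in> Y" "r < s" "\<bar>r - t0 $ j\<bar> \<le> \<delta>" "\<bar>s - t0 $ j\<bar> \<le> \<delta>"
      "\<phi> (y + axis j r) = 0" "\<phi> (y + axis j s) = 0" for y r s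
    using increasing[of r s y] box[of y] that by force
  have "inj_on \<pi> Z"
  proof (rule inj_onI)
    fix z z' assume z: "z \<in> Z" and z': "z' \<in> Z" and eq: "\<pi> z = \<pi> z'"
    have zz: "z = \<pi> z + axis j (z $ j)" "z' = \<pi> z + axis j (z' $ j)"
      using eq by (auto simp: \<pi>_def algebra_simps)
    have y: "\<pi> z \<in> Y" using z \<pi>Z by blast
    have "z $ j = z' $ j"
      using no_two[OF y, of "z $ j" "z' $ j"] no_two[OF y, of "z' $ j" "z $ j"] z z' zz
      by (auto simp: Z_def Q) (metis linorder_neqE_linordered_idom)
    then show "z = z'" using zz by simp
  qed
  \<comment> \<open>Compactness of \<open>Z\<close> makes the inverse of the projection
    continuous.\<close>
  then obtain \<psi> where \<psi>: "homeomorphism Z Y \<pi> \<psi>"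
    using homeomorphism_compact[OF compactZ cont_\<pi> \<pi>Z] by blast
  then have \<psi>': "continuous_on Y \<psi>" "\<psi> ` Y = Z" "\<And>y. y \<in> Y \<Longrightarrow> \<pi> (\<psi> y) = y"
    by (auto simp: homeomorphism_def)
  show False
  proof (rule atoral_no_embedding[OF f, of Y j "\<pi> t0" "{y. y $ j = 0} \<inter> (\<Inter>i\<in>UNIV - {j}. {y. \<bar>y $ i - t0 $ i\<bar> < \<eta>})" "torus_point \<circ> \<psi>"])
    show "compact Y" "convex Y" by (auto simp: Y_def compact_cbox convex_box)
    show "Y \<subseteq> {y. y $ j = 0}" "\<pi> t0 \<in> Y" using \<eta>(1) by (auto simp: Y \<pi>_def axis_def)
    show "openin (top_of_set {y. y $ j = 0}) ({y. y $ j = 0} \<inter> (\<Inter>i\<in>UNIV - {j}. {y. \<bar>y $ i - t0 $ i\<bar> < \<eta>}))"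
      by (intro openin_open_Int open_INT ballI open_Collect_less continuous_intros) auto
    show "{y. y $ j = 0} \<inter> (\<Inter>i\<in>UNIV - {j}. {y. \<bar>y $ i - t0 $ i\<bar> < \<eta>}) \<subseteq> Y"
      by (force simp: Y intro: less_imp_le)
    show "y + \<epsilon> *\<^sub>R (\<pi> t0 - y) \<in> {y. y $ j = 0} \<inter> (\<Inter>i\<in>UNIV - {j}. {y. \<bar>y $ i - t0 $ i\<bar> < \<eta>})"
      if y: "y \<in> Y" and \<epsilon>: "0 < \<epsilon>" "\<epsilon> < 1" for y \<epsilon>
    proof -
      have "\<bar>(y + \<epsilon> *\<^sub>R (\<pi> t0 - y)) $ i - t0 $ i\<bar> < \<eta>" if "i \<noteq> j" for i
      proof -
        have "(y + \<epsilon> *\<^sub>R (\<pi> t0 - y)) $ i - t0 $ i = (1 - \<epsilon>) * (y $ i - t0 $ i)"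
          using that by (simp add: \<pi>_def axis_def algebra_simps)
        also have "\<bar>\<dots>\<bar> \<le> (1 - \<epsilon>) * \<eta>"
          using y that \<epsilon> by (simp add: abs_mult Y mult_left_mono)
        also have "\<dots> < \<eta>" using \<epsilon> \<eta>(1) by (simp add: algebra_simps)
        finally show ?thesis .
      qed
      moreover have "(y + \<epsilon> *\<^sub>R (\<pi> t0 - y)) $ j = 0" using y by (simp add: Y \<pi>_def axis_def)
      ultimately show ?thesis by auto
    qed
    show "continuous_on Y (torus_point \<circ> \<psi>)"
      by (intro continuous_on_compose \<psi>'(1) continuous_on_torus_point)
    show "inj_on (torus_point \<circ> \<psi>) Y"
    proof (rule inj_onI)
      fix y y' assume y: "y \<in> Y" "y' \<in> Y" and eq: "(torus_point \<circ> \<psi>) y = (torus_point \<circ> \<psi>) y'"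
      have "\<psi> y \<in> Q" "\<psi> y' \<in> Q" using y \<psi>'(2) by (auto simp: Z_def)
      have "\<psi> y = \<psi> y'"
      proof (rule torus_point_inject)
        fix i
        have "\<bar>\<psi> y $ i - t0 $ i\<bar> \<le> 1 / 4" "\<bar>\<psi> y' $ i - t0 $ i\<bar> \<le> 1 / 4"
          using \<open>\<psi> y \<in> Q\<close> \<open>\<psi> y' \<in> Q\<close> \<eta>(2) \<delta>(2) unfolding Q by (cases "i = j"; force)+
        then show "\<bar>\<psi> y $ i - \<psi> y' $ i\<bar> < 1" by linarith
      qed (use eq in simp)
      then show "y = y'" using \<psi>'(3) y by metis
    qed
    show "(torus_point \<circ> \<psi>) ` Y \<subseteq> unitary_variety f"
      using \<psi>'(2) zero by (auto simp: Z_def intro!: torus_point_in_unitary_variety)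
  qed
qed

lemma atoral_no_regular_zero:
  fixes f :: "'d::finite laurent" and \<phi> :: "real ^ 'd \<Rightarrow> real"
  assumes f: "atoral f"
    and deriv: "\<And>t s. ((\<lambda>s. \<phi> (t + axis j s)) has_real_derivative \<phi>' (t + axis j s)) (at s)"
    and cont: "continuous_on UNIV \<phi>" "continuous_on UNIV \<phi>'"
    and zero: "\<And>t. \<phi> t = 0 \<Longrightarrow> ev f t = 0"
    and t0: "\<phi> t0 = 0"
  shows "\<phi>' t0 = 0"
proof (rule ccontr)
  assume "\<phi>' t0 \<noteq> 0"
  then consider "\<phi>' t0 > 0" | "- \<phi>' t0 > 0" by linarith
  then show False
  proof cases
    case 1
    then show ?thesis using atoral_no_regular_zero_aux[OF f deriv cont zero t0] by blast
  next
    case 2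
    show ?thesis
      by (rule atoral_no_regular_zero_aux[OF f, of "\<lambda>t. - \<phi> t" j "\<lambda>t. - \<phi>' t" t0])
         (use 2 t0 zero cont in \<open>auto intro!: DERIV_minus deriv continuous_intros\<close>)
  qed
qed

section \<open>Self-adjoint polynomials\<close>

text \<open>Applying \<open>adj\<close> twice gives \<open>q * adj q = 1\<close>. Its constant
  coefficient is the sum of the squared coefficients of \<open>q\<close>, so \<open>q\<close> is a
  monomial up to sign.\<close>

lemma self_adjoint_cases:
  fixes f :: "'d::finite laurent"
  assumes f: "f \<noteq> 0" and dvd: "f dvd adj f"
  obtains m \<sigma> where "\<sigma> = 1 \<or> \<sigma> = -1" "adj f = Poly_Mapping.single m \<sigma> * f"
proof -
  obtain q where q: "adj f = f * q" using dvd by (rule dvdE)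
  have "f * (q * adj q) = adj (adj f)" unfolding q by (simp add: adj_mult q mult_ac)
  then have "f * (q * adj q) = f * 1" by simp
  then have qq: "q * adj q = 1" using f laurent_mult_left_cancel by blast
  have "complex_of_int (coef (q * adj q) 0) = of_int (\<Sum>m\<in>supp q. coef q m * coef q m)"
    unfolding coef_mult_eq_conv conv_def by (simp add: coef_adj)
  then have sq: "(\<Sum>m\<in>supp q. coef q m * coef q m) = 1" unfolding qq of_int_eq_iff by simp
  then obtain m where m: "m \<in> supp q" by (metis sum.empty zero_neq_one all_not_in_conv)
  have ge: "coef q l * coef q l \<ge> 1" if "l \<in> supp q" for l
    using that by (simp add: in_keys_iff) (metis int_one_le_iff_zero_less not_real_square_gt_zero not_square_less_zero linorder_neqE_linordered_idom mult_eq_0_iff)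
  have split: "(\<Sum>l\<in>supp q. coef q l * coef q l) = coef q m * coef q m + (\<Sum>l\<in>supp q - {m}. coef q l * coef q l)"
    by (rule sum.remove) (use m in auto)
  have "supp q - {m} = {}"
  proof (rule ccontr)
    assume "supp q - {m} \<noteq> {}"
    then have "(\<Sum>l\<in>supp q - {m}. coef q l * coef q l) > 0"
      by (intro sum_pos) (use ge in force)+
    then show False using ge[OF m] sq split by linarith
  qed
  then have supp: "supp q = {m}" using m by blast
  then have "coef q m * coef q m = 1" using sq by simp
  then have "coef q m = 1 \<or> coef q m = -1" by (auto simp: zmult_eq_1_iff)
  moreover have "q = Poly_Mapping.single m (coef q m)" using sum_single[of q] supp by simp
  ultimately show ?thesis using that q by (metis mult.commute)
qed

text \<open>
  If \<open>adj f = \<plusminus> x\<^sup>m f\<close>, then \<open>x\<^sup>m\<^sup>/\<^sup>2\<close> is the factor which makes \<open>f\<close> real or purely imaginary on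
  the torus; \<open>twist m j\<close> is the logarithmic derivative compatible with it, without denominators.
\<close>

definition twist :: "int ^ 'd \<Rightarrow> 'd \<Rightarrow> 'd::finite laurent \<Rightarrow> 'd laurent" where
  "twist m j p = of_int (m $ j) * p + of_int 2 * euler j p"

lemma coef_twist: "coef (twist m j p) n = (m $ j + 2 * n $ j) * coef p n"
  by (simp only: twist_def lookup_add coef_of_int_mult coef_euler) (simp add: algebra_simps)

lemma ev_twist: "ev (twist m j p) t = of_int (m $ j) * ev p t + 2 * ev (euler j p) t"
  unfolding twist_def ev_add ev_mult ev_of_int by simp

lemma hcomp_twist: "hcomp j i (twist m j p) = of_int (m $ j + 2 * i) * hcomp j i p"
proof (rule poly_mapping_eqI)
  fix n show "coef (hcomp j i (twist m j p)) n = coef (of_int (m $ j + 2 * i) * hcomp j i p) n"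
    unfolding coef_of_int_mult by (simp add: hcomp_def restr.rep_eq coef_twist)
qed

text \<open>\<open>twist\<close> does not enlarge the range of degrees in \<open>j\<close>, so the
  quotient \<open>q\<close> has degree 0 in \<open>j\<close>. Comparing components gives
  \<open>q = m $ j + 2 * k\<close> for every degree \<open>k\<close> in \<open>f\<close>; there is
  only one such degree \<open>a\<close>, and the symmetry of \<open>f\<close> under
  \<open>n \<mapsto> - (n + m)\<close> forces \<open>m $ j + 2 * a = 0\<close>.\<close>

lemma dvd_twist_imp_eq_0:
  fixes f :: "'d::finite laurent"
  assumes f: "f \<noteq> 0" and \<sigma>: "\<sigma> = 1 \<or> \<sigma> = -1" and adj: "adj f = Poly_Mapping.single m \<sigma> * f"
    and dvd: "f dvd twist m j f"
  shows "twist m j f = 0"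
proof (rule ccontr)
  assume nz: "twist m j f \<noteq> 0"
  obtain q where q: "twist m j f = f * q" using dvd by (rule dvdE)
  have q0: "q \<noteq> 0" using nz q by auto
  have le: "topdeg s j q \<le> 0" if s: "s * s = 1" for s
  proof -
    have "hcomp j (s * topdeg s j (twist m j f)) (twist m j f) \<noteq> 0"
      by (rule hcomp_top_neq_0[OF s nz])
    then have "hcomp j (s * topdeg s j (twist m j f)) f \<noteq> 0" by (auto simp: hcomp_twist)
    then have "\<not> s * (s * topdeg s j (twist m j f)) > topdeg s j f" using hcomp_gt_top[OF s] by blast
    then have "topdeg s j (twist m j f) \<le> topdeg s j f" using s by (simp flip: mult.assoc)
    then show ?thesis unfolding q top_mult[OF s f q0] by simp
  qed
  have "topdeg 1 j q \<le> 0" "topdeg (-1) j q \<le> 0" using le[of 1] le[of "-1"] by auto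
  then have "width j q = 0" "topdeg 1 j q = 0"
    using width_nonneg[OF q0, of j] by (auto simp: width_def)
  then have q_hom: "hcomp j 0 q = q" using width_eq_0D[OF q0, of j] by simp
  have "n $ j = 0" if "n \<in> supp q" for n
    using that q_hom keys_hcomp[of j 0 q] by auto
  then have hq: "hcomp j k (q * f) = q * hcomp j (k - 0) f" for k
    by (rule hcomp_mult_homogeneous)
  have q_eq: "q = of_int (m $ j + 2 * k)" if "hcomp j k f \<noteq> 0" for k
  proof -
    have "hcomp j k f * q = hcomp j k f * of_int (m $ j + 2 * k)"
      using hq[of k] hcomp_twist[of j k m f] q by (simp add: mult.commute)
    then show ?thesis using that by (rule laurent_mult_left_cancel)
  qed
  define a where "a = topdeg 1 j f"
  have a: "hcomp j a f \<noteq> 0" using hcomp_top_neq_0[of 1 f j] f by (simp add: a_def)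
  have const: "n $ j = a" if n: "n \<in> supp f" for n
  proof -
    have "hcomp j (n $ j) f \<noteq> 0" using n by (auto simp: hcomp_eq_0_iff)
    then have "of_int (m $ j + 2 * n $ j) = (of_int (m $ j + 2 * a) :: 'd laurent)" using q_eq a by metis
    then show ?thesis by (simp only: of_int_eq_iff)
  qed
  obtain n where n: "n \<in> supp f" using f by fastforce
  have "complex_of_int (coef (adj f) (n + m)) = of_int \<sigma> * of_int (coef f n)"
    unfolding adj coef_mult_eq_conv conv_single by simp
  then have "coef f (- (n + m)) \<noteq> 0" using n \<sigma> by (auto simp: coef_adj in_keys_iff)
  then have "- (n $ j + m $ j) = a" using const[of "- (n + m)"] by (simp add: in_keys_iff)
  then have "m $ j + 2 * a = 0" using const[OF n] by simp
  then have "q = 0" using q_eq[OF a] by simp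
  then show False using q0 by simp
qed

text \<open>The factor \<open>x ^ (m / 2)\<close>, which lives on \<open>real ^ 'd\<close>: it is
  periodic only up to sign.\<close>

definition half :: "int ^ 'd \<Rightarrow> real ^ 'd::finite \<Rightarrow> complex" where
  "half m t = e2pi (pairing m t / 2)"

lemma norm_half [simp]: "norm (half m t) = 1"
  by (simp add: half_def)

lemma half_ev_has_vector_derivative:
  "((\<lambda>s. half m (t + axis j s) * ev p (t + axis j s)) has_vector_derivative
     of_real pi * \<i> * (half m (t + axis j s) * ev (twist m j p) (t + axis j s))) (at s)"
proof -
  define h where "h z = exp (2 * of_real pi * \<i> * ((of_real (pairing m t) + of_int (m $ j) * z) / 2))" for z
  have h: "half m (t + axis j s) = h (of_real s)" for s
    by (simp add: half_def h_def e2pi_def pairing_add_right pairing_axis_right)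
  have "(h has_field_derivative of_real pi * \<i> * of_int (m $ j) * h (of_real s)) (at (of_real s))"
    unfolding h_def[abs_def] by (auto intro!: derivative_eq_intros)
  from has_vector_derivative_real_field[OF this]
  have "((\<lambda>s. half m (t + axis j s)) has_vector_derivative of_real pi * \<i> * of_int (m $ j) * half m (t + axis j s)) (at s)"
    by (simp add: h)
  from has_vector_derivative_mult[OF this ev_has_vector_derivative[of p t j s]]
  show ?thesis by (simp add: ev_twist algebra_simps)
qed

lemma continuous_on_half_ev: "continuous_on A (\<lambda>t. half m t * ev p t)"
  unfolding half_def pairing_def by (intro continuous_intros) auto

lemma ev_lring_axis:
  assumes "k \<in> lring (UNIV - {j})" shows "ev k (t + axis j r) = ev k t"
  using assms by (auto simp: ev_def lring_def pairing_add_right pairing_axis_right intro!: sum.cong)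

section \<open>Functions of constant sign\<close>

lemma nonneg_derivative_bound:
  fixes \<phi> \<phi>' :: "real \<Rightarrow> real"
  assumes deriv: "\<And>s. (\<phi> has_real_derivative \<phi>' s) (at s)" and nonneg: "\<And>s. \<phi> s \<ge> 0"
    and lip: "\<And>s. \<bar>\<phi>' s - \<phi>' 0\<bar> \<le> K * \<bar>s\<bar>" and K: "K > 0"
  shows "\<phi>' 0 ^ 2 \<le> 4 * K * \<phi> 0"
proof (cases "\<phi>' 0 = 0")
  case True
  then show ?thesis using K nonneg[of 0] by simp
next
  case False
  \<comment> \<open>The minimiser of the quadratic upper bound
    \<open>\<phi> 0 + s * \<phi>' 0 + K * s\<^sup>2\<close>, which must be nonnegative
    there.\<close>
  define s where "s = - \<phi>' 0 / (2 * K)"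
  have s0: "s \<noteq> 0" using False K by (simp add: s_def)
  obtain \<xi> where \<xi>: "\<bar>\<xi>\<bar> \<le> \<bar>s\<bar>" "\<phi> s - \<phi> 0 = s * \<phi>' \<xi>"
  proof (cases "s > 0")
    case True
    then show ?thesis using MVT2[of 0 s \<phi> \<phi>'] deriv that by force
  next
    case False
    then have "s < 0" using s0 by simp
    then obtain z where "s < z" "z < 0" "\<phi> 0 - \<phi> s = (0 - s) * \<phi>' z" using MVT2[of s 0 \<phi> \<phi>'] deriv by blast
    then show ?thesis using that[of z] by simp
  qed
  have "s * (\<phi>' \<xi> - \<phi>' 0) \<le> \<bar>s\<bar> * \<bar>\<phi>' \<xi> - \<phi>' 0\<bar>" by (metis abs_ge_self abs_mult)
  also have "\<dots> \<le> \<bar>s\<bar> * (K * \<bar>s\<bar>)"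
    using lip[of \<xi>] \<xi>(1) K by (intro mult_left_mono order_trans[OF lip]) auto
  also have "\<dots> = K * s\<^sup>2" by (simp add: power2_eq_square)
  finally have "\<phi> s \<le> \<phi> 0 + s * \<phi>' 0 + K * s\<^sup>2" using \<xi>(2) by (simp add: right_diff_distrib)
  also have "\<dots> = \<phi> 0 - (\<phi>' 0)\<^sup>2 / (4 * K)" using K by (simp add: s_def power2_eq_square field_simps)
  finally have "(\<phi>' 0)\<^sup>2 / (4 * K) \<le> \<phi> 0" using nonneg[of s] by simp
  then show ?thesis using K by (simp add: divide_simps mult_ac split: if_splits)
qed

text \<open>Starting at \<open>x\<close>, the coordinates are moved to those of \<open>y\<close> one
  at a time. Without a sign change along an axis the value stays nonnegative, and a small
  perturbation makes it positive again; so positive values occur arbitrarily close to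
  \<open>y\<close>.\<close>

lemma sign_change_along_axis:
  fixes \<phi> :: "real ^ 'd::finite \<Rightarrow> real"
  assumes cont: "continuous_on UNIV \<phi>"
    and dense: "\<And>U. open U \<Longrightarrow> U \<noteq> {} \<Longrightarrow> \<exists>t\<in>U. \<phi> t \<noteq> 0"
    and x: "\<phi> x > 0" and y: "\<phi> y < 0"
  shows "\<exists>t j s. \<phi> t > 0 \<and> \<phi> (t + axis j s) < 0"
proof (rule ccontr)
  assume "\<not> ?thesis"
  then have H: "\<phi> (t + axis j s) \<ge> 0" if "\<phi> t > 0" for t j s using that by (meson not_le)
  have "open {z. \<phi> z < 0}" by (rule open_Collect_less) (use cont in auto)
  then obtain \<delta> where \<delta>: "\<delta> > 0" "\<And>z. (\<And>i. \<bar>z $ i - y $ i\<bar> \<le> \<delta>) \<Longrightarrow> \<phi> z < 0"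
    using box_in_open[of "{z. \<phi> z < 0}" y] y by auto
  have "finite (UNIV :: 'd set)" by simp
  then have "\<exists>t. \<phi> t > 0 \<and> (\<forall>i\<in>UNIV. \<bar>t $ i - y $ i\<bar> < \<delta>)"
  proof (induction rule: finite_induct)
    case empty
    then show ?case using x by auto
  next
    case (insert j J)
    then obtain t where t: "\<phi> t > 0" "\<forall>i\<in>J. \<bar>t $ i - y $ i\<bar> < \<delta>" by blast
    define r where "r = y $ j - t $ j"
    \<comment> \<open>Open, so that density of the nonzero set provides a perturbed endpoint which
      is reached from a positive value and is still close to \<open>y\<close> in the coordinates
      treated.\<close>
    define V where "V = {z. 0 < \<phi> (z - axis j r)} \<inter> (\<Inter>i\<in>insert j J. {z. \<bar>z $ i - y $ i\<bar> < \<delta>})"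
    have "continuous_on UNIV (\<lambda>z. \<phi> (z - axis j r))"
      by (rule continuous_on_compose2[OF cont]) (intro continuous_intros, simp)
    then have "open V" unfolding V_def
      by (intro open_Int open_INT ballI open_Collect_less continuous_intros) (use insert.hyps in auto)
    moreover have "t + axis j r \<in> V"
      using t insert.hyps \<delta>(1) by (auto simp: V_def r_def axis_def)
    ultimately obtain z where z: "z \<in> V" "\<phi> z \<noteq> 0" using dense[of V] by blast
    then have "\<phi> (z - axis j r + axis j r) \<ge> 0" by (intro H) (simp add: V_def)
    then have "\<phi> z > 0" using z(2) by simp
    then show ?case using z(1) by (auto simp: V_def)
  qed
  then obtain t where t: "\<phi> t > 0" "\<And>i. \<bar>t $ i - y $ i\<bar> < \<delta>" by auto
  have "\<phi> t < 0" by (rule \<delta>(2)) (use t(2) in \<open>auto intro: less_imp_le\<close>)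
  then show False using t(1) by simp
qed

lemma self_adjoint_dominated:
  fixes f :: "'d::finite laurent"
  assumes irr: "irreducible f" and ator: "atoral f" and \<sigma>: "\<sigma> = 1 \<or> \<sigma> = -1"
    and adj: "adj f = Poly_Mapping.single m \<sigma> * f" and j0: "twist m j0 f \<noteq> 0"
  obtains C where "C \<ge> 0" "\<And>t. norm (ev (twist m j0 f) t) ^ 2 \<le> C * norm (ev f t)"
proof -
  have f0: "f \<noteq> 0" using irr by (auto simp: irreducible_def)
  \<comment> \<open>For \<sigma> = -1 the function \<open>half m t * ev f t\<close> is purely
    imaginary, and the factor \<i> makes it real.\<close>
  define \<kappa> where "\<kappa> = (if \<sigma> = 1 then 1 else \<i>)"
  have \<kappa>: "norm \<kappa> = 1" "cnj \<kappa> * of_int \<sigma> = \<kappa>" using \<sigma> by (auto simp: \<kappa>_def)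
  define \<Phi> where "\<Phi> t = \<kappa> * (half m t * ev f t)" for t
  define \<Phi>' where "\<Phi>' j t = \<kappa> * (of_real pi * \<i> * (half m t * ev (twist m j f) t))" for j t
  define \<Phi>'' where "\<Phi>'' j t = \<kappa> * (of_real pi * \<i> * (of_real pi * \<i> * (half m t * ev (twist m j (twist m j f)) t)))" for j t
  have deriv: "((\<lambda>s. \<Phi> (t + axis j s)) has_vector_derivative \<Phi>' j (t + axis j s)) (at s)" for t j s
    unfolding \<Phi>_def \<Phi>'_def by (intro has_vector_derivative_mult_right half_ev_has_vector_derivative)
  have deriv2: "((\<lambda>s. \<Phi>' j (t + axis j s)) has_vector_derivative \<Phi>'' j (t + axis j s)) (at s)" for t j s
    unfolding \<Phi>'_def \<Phi>''_def by (intro has_vector_derivative_mult_right half_ev_has_vector_derivative)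
  have real: "\<Phi> t \<in> \<real>" for t
  proof -
    have "cnj (ev f t) = of_int \<sigma> * e2pi (pairing m t) * ev f t"
      unfolding ev_adj[symmetric] adj ev_mult ev_single ..
    moreover have "cnj (half m t) * e2pi (pairing m t) = half m t"
      by (simp add: half_def cnj_e2pi flip: e2pi_add)
    ultimately have "cnj (\<Phi> t) = (cnj \<kappa> * of_int \<sigma>) * (half m t * ev f t)"
      by (simp add: \<Phi>_def mult_ac)
    also have "\<dots> = \<Phi> t" by (simp add: \<kappa>(2) \<Phi>_def)
    finally show ?thesis by (simp add: complex_cnj_cancel_iff Reals_cnj_iff)
  qed
  define \<phi> where "\<phi> t = Re (\<Phi> t)" for t
  define \<phi>' where "\<phi>' j t = Re (\<Phi>' j t)" for j t
  have \<phi>: "\<bar>\<phi> t\<bar> = norm (ev f t)" for t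
    using in_Reals_norm[OF real[of t]] by (simp add: \<phi>_def \<Phi>_def norm_mult \<kappa>(1))
  have d\<phi>: "((\<lambda>s. \<phi> (t + axis j s)) has_real_derivative \<phi>' j (t + axis j s)) (at s)" for t j s
    unfolding \<phi>_def \<phi>'_def by (rule has_field_derivative_Re[OF deriv])
  have \<phi>': "\<bar>\<phi>' j t\<bar> = pi * norm (ev (twist m j f) t)" for j t
  proof -
    have "((\<lambda>s. Im (\<Phi> (t + axis j s))) has_real_derivative Im (\<Phi>' j (t + axis j 0))) (at 0)"
      by (rule has_field_derivative_Im[OF deriv])
    \<comment> \<open>As \<Phi> is real, so is its derivative, and passing to real parts loses
      nothing of its modulus.\<close>
    moreover have "(\<lambda>s. Im (\<Phi> (t + axis j s))) = (\<lambda>s. 0)" using real by (simp add: complex_is_Real_iff)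
    ultimately have "Im (\<Phi>' j t) = 0" using DERIV_unique[OF _ DERIV_const] by force
    then have "\<bar>\<phi>' j t\<bar> = norm (\<Phi>' j t)" by (simp add: \<phi>'_def cmod_def)
    then show ?thesis by (simp add: \<Phi>'_def norm_mult \<kappa>(1))
  qed
  have cont: "continuous_on UNIV \<phi>" "continuous_on UNIV (\<phi>' j)" for j
    unfolding \<phi>_def[abs_def] \<phi>'_def[abs_def] \<Phi>_def \<Phi>'_def
    by (intro continuous_on_Re continuous_on_mult continuous_on_const continuous_on_half_ev)+
  have zero: "\<phi> t = 0 \<longleftrightarrow> ev f t = 0" for t using \<phi>[of t] by auto
  have no_sign_change: False if x: "\<phi> x > 0" and y: "\<phi> y < 0" for x y
  proof -
    have "\<exists>t\<in>U. \<phi> t \<noteq> 0" if "open U" "U \<noteq> {}" for U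
      using ev_neq_0_on_open[OF f0 that] zero by blast
    then obtain t j s where t: "\<phi> t > 0" "\<phi> (t + axis j s) < 0"
      using sign_change_along_axis[OF cont(1) _ x y] by blast
    have "twist m j f \<noteq> 0"
    proof
      assume "twist m j f = 0"
      then have "\<phi>' j t = 0" for t using \<phi>'[of j t] by simp
      then have "\<phi> (t + axis j s) = \<phi> (t + axis j 0)"
        using d\<phi>[of t j] by (intro DERIV_isconst_all[of "\<lambda>s. \<phi> (t + axis j s)"]) auto
      then show False using t by simp
    qed
    then have "\<not> f dvd twist m j f" using dvd_twist_imp_eq_0[OF f0 \<sigma> adj] by blast
    then obtain k u v where k: "k \<in> lring (UNIV - {j})" "k \<noteq> 0" "k = u * f + v * twist m j f"
      using irreducible_laurent_elimination[OF irr] by blast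
    \<comment> \<open>An open set of starting points with a sign change along direction
      \<open>j\<close>; one of them avoids the zeros of the eliminant \<open>k\<close>.\<close>
    define U where "U = {z. 0 < \<phi> z} \<inter> {z. \<phi> (z + axis j s) < 0}"
    have "continuous_on UNIV (\<lambda>z. \<phi> (z + axis j s))"
      by (rule continuous_on_compose2[OF cont(1)]) (intro continuous_intros, simp)
    then have "open U" unfolding U_def
      by (intro open_Int open_Collect_less) (use cont(1) in auto)
    moreover have "U \<noteq> {}" using t by (auto simp: U_def)
    ultimately obtain z where z: "z \<in> U" "ev k z \<noteq> 0" using ev_neq_0_on_open[OF k(2)] by blast
    have cz: "continuous_on A (\<lambda>r. \<phi> (z + axis j r))" for A by (rule isCont_along_axis[OF cont(1)])
    have "\<phi> (z + axis j 0) > 0" "\<phi> (z + axis j s) < 0" using z(1) by (auto simp: U_def)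
    then obtain r where r: "\<phi> (z + axis j r) = 0"
      using IVT2'[of "\<lambda>r. \<phi> (z + axis j r)" s 0 0] IVT'[of "\<lambda>r. \<phi> (z + axis j r)" s 0 0] cz
      by (metis less_imp_le linear)
    define t0 where "t0 = z + axis j r"
    \<comment> \<open>\<open>k\<close> does not involve the variable \<open>j\<close>, so its
      nonzero value at \<open>z\<close> persists at the zero \<open>t0\<close> of \<open>f\<close>,
      and the derivative cannot vanish there.\<close>
    have "ev k t0 \<noteq> 0" using z(2) ev_lring_axis[OF k(1)] by (simp add: t0_def)
    moreover have "ev f t0 = 0" using r zero by (simp add: t0_def)
    ultimately have "ev (twist m j f) t0 \<noteq> 0" by (auto simp: k(3) ev_add ev_mult)
    then have "\<phi>' j t0 \<noteq> 0" using \<phi>'[of j t0] by auto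
    moreover have "\<phi>' j t0 = 0"
      by (rule atoral_no_regular_zero[OF ator d\<phi> cont]) (use zero r t0_def in auto)
    ultimately show False by simp
  qed
  define K where "K = 1 + pi * pi * norm1 (twist m j0 (twist m j0 f))"
  have K: "K > 0" unfolding K_def by (intro add_pos_nonneg mult_nonneg_nonneg norm1_nonneg) auto
  have bound: "norm (\<Phi>'' j0 t) \<le> K" for t
  proof -
    have "norm (\<Phi>'' j0 t) = pi * pi * norm (ev (twist m j0 (twist m j0 f)) t)"
      by (simp add: \<Phi>''_def norm_mult \<kappa>(1))
    also have "\<dots> \<le> pi * pi * norm1 (twist m j0 (twist m j0 f))"
      by (intro mult_left_mono norm_ev_le) auto
    finally show ?thesis by (simp add: K_def)
  qed
  have lip: "\<bar>\<phi>' j0 (t + axis j0 s) - \<phi>' j0 (t + axis j0 0)\<bar> \<le> K * \<bar>s\<bar>" for t s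
  proof -
    have "norm (\<Phi>' j0 (t + axis j0 s) - \<Phi>' j0 (t + axis j0 0)) \<le> K * \<bar>s - 0\<bar>"
      by (rule vector_differentiable_bound[OF deriv2 bound])
    then show ?thesis
      using abs_Re_le_cmod[of "\<Phi>' j0 (t + axis j0 s) - \<Phi>' j0 (t + axis j0 0)"] by (simp add: \<phi>'_def)
  qed
  have main: "\<phi>' j0 t ^ 2 \<le> 4 * K * \<bar>\<phi> t\<bar>" for t
  proof (cases "\<forall>t. \<phi> t \<ge> 0")
    case True
    have "\<phi>' j0 (t + axis j0 0) ^ 2 \<le> 4 * K * \<phi> (t + axis j0 0)"
      by (rule nonneg_derivative_bound[OF d\<phi> _ lip K]) (use True in auto)
    then show ?thesis using True by simp
  next
    case False
    then have neg: "\<phi> t \<le> 0" for t using no_sign_change by (meson not_le)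
    have "(- \<phi>' j0 (t + axis j0 0)) ^ 2 \<le> 4 * K * (- \<phi> (t + axis j0 0))"
      by (rule nonneg_derivative_bound[OF DERIV_minus[OF d\<phi>] _ _ K])
         (use neg lip in \<open>auto simp: abs_minus_commute\<close>)
    then show ?thesis using neg[of t] by simp
  qed
  have "norm (ev (twist m j0 f) t) ^ 2 \<le> (4 * K / pi ^ 2) * norm (ev f t)" for t
  proof -
    have "pi ^ 2 * norm (ev (twist m j0 f) t) ^ 2 = \<bar>\<phi>' j0 t\<bar> ^ 2"
      unfolding \<phi>' by (simp add: power_mult_distrib)
    also have "\<dots> \<le> 4 * K * norm (ev f t)" using main[of t] \<phi>[of t] by simp
    finally show ?thesis by (simp add: divide_simps mult.commute)
  qed
  moreover have "4 * K / pi ^ 2 \<ge> 0" using K by simp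
  ultimately show ?thesis using that by blast
qed

lemma irreducible_atoral_dominated:
  fixes f :: "'d::finite laurent"
  assumes irr: "irreducible f" and ator: "atoral f"
  obtains g C where "\<not> f dvd g" "C \<ge> 0" "\<And>t. norm (ev g t) ^ 2 \<le> C * norm (ev f t)"
proof -
  have f0: "f \<noteq> 0" and unit: "\<not> f dvd 1" using irr by (auto simp: irreducible_def)
  show ?thesis
  proof (cases "f dvd adj f")
    case False
    have "norm (ev (adj f) t) ^ 2 \<le> norm1 f * norm (ev f t)" for t
      by (simp add: ev_adj power2_eq_square mult_right_mono norm_ev_le)
    then show ?thesis using that[OF False norm1_nonneg] by blast
  next
    case True
    obtain m \<sigma> where m: "\<sigma> = 1 \<or> \<sigma> = -1" "adj f = Poly_Mapping.single m \<sigma> * f"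
      using self_adjoint_cases[OF f0 True] by blast
    show ?thesis
    proof (cases "\<exists>j. twist m j f \<noteq> 0")
      case True
      then obtain j where j: "twist m j f \<noteq> 0" by blast
      obtain C where "C \<ge> 0" "\<And>t. norm (ev (twist m j f) t) ^ 2 \<le> C * norm (ev f t)"
        using self_adjoint_dominated[OF irr ator m j] by blast
      moreover have "\<not> f dvd twist m j f" using dvd_twist_imp_eq_0[OF f0 m] j by blast
      ultimately show ?thesis using that by blast
    next
      case False
      \<comment> \<open>All twists vanish only if \<open>f\<close> is an integer times a monomial.
        Then its modulus on the torus is constant and at least 1, and \<open>g = 1\<close>
        works.\<close>
      have eq: "2 * n $ j = - m $ j" if "n \<in> supp f" for n j
      proof -
        have "coef (twist m j f) n = 0" using False by simp
        then show ?thesis using that by (simp add: coef_twist in_keys_iff)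
      qed
      obtain n where n: "n \<in> supp f" using f0 by fastforce
      have "n' = n" if "n' \<in> supp f" for n'
      proof -
        have "n' $ j = n $ j" for j using eq[OF that, of j] eq[OF n, of j] by linarith
        then show ?thesis by (simp add: vec_eq_iff)
      qed
      then have supp: "supp f = {n}" using n by blast
      have c: "\<bar>coef f n\<bar> \<ge> 1" using n by (simp add: in_keys_iff)
      have "norm (ev 1 t) ^ 2 \<le> 1 * norm (ev f t)" for t
      proof -
        have "norm (ev f t) = \<bar>of_int (coef f n)\<bar>" by (simp add: ev_def supp norm_mult)
        then show ?thesis using c by (simp flip: of_int_abs)
      qed
      then show ?thesis using that[OF unit, of 1] by simp
    qed
  qed
qed

theorem corollary1p7:
  fixes f :: "'d::finite laurent" and F :: "'d laurent set"
  assumes "irreducible f" and "atoral f" and "finite F" and "F \<noteq> {}"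
  shows "\<exists>M::real. M \<ge> 1 \<and>
    (\<forall>(S :: (int ^ 'd) set) (p :: int ^ 'd \<Rightarrow> 'd laurent).
       finite S \<longrightarrow>
       (\<forall>m\<in>S. \<forall>n\<in>S. m \<noteq> n \<longrightarrow> real_of_int (max_norm (m - n)) \<ge> M) \<longrightarrow>
       (\<forall>n\<in>S. p n \<in> F) \<longrightarrow>
       f dvd (\<Sum>n\<in>S. laurent_monom n * p n) \<longrightarrow>
       (\<forall>n\<in>S. f dvd p n))"
proof (rule irreducible_atoral_dominated[OF assms(1,2)])
  fix g C assume "\<not> f dvd g" "C \<ge> 0" "\<And>t. norm (ev g t) ^ 2 \<le> C * norm (ev f t)"
  then show ?thesis by (rule separation[OF assms(1) _ _ _ assms(3)])
qed

end
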